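(* The compact non-singular smooth flow $$(N,Y) = \left((\mathbb{R}/\mathbb{Z})^2,\ \sin(2\pi x)\frac{d}{dx}+\cos(2\pi x)\frac{d}{dy}\right),$$ where $x,y$ are the standard coordinates on $(\mathbb{R}/\mathbb{Z})^2$, does not support any strongly adapted $1$-form. In particular, one cannot embed $(N,Y)$ into $\mathrm{Well}(\mathbb{R}^m,V)$, $\mathrm{Well}(M,V)$, $\mathrm{NLW}((\mathbb{R}/\mathbb{Z})^d,\mathbb{R}^m,V)$, or $\mathrm{NLW}((\mathbb{R}/\mathbb{Z})^d,M,V)$ for any $d\geq 0$, $m\geq 1$, Riemannian manifold $M$, and smooth potential $V$ (on $\mathbb{R}^m$ or $M$ respectively).
   Context: All vector fields, differential forms, Riemannian metrics and potential functions are smooth. A smooth flow is a pair $(N,Y)$ of a smooth manifold $N$ and a vector field $Y$ on $N$; it is compact if $N$ is compact, and non-singular if $Y$ is nowhere vanishing. A trajectory is a solution $u\colon I\to N$ of $\partial_t u = Y(u)$ on an interval $I\subset\mathbb{R}$. A morphism from $(N,Y)$ to $(N',Y')$ is a smooth map $\phi\colon N\to N'$ with $d\phi(Y(y)) = Y'(\phi(y))$ for all $y\in N$ (equivalently, it maps trajectories to trajectories). An embedding is a morphism that is also an injective immersion. Strongly adapted: a $1$-form $\theta$ on $N$ is strongly adapted to $(N,Y)$ if the function $\theta(Y)$ is strictly positive everywhere and the Lie derivative $\mathcal{L}_Y\theta$ is exact, i.e. $\mathcal{L}_Y\theta = dL$ for some smooth $L\colon N\to\mathbb{R}$. $\mathrm{Well}(M,V)$: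 for a Riemannian manifold $(M,g)$ and smooth $V\colon M\to\mathbb{R}$, this is the smooth flow on the cotangent bundle $T^*M$ (points $(q,p)$, $q\in M$, $p\in T_q^*M$) given by the Hamiltonian $H(q,p)=\frac12|p|^2_{g(q)^{-1}}+V(q)$ with respect to the usual symplectic form $\sum_i dq_i\wedge dp_i$; its equations of motion are $$\partial_t q = g(q)^{-1}\cdot p,\qquad \nabla_t p = -(dV)(q),$$ where $g(q)^{-1}\cdot p\in T_qM$ is the vector dual to $p$ under $g(q)$ and $\nabla_t$ is the covariant derivative along $q$ (pullback by $q$ of the Levi-Civita connection). $\mathrm{Well}(\mathbb{R}^m,V)$ is the case of $\mathbb{R}^m$ with the Euclidean metric: the flow $\partial_t q=p$, $\partial_t p=-(\nabla_{\mathbb{R}^m}V)(q)$ on $T^*\mathbb{R}^m=\mathbb{R}^m\times\mathbb{R}^m$. $\mathrm{NLW}((\mathbb{R}/\mathbb{Z})^d,M,V)$: this is the formal (infinite-dimensional) system for pairs $(q,p)$, where at each time $q\colon(\mathbb{R}/\mathbb{Z})^d\to M$ is smooth and $p(x)\in T^*_{q(x)}M$ depends smoothly on $x\in(\mathbb{R}/\mathbb{Z})^d$ (i.e. $(q,p)\in C^\infty((\mathbb{R}/\mathbb{Z})^d\to T^*M)$), with equations of motion $$\partial_t q = g(q)^{-1}\cdot p,\qquad \nabla_t p = \sum_{k=1}^d g(q)\cdot\nabla_{x_k}\partial_{x_k}q-(dV)(q),$$ where $g(q)\cdot v$ is the covector dual to $v$ and $\nabla_t,\nabla_{x_k}$ are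 covariant derivatives from the pullback by $q$ of the Levi-Civita connection. For $d=0$ this is $\mathrm{Well}(M,V)$. $\mathrm{NLW}((\mathbb{R}/\mathbb{Z})^d,\mathbb{R}^m,V)$ is the Euclidean case: on $C^\infty((\mathbb{R}/\mathbb{Z})^d\to\mathbb{R}^m)\times C^\infty((\mathbb{R}/\mathbb{Z})^d\to\mathbb{R}^m)$, $$\partial_t q=p,\qquad \partial_t p=\sum_{k=1}^d\partial_{x_k}^2 q-(\nabla_{\mathbb{R}^m}V)(q).$$ An embedding of $(N,Y)$ into one of these $\mathrm{NLW}$ systems is an injective immersion $\phi$ from $N$ to the phase space, smooth in the Gâteaux sense (in particular $(y,x)\mapsto\phi(y)(x)$ is smooth on $N\times(\mathbb{R}/\mathbb{Z})^d$), which maps trajectories of $(N,Y)$ to solutions of the system. Immersion means that for every $y\in N$ and nonzero $v\in T_yN$, the derivative of $\phi$ at $y$ in the direction $v$ is not identically zero as a function of $x$. *)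

theory Defs
  imports "HOL-Analysis.Analysis"
begin

section \<open>Smooth functions on open subsets of normed spaces\<close>

abbreviation fderiv :: "('a::real_normed_vector \<Rightarrow> 'b::real_normed_vector) \<Rightarrow> 'a \<Rightarrow> 'a \<Rightarrow> 'b"
  where "fderiv f x \<equiv> frechet_derivative f (at x)"

text \<open>Only used for open subsets of finite-dimensional spaces, where continuity of all
  iterated directional derivatives is continuity of the iterated Frechet derivatives.\<close>

primrec Ck_on :: "nat \<Rightarrow> 'a::real_normed_vector set \<Rightarrow> ('a \<Rightarrow> 'b::real_normed_vector) \<Rightarrow> bool"
  where
    "Ck_on 0 S f \<longleftrightarrow> continuous_on S f"
  | "Ck_on (Suc k) S f \<longleftrightarrow>
       (\<forall>x\<in>S. f differentiable (at x)) \<and> (\<forall>v. Ck_on k S (\<lambda>x. fderiv f x v))"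

definition smooth_on :: "'a::real_normed_vector set \<Rightarrow> ('a \<Rightarrow> 'b::real_normed_vector) \<Rightarrow> bool"
  where "smooth_on S f \<longleftrightarrow> (\<forall>k. Ck_on k S f)"


section \<open>Smooth manifolds\<close>

text \<open>A chart is a domain together with a coordinate map into a finite-dimensional inner product
  space \<open>'e\<close>; the values of the coordinate map outside the domain are irrelevant. A manifold is
  given by an atlas (not necessarily maximal), which also determines its points and its topology.
  The class \<open>real_inner\<close> rather than \<open>euclidean_space\<close> is used for \<open>'e\<close> so that
  manifolds of dimension 0 are included; finite-dimensionality is demanded in
  \<open>smooth_manifold\<close>.\<close>

type_synonym ('m, 'e) chart = "'m set \<times> ('m \<Rightarrow> 'e)"

definition points :: "('m, 'e) chart set \<Rightarrow> 'm set"
  where "points A = (\<Union>c\<in>A. fst c)"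

definition atlas_topology :: "('m, 'e::real_inner) chart set \<Rightarrow> 'm topology"
  where "atlas_topology A =
    topology (\<lambda>W. W \<subseteq> points A \<and> (\<forall>c\<in>A. open (snd c ` (W \<inter> fst c))))"

definition chart_inv :: "('m, 'e) chart \<Rightarrow> 'e \<Rightarrow> 'm"
  where "chart_inv c = inv_into (fst c) (snd c)"

definition local_rep ::
    "('m, 'e) chart \<Rightarrow> ('n, 'f) chart \<Rightarrow> ('m \<Rightarrow> 'n) \<Rightarrow> 'e \<Rightarrow> 'f"
  where "local_rep c c' f = snd c' \<circ> f \<circ> chart_inv c"

definition transition :: "('m, 'e) chart \<Rightarrow> ('m, 'e) chart \<Rightarrow> 'e \<Rightarrow> 'e"
  where "transition c c' = local_rep c c' (\<lambda>y. y)"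

definition smooth_manifold :: "('m, 'e::real_inner) chart set \<Rightarrow> bool"
  where "smooth_manifold A \<longleftrightarrow>
    (\<exists>B::'e set. finite B \<and> span B = UNIV) \<and>
    (\<forall>c\<in>A. inj_on (snd c) (fst c) \<and> open (snd c ` fst c)) \<and>
    (\<forall>c\<in>A. \<forall>c'\<in>A. open (snd c ` (fst c \<inter> fst c')) \<and>
       smooth_on (snd c ` (fst c \<inter> fst c')) (transition c c')) \<and>
    Hausdorff_space (atlas_topology A) \<and>
    second_countable (atlas_topology A)"

definition smooth_function :: "('m, 'e::real_inner) chart set \<Rightarrow> ('m \<Rightarrow> real) \<Rightarrow> bool"
  where "smooth_function A f \<longleftrightarrow> (\<forall>c\<in>A. smooth_on (snd c ` fst c) (f \<circ> chart_inv c))"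

text \<open>The openness requirement says that the map is continuous.\<close>

definition smooth_map ::
    "('m, 'e::real_inner) chart set \<Rightarrow> ('n, 'f::real_inner) chart set \<Rightarrow> ('m \<Rightarrow> 'n) \<Rightarrow> bool"
  where "smooth_map A B f \<longleftrightarrow>
    f ` points A \<subseteq> points B \<and>
    (\<forall>c\<in>A. \<forall>c'\<in>B. open (snd c ` (fst c \<inter> f -` fst c')) \<and>
       smooth_on (snd c ` (fst c \<inter> f -` fst c')) (local_rep c c' f))"

definition prod_chart ::
    "('m, 'e) chart \<Rightarrow> ('n, 'f) chart \<Rightarrow> ('m \<times> 'n, 'e \<times> 'f) chart"
  where "prod_chart c c' = (fst c \<times> fst c', map_prod (snd c) (snd c'))"

definition prod_atlas ::
    "('m, 'e) chart set \<Rightarrow> ('n, 'f) chart set \<Rightarrow> ('m \<times> 'n, 'e \<times> 'f) chart set"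
  where "prod_atlas A B = {prod_chart c c' | c c'. c \<in> A \<and> c' \<in> B}"

definition euclidean_atlas :: "('e, 'e::euclidean_space) chart set"
  where "euclidean_atlas = {(UNIV, \<lambda>x. x)}"


section \<open>Tangent vectors, covectors, tensor fields\<close>

text \<open>A tangent vector or covector at \<open>y\<close> is its family of components in all charts around \<open>y\<close>,
  subject to the usual transformation law, and set to 0 in all other charts so that equality of
  (co)vectors is equality of functions. The components of a covector \<open>p\<close> in a chart \<open>c\<close> form a
  vector \<open>p c\<close> of \<open>'e\<close>, the pairing with a tangent vector \<open>v\<close> being the inner product
  \<open>p c \<bullet> v c\<close> (that is, \<open>\<Sum>\<^sub>i p\<^sub>i v\<^sub>i\<close>).\<close>

definition tangent_space ::
    "('m, 'e::real_inner) chart set \<Rightarrow> 'm \<Rightarrow> (('m, 'e) chart \<Rightarrow> 'e) set"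
  where "tangent_space A y =
    {v. (\<forall>c\<in>A. \<forall>c'\<in>A. y \<in> fst c \<longrightarrow> y \<in> fst c' \<longrightarrow>
           v c' = fderiv (transition c c') (snd c y) (v c)) \<and>
        (\<forall>c. \<not> (c \<in> A \<and> y \<in> fst c) \<longrightarrow> v c = 0)}"

definition cotangent_space ::
    "('m, 'e::real_inner) chart set \<Rightarrow> 'm \<Rightarrow> (('m, 'e) chart \<Rightarrow> 'e) set"
  where "cotangent_space A y =
    {p. (\<forall>c\<in>A. \<forall>c'\<in>A. y \<in> fst c \<longrightarrow> y \<in> fst c' \<longrightarrow>
           (\<forall>w. p c \<bullet> w = p c' \<bullet> fderiv (transition c c') (snd c y) w)) \<and>
        (\<forall>c. \<not> (c \<in> A \<and> y \<in> fst c) \<longrightarrow> p c = 0)}"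

definition vector_field ::
    "('m, 'e::real_inner) chart set \<Rightarrow> ('m \<Rightarrow> ('m, 'e) chart \<Rightarrow> 'e) \<Rightarrow> bool"
  where "vector_field A Y \<longleftrightarrow>
    (\<forall>y\<in>points A. Y y \<in> tangent_space A y) \<and>
    (\<forall>c\<in>A. smooth_on (snd c ` fst c) (\<lambda>x. Y (chart_inv c x) c))"

definition one_form ::
    "('m, 'e::real_inner) chart set \<Rightarrow> ('m \<Rightarrow> ('m, 'e) chart \<Rightarrow> 'e) \<Rightarrow> bool"
  where "one_form A \<theta> \<longleftrightarrow>
    (\<forall>y\<in>points A. \<theta> y \<in> cotangent_space A y) \<and>
    (\<forall>c\<in>A. smooth_on (snd c ` fst c) (\<lambda>x. \<theta> (chart_inv c x) c))"

text \<open>The value of \<open>d f\<close> at \<open>y\<close> on the vector with components \<open>w\<close> in the chart \<open>c\<close>.\<close>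

definition exterior_deriv :: "('m \<Rightarrow> real) \<Rightarrow> ('m, 'e::real_inner) chart \<Rightarrow> 'm \<Rightarrow> 'e \<Rightarrow> real"
  where "exterior_deriv f c y w = fderiv (f \<circ> chart_inv c) (snd c y) w"

text \<open>In coordinates \<open>(L\<^sub>Y \<theta>)\<^sub>i = \<Sum>\<^sub>j (Y\<^sub>j \<partial>\<^sub>j \<theta>\<^sub>i + \<theta>\<^sub>j \<partial>\<^sub>i Y\<^sub>j)\<close>; again evaluated on the vector with
  components \<open>w\<close>.\<close>

definition lie_deriv ::
    "('m \<Rightarrow> ('m, 'e::real_inner) chart \<Rightarrow> 'e) \<Rightarrow> ('m \<Rightarrow> ('m, 'e) chart \<Rightarrow> 'e) \<Rightarrow>
     ('m, 'e) chart \<Rightarrow> 'm \<Rightarrow> 'e \<Rightarrow> real"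
  where "lie_deriv Y \<theta> c y w =
    fderiv (\<lambda>x. \<theta> (chart_inv c x) c) (snd c y) (Y y c) \<bullet> w
    + \<theta> y c \<bullet> fderiv (\<lambda>x. Y (chart_inv c x) c) (snd c y) w"


section \<open>Flows\<close>

definition smooth_flow ::
    "('m, 'e::real_inner) chart set \<Rightarrow> ('m \<Rightarrow> ('m, 'e) chart \<Rightarrow> 'e) \<Rightarrow> bool"
  where "smooth_flow A Y \<longleftrightarrow> smooth_manifold A \<and> vector_field A Y"

definition compact_flow ::
    "('m, 'e::real_inner) chart set \<Rightarrow> ('m \<Rightarrow> ('m, 'e) chart \<Rightarrow> 'e) \<Rightarrow> bool"
  where "compact_flow A Y \<longleftrightarrow> smooth_flow A Y \<and> compact_space (atlas_topology A)"

definition nonsingular ::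
    "('m, 'e::real_inner) chart set \<Rightarrow> ('m \<Rightarrow> ('m, 'e) chart \<Rightarrow> 'e) \<Rightarrow> bool"
  where "nonsingular A Y \<longleftrightarrow> (\<forall>y\<in>points A. Y y \<noteq> (\<lambda>c. 0))"

definition strongly_adapted ::
    "('m, 'e::real_inner) chart set \<Rightarrow> ('m \<Rightarrow> ('m, 'e) chart \<Rightarrow> 'e) \<Rightarrow>
     ('m \<Rightarrow> ('m, 'e) chart \<Rightarrow> 'e) \<Rightarrow> bool"
  where "strongly_adapted A Y \<theta> \<longleftrightarrow>
    one_form A \<theta> \<and>
    (\<forall>c\<in>A. \<forall>y\<in>fst c. \<theta> y c \<bullet> Y y c > 0) \<and>
    (\<exists>L. smooth_function A L \<and>
       (\<forall>c\<in>A. \<forall>y\<in>fst c. \<forall>w. lie_deriv Y \<theta> c y w = exterior_deriv L c y w))"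

definition trajectory ::
    "('m, 'e::real_inner) chart set \<Rightarrow> ('m \<Rightarrow> ('m, 'e) chart \<Rightarrow> 'e) \<Rightarrow>
     real set \<Rightarrow> (real \<Rightarrow> 'm) \<Rightarrow> bool"
  where "trajectory A Y I u \<longleftrightarrow>
    is_interval I \<and>
    continuous_map (top_of_set I) (atlas_topology A) u \<and>
    (\<forall>t\<in>I. \<forall>c\<in>A. u t \<in> fst c \<longrightarrow>
       ((\<lambda>s. snd c (u s)) has_vector_derivative Y (u t) c) (at t within I))"

definition flow_morphism ::
    "('m, 'e::real_inner) chart set \<Rightarrow> ('m \<Rightarrow> ('m, 'e) chart \<Rightarrow> 'e) \<Rightarrow>
     ('n, 'f::real_inner) chart set \<Rightarrow> ('n \<Rightarrow> ('n, 'f) chart \<Rightarrow> 'f) \<Rightarrow> ('m \<Rightarrow> 'n) \<Rightarrow> bool"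
  where "flow_morphism A Y B Y' \<phi> \<longleftrightarrow>
    smooth_map A B \<phi> \<and>
    (\<forall>c\<in>A. \<forall>c'\<in>B. \<forall>y\<in>fst c. \<phi> y \<in> fst c' \<longrightarrow>
       fderiv (local_rep c c' \<phi>) (snd c y) (Y y c) = Y' (\<phi> y) c')"

definition immersion ::
    "('m, 'e::real_inner) chart set \<Rightarrow> ('n, 'f::real_inner) chart set \<Rightarrow> ('m \<Rightarrow> 'n) \<Rightarrow> bool"
  where "immersion A B \<phi> \<longleftrightarrow>
    (\<forall>c\<in>A. \<forall>c'\<in>B. \<forall>y\<in>fst c. \<phi> y \<in> fst c' \<longrightarrow> inj (fderiv (local_rep c c' \<phi>) (snd c y)))"

definition flow_embedding ::
    "('m, 'e::real_inner) chart set \<Rightarrow> ('m \<Rightarrow> ('m, 'e) chart \<Rightarrow> 'e) \<Rightarrow>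
     ('n, 'f::real_inner) chart set \<Rightarrow> ('n \<Rightarrow> ('n, 'f) chart \<Rightarrow> 'f) \<Rightarrow> ('m \<Rightarrow> 'n) \<Rightarrow> bool"
  where "flow_embedding A Y B Y' \<phi> \<longleftrightarrow>
    flow_morphism A Y B Y' \<phi> \<and> inj_on \<phi> (points A) \<and> immersion A B \<phi>"


section \<open>Tori\<close>

quotient_type circle = real / "\<lambda>x y. x - y \<in> \<int>"
proof (rule equivpI)
  show "reflp (\<lambda>x y::real. x - y \<in> \<int>)" by (auto simp: reflp_def)
  show "symp (\<lambda>x y::real. x - y \<in> \<int>)"
    by (auto simp: symp_def) (metis Ints_minus minus_diff_eq)
  show "transp (\<lambda>x y::real. x - y \<in> \<int>)"
    by (auto simp: transp_def) (metis Ints_add add_diff_eq diff_add_cancel)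
qed

instantiation circle :: ab_group_add
begin

lift_definition zero_circle :: circle is "0::real" .

lift_definition plus_circle :: "circle \<Rightarrow> circle \<Rightarrow> circle" is "(+)"
  by (metis Ints_add add_diff_add)

lift_definition uminus_circle :: "circle \<Rightarrow> circle" is "uminus"
  by (metis Ints_minus minus_diff_minus)

definition minus_circle :: "circle \<Rightarrow> circle \<Rightarrow> circle"
  where "minus_circle a b = a + - b"

instance
proof
  fix a b c :: circle
  show "a + b + c = a + (b + c)" by transfer (simp add: add.assoc)
  show "a + b = b + a" by transfer (simp add: add.commute)
  show "0 + a = a" by transfer simp
  show "- a + a = 0" by transfer simp
  show "a - b = a + - b" by (rule minus_circle_def)
qed

end

definition torus_proj :: "real ^ 'd \<Rightarrow> circle ^ 'd"
  where "torus_proj x = (\<chi> i. abs_circle (x $ i))"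

text \<open>The charts are the local inverses of the covering map on open unit boxes.\<close>

definition torus_chart :: "real ^ 'd \<Rightarrow> (circle ^ 'd, real ^ 'd) chart"
  where "torus_chart a =
    (torus_proj ` box a (a + 1), inv_into (box a (a + 1)) torus_proj)"

definition torus_atlas :: "(circle ^ 'd, real ^ 'd) chart set"
  where "torus_atlas = range torus_chart"

definition torus_partial ::
    "'d \<Rightarrow> (circle ^ 'd \<Rightarrow> 'a::real_normed_vector) \<Rightarrow> circle ^ 'd \<Rightarrow> 'a"
  where "torus_partial k f x =
    vector_derivative (\<lambda>s. f (x + axis k (abs_circle s))) (at 0)"

text \<open>In every torus chart the coordinates are the standard \<open>x, y\<close> up to integer constants, so
  \<open>sin (2 \<pi> x) d/dx + cos (2 \<pi> x) d/dy\<close> has the same expression in each of them.\<close>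

definition Y_torus :: "circle ^ 2 \<Rightarrow> (circle ^ 2, real ^ 2) chart \<Rightarrow> real ^ 2"
  where "Y_torus z c =
    (if c \<in> torus_atlas \<and> z \<in> fst c
     then let x = snd c z $ 1 in vector [sin (2 * pi * x), cos (2 * pi * x)]
     else 0)"


section \<open>Riemannian metrics\<close>

text \<open>\<open>g y c u v\<close> is the inner product at \<open>y\<close> of the tangent vectors with components \<open>u\<close>
  and \<open>v\<close> in the chart \<open>c\<close>.\<close>

type_synonym ('m, 'e) metric = "'m \<Rightarrow> ('m, 'e) chart \<Rightarrow> 'e \<Rightarrow> 'e \<Rightarrow> real"

definition riemannian_manifold ::
    "('m, 'e::real_inner) chart set \<Rightarrow> ('m, 'e) metric \<Rightarrow> bool"
  where "riemannian_manifold A g \<longleftrightarrow>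
    smooth_manifold A \<and>
    (\<forall>c\<in>A. \<forall>y\<in>fst c.
       (\<forall>u. linear (g y c u)) \<and>
       (\<forall>u v. g y c u v = g y c v u) \<and>
       (\<forall>u. u \<noteq> 0 \<longrightarrow> g y c u u > 0)) \<and>
    (\<forall>c\<in>A. \<forall>u v. smooth_on (snd c ` fst c) (\<lambda>x. g (chart_inv c x) c u v)) \<and>
    (\<forall>c\<in>A. \<forall>c'\<in>A. \<forall>y\<in>fst c \<inter> fst c'. \<forall>u v.
       g y c u v = g y c' (fderiv (transition c c') (snd c y) u)
                          (fderiv (transition c c') (snd c y) v))"

text \<open>The components of \<open>g(y)\<^sup>-\<^sup>1 \<cdot> p\<close>, for a covector with components \<open>p\<close>.\<close>

definition sharp :: "('m, 'e::real_inner) metric \<Rightarrow> ('m, 'e) chart \<Rightarrow> 'm \<Rightarrow> 'e \<Rightarrow> 'e"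
  where "sharp g c y p = (THE v. \<forall>w. g y c v w = p \<bullet> w)"

text \<open>The vector \<open>\<Sum>\<^sub>i\<^sub>j \<Gamma>\<^sub>i\<^sub>j u\<^sub>i v\<^sub>j\<close> of Christoffel symbols of the Levi-Civita connection, determined by
  \<open>2 g\<^sub>k\<^sub>l \<Gamma>\<^sup>k\<^sub>i\<^sub>j = \<partial>\<^sub>i g\<^sub>j\<^sub>l + \<partial>\<^sub>j g\<^sub>i\<^sub>l - \<partial>\<^sub>l g\<^sub>i\<^sub>j\<close>.\<close>

definition christoffel ::
    "('m, 'e::real_inner) metric \<Rightarrow> ('m, 'e) chart \<Rightarrow> 'm \<Rightarrow> 'e \<Rightarrow> 'e \<Rightarrow> 'e"
  where "christoffel g c y u v =
    (let dg = (\<lambda>a b. fderiv (\<lambda>x. g (chart_inv c x) c a b) (snd c y))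
     in THE z. \<forall>w. 2 * g y c z w = dg v w u + dg u w v - dg u v w)"

text \<open>Pullback connection along a curve through \<open>y\<close> with velocity \<open>q'\<close>: the components of the
  covariant derivative of a vector field \<open>X\<close> (with value \<open>X\<close> and component-wise derivative \<open>X'\<close>),
  and the covariant derivative of a covector field \<open>P\<close>, evaluated on \<open>w\<close>.\<close>

definition cov_deriv_vector ::
    "('m, 'e::real_inner) metric \<Rightarrow> ('m, 'e) chart \<Rightarrow> 'm \<Rightarrow> 'e \<Rightarrow> 'e \<Rightarrow> 'e \<Rightarrow> 'e"
  where "cov_deriv_vector g c y q' X X' = X' + christoffel g c y q' X"

definition cov_deriv_covector ::
    "('m, 'e::real_inner) metric \<Rightarrow> ('m, 'e) chart \<Rightarrow> 'm \<Rightarrow> 'e \<Rightarrow> 'e \<Rightarrow> 'e \<Rightarrow> 'e \<Rightarrow> real"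
  where "cov_deriv_covector g c y q' P P' w = P' \<bullet> w - P \<bullet> christoffel g c y q' w"


section \<open>Cotangent bundle and potential well flows\<close>

type_synonym ('m, 'e) cot = "'m \<times> (('m, 'e) chart \<Rightarrow> 'e)"

definition cotangent_chart ::
    "('m, 'e::real_inner) chart set \<Rightarrow> ('m, 'e) chart \<Rightarrow> (('m, 'e) cot, 'e \<times> 'e) chart"
  where "cotangent_chart A c =
    ((SIGMA q:fst c. cotangent_space A q), (\<lambda>(q, p). (snd c q, p c)))"

definition cotangent_atlas ::
    "('m, 'e::real_inner) chart set \<Rightarrow> (('m, 'e) cot, 'e \<times> 'e) chart set"
  where "cotangent_atlas A = cotangent_chart A ` A"

text \<open>The form \<open>\<Sum>\<^sub>i dq\<^sub>i \<and> dp\<^sub>i\<close> in a canonical chart of the cotangent bundle.\<close>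

definition canonical_symplectic :: "'e::real_inner \<times> 'e \<Rightarrow> 'e \<times> 'e \<Rightarrow> real"
  where "canonical_symplectic X Z = fst X \<bullet> snd Z - snd X \<bullet> fst Z"

text \<open>The vector field \<open>X\<close> with \<open>\<omega>(X, \<cdot>) = dH\<close>; in canonical coordinates it reads
  \<open>\<partial>\<^sub>t q = \<partial>H/\<partial>p\<close>, \<open>\<partial>\<^sub>t p = - \<partial>H/\<partial>q\<close>.\<close>

definition hamiltonian_field ::
    "('m, 'e::real_inner) chart set \<Rightarrow> (('m, 'e) cot \<Rightarrow> real) \<Rightarrow>
     ('m, 'e) cot \<Rightarrow> (('m, 'e) cot, 'e \<times> 'e) chart \<Rightarrow> 'e \<times> 'e"
  where "hamiltonian_field A H z C =
    (if C \<in> cotangent_atlas A \<and> z \<in> fst C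
     then THE X. \<forall>Z. canonical_symplectic X Z = exterior_deriv H C z Z
     else 0)"

text \<open>The kinetic term does not depend on the choice of the chart around \<open>q\<close>.\<close>

definition well_hamiltonian ::
    "('m, 'e::real_inner) chart set \<Rightarrow> ('m, 'e) metric \<Rightarrow> ('m \<Rightarrow> real) \<Rightarrow> ('m, 'e) cot \<Rightarrow> real"
  where "well_hamiltonian A g V = (\<lambda>(q, p).
    (let c = (SOME c. c \<in> A \<and> q \<in> fst c) in (p c \<bullet> sharp g c q (p c)) / 2) + V q)"

definition well_field ::
    "('m, 'e::real_inner) chart set \<Rightarrow> ('m, 'e) metric \<Rightarrow> ('m \<Rightarrow> real) \<Rightarrow>
     ('m, 'e) cot \<Rightarrow> (('m, 'e) cot, 'e \<times> 'e) chart \<Rightarrow> 'e \<times> 'e"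
  where "well_field A g V = hamiltonian_field A (well_hamiltonian A g V)"

definition grad :: "(real ^ 'm \<Rightarrow> real) \<Rightarrow> real ^ 'm \<Rightarrow> real ^ 'm"
  where "grad V q = (\<chi> i. fderiv V q (axis i 1))"

definition euclidean_well_field ::
    "(real ^ 'm \<Rightarrow> real) \<Rightarrow> (real ^ 'm) \<times> (real ^ 'm) \<Rightarrow>
     ((real ^ 'm) \<times> (real ^ 'm), (real ^ 'm) \<times> (real ^ 'm)) chart \<Rightarrow> (real ^ 'm) \<times> (real ^ 'm)"
  where "euclidean_well_field V = (\<lambda>(q, p) C.
    if C \<in> euclidean_atlas then (p, - grad V q) else 0)"


section \<open>Nonlinear wave systems\<close>

text \<open>A state is a smooth map from the torus to the cotangent bundle. The parameter \<open>'d\<close> gives the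
  dimensions \<open>d \<ge> 1\<close>; for \<open>d = 0\<close> the system is by definition the potential well flow.
  The equations are stated in an arbitrary chart \<open>c\<close> around the point \<open>q(t,x)\<close>.\<close>

definition nlw_solution ::
    "('m, 'e::real_inner) chart set \<Rightarrow> ('m, 'e) metric \<Rightarrow> ('m \<Rightarrow> real) \<Rightarrow>
     real set \<Rightarrow> (real \<Rightarrow> circle ^ 'd \<Rightarrow> ('m, 'e) cot) \<Rightarrow> bool"
  where "nlw_solution A g V I z \<longleftrightarrow>
    is_interval I \<and>
    (\<forall>t\<in>I. smooth_map torus_atlas (cotangent_atlas A) (z t)) \<and>
    (\<forall>x. continuous_map (top_of_set I) (atlas_topology (cotangent_atlas A)) (\<lambda>t. z t x)) \<and>
    (\<forall>t\<in>I. \<forall>x. \<forall>c\<in>A. fst (z t x) \<in> fst c \<longrightarrow>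
      (let y = fst (z t x);
           Q = (\<lambda>s x. snd c (fst (z s x)));
           P = (\<lambda>s x. snd (z s x) c);
           Qt = sharp g c y (P t x);
           Qk = (\<lambda>k. torus_partial k (Q t) x);
           Qkk = (\<lambda>k. torus_partial k (torus_partial k (Q t)) x)
       in ((\<lambda>s. Q s x) has_vector_derivative Qt) (at t within I) \<and>
          (\<exists>Pt. ((\<lambda>s. P s x) has_vector_derivative Pt) (at t within I) \<and>
             (\<forall>w. cov_deriv_covector g c y Qt (P t x) Pt w =
                   (\<Sum>k\<in>UNIV. g y c (cov_deriv_vector g c y (Qk k) (Qk k) (Qkk k)) w)
                   - exterior_deriv V c y w))))"

definition euclidean_nlw_solution ::
    "(real ^ 'm \<Rightarrow> real) \<Rightarrow> real set \<Rightarrow>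
     (real \<Rightarrow> circle ^ 'd \<Rightarrow> (real ^ 'm) \<times> (real ^ 'm)) \<Rightarrow> bool"
  where "euclidean_nlw_solution V I z \<longleftrightarrow>
    is_interval I \<and>
    (\<forall>t\<in>I. smooth_map torus_atlas euclidean_atlas (z t)) \<and>
    (\<forall>t\<in>I. \<forall>x.
       ((\<lambda>s. fst (z s x)) has_vector_derivative snd (z t x)) (at t within I) \<and>
       ((\<lambda>s. snd (z s x)) has_vector_derivative
          (\<Sum>k\<in>UNIV. torus_partial k (torus_partial k (\<lambda>x. fst (z t x))) x)
          - grad V (fst (z t x))) (at t within I))"

text \<open>Embeddings of a flow into a system whose states are smooth maps from the torus to the manifold
  with atlas \<open>B\<close> and whose solutions are given by \<open>sol\<close>. Smoothness in the Gateaux sense is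
  expressed as joint smoothness of \<open>(y, x) \<mapsto> \<phi> y x\<close>.\<close>

definition field_embedding ::
    "('n, 'a::real_inner) chart set \<Rightarrow> ('n \<Rightarrow> ('n, 'a) chart \<Rightarrow> 'a) \<Rightarrow>
     ('b, 'f::real_inner) chart set \<Rightarrow> (real set \<Rightarrow> (real \<Rightarrow> circle ^ 'd \<Rightarrow> 'b) \<Rightarrow> bool) \<Rightarrow>
     ('n \<Rightarrow> circle ^ 'd \<Rightarrow> 'b) \<Rightarrow> bool"
  where "field_embedding N Y B sol \<phi> \<longleftrightarrow>
    smooth_map (prod_atlas N torus_atlas) B (\<lambda>(y, x). \<phi> y x) \<and>
    inj_on \<phi> (points N) \<and>
    (\<forall>c\<in>N. \<forall>y\<in>fst c. \<forall>w. w \<noteq> 0 \<longrightarrow>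
       (\<exists>x. \<exists>c'\<in>B. \<phi> y x \<in> fst c' \<and>
          fderiv (local_rep c c' (\<lambda>y. \<phi> y x)) (snd c y) w \<noteq> 0)) \<and>
    (\<forall>I u. trajectory N Y I u \<longrightarrow> sol I (\<lambda>t. \<phi> (u t)))"

end

theory Submission
  imports Defs
begin

text \<open>Write the vector field on the universal cover as \<open>Y = sin(2 \<pi> x) \<partial>\<^sub>x + cos(2 \<pi> x) \<partial>\<^sub>y\<close>. It commutes with
\<open>\<partial>\<^sub>y\<close>, has the closed orbits \<open>x = 0\<close>, where it equals \<open>\<partial>\<^sub>y\<close>, and \<open>x = 1/2\<close>, where it equals
\<open>-\<partial>\<^sub>y\<close>, and moves \<open>x\<close> from the first to the second orbit in between.

Suppose that \<open>L\<^sub>Y \<theta> = dL\<close> and put \<open>\<beta> = \<theta>(\<partial>\<^sub>y)\<close>. Since \<open>[Y, \<partial>\<^sub>y] = 0\<close>, evaluation on \<open>\<partial>\<^sub>y\<close> gives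
\<open>Y \<beta> = \<partial>\<^sub>y L\<close>. The mean \<open>B(x)\<close> of \<open>\<beta>\<close> over \<open>y\<close> therefore satisfies \<open>sin(2 \<pi> x) B'(x) = 0\<close>, so
\<open>B\<close> is constant on \<open>[0, 1/2]\<close>. But \<open>\<beta> = \<theta>(Y) > 0\<close> on the first orbit and \<open>\<beta> = -\<theta>(Y) < 0\<close> on
the second one, a contradiction.

For an embedding \<open>(q, p)\<close> into a potential well or a wave system the same argument is applied to the
pull-back \<open>\<theta> = p dq\<close> of the canonical 1-form. In the presence of spatial variables
\<open>\<xi>\<^sub>1, \<dots>, \<xi>\<^sub>d\<close> the equations of motion yield
\<open>Y \<beta> = \<partial>\<^sub>y l + \<Sum>\<^sub>k \<partial>\<^sub>k \<langle>\<partial>\<^sub>k q, \<partial>\<^sub>y q\<rangle>\<close> for \<open>\<beta> = p(\<partial>\<^sub>y q)\<close>,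
where \<open>l\<close> is the Lagrangian density (lemma \<open>balance_law\<close>). Averaging over \<open>y\<close> and over space kills the
right-hand side. Now \<open>\<theta>(Y) = |p|\<^sup>2\<close> is only nonnegative, so the conclusion is that \<open>\<beta>\<close>, and with it
\<open>p\<close>, vanishes on the orbit \<open>x = 0\<close> (lemmas \<open>conserved_density_vanishes\<close> and
\<open>stationary_on_orbit\<close>). Then \<open>\<partial>\<^sub>y q\<close> and \<open>\<partial>\<^sub>y p\<close> vanish there too, and the map is not an immersion.

All four systems are brought to the form of the locale \<open>wave_cover\<close>, in which the base is the
universal cover of the torus and everything is expressed in charts of the target. A
potential well is the case without spatial variables. For a well on a manifold the
velocity and the force have to be read off from the Hamiltonian vector field; this is lemma
\<open>well_field_eq\<close>, whose analytic content is that the kinetic energy is differentiable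
(\<open>has_derivative_kinetic\<close>).\<close>


section \<open>Calculus of smooth and of \<open>C\<^sup>1\<close> maps\<close>

lemma fderiv_cong:
  assumes "open S" "x \<in> S" "\<And>y. y \<in> S \<Longrightarrow> f y = g y"
  shows "fderiv f x = fderiv g x"
proof -
  have "(f has_derivative f') (at x) \<longleftrightarrow> (g has_derivative f') (at x)" for f'
    using has_derivative_transform_within_open[OF _ assms(1,2)] assms(3) by metis
  then show ?thesis
    unfolding frechet_derivative_def by simp
qed

lemma differentiable_cong:
  assumes "open S" "x \<in> S" "\<And>y. y \<in> S \<Longrightarrow> f y = g y" "f differentiable (at x)"
  shows "g differentiable (at x)"
  using assms has_derivative_transform_within_open[OF _ assms(1,2)] unfolding differentiable_def by metis

lemma fderiv_works: "f differentiable (at x) \<Longrightarrow> (f has_derivative fderiv f x) (at x)"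
  using frechet_derivative_works by blast

lemma fderiv_eq: "(f has_derivative f') (at x) \<Longrightarrow> fderiv f x = f'"
  by (metis frechet_derivative_at)

lemma Ck_on_cong:
  assumes "open S" "\<And>x. x \<in> S \<Longrightarrow> f x = g x" "Ck_on k S f"
  shows "Ck_on k S g"
  using assms(2,3)
proof (induction k arbitrary: f g)
  case 0
  then show ?case using continuous_on_cong by force
next
  case (Suc k)
  show ?case unfolding Ck_on.simps
  proof (intro conjI ballI allI)
    show "g differentiable at x" if "x \<in> S" for x
      using differentiable_cong[OF assms(1) that, of f g] Suc that by auto
    show "Ck_on k S (\<lambda>x. fderiv g x v)" for v
      by (rule Suc.IH[of "\<lambda>x. fderiv f x v"])
        (use Suc.prems fderiv_cong[OF assms(1), of _ f g] in auto)
  qed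
qed

lemma Ck_on_local:
  assumes "\<And>x. x \<in> S \<Longrightarrow> \<exists>U. open U \<and> x \<in> U \<and> Ck_on k U f"
  shows "Ck_on k S f"
  using assms
proof (induction k arbitrary: f)
  case 0
  then show ?case
    by (metis Ck_on.simps(1) continuous_at_imp_continuous_on continuous_on_eq_continuous_at)
next
  case (Suc k)
  show ?case unfolding Ck_on.simps
  proof (intro conjI ballI allI)
    show "f differentiable at x" if "x \<in> S" for x
      using Suc.prems[OF that] by auto
    show "Ck_on k S (\<lambda>x. fderiv f x v)" for v
      by (rule Suc.IH) (use Suc.prems in fastforce)
  qed
qed

lemma Ck_on_subset: "Ck_on k S f \<Longrightarrow> T \<subseteq> S \<Longrightarrow> Ck_on k T f"
  by (induction k arbitrary: f) (auto intro: continuous_on_subset)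

lemma smooth_on_cong:
  "open S \<Longrightarrow> (\<And>x. x \<in> S \<Longrightarrow> f x = g x) \<Longrightarrow> smooth_on S f \<Longrightarrow> smooth_on S g"
  unfolding smooth_on_def using Ck_on_cong by blast

lemma smooth_on_subset: "smooth_on S f \<Longrightarrow> T \<subseteq> S \<Longrightarrow> smooth_on T f"
  unfolding smooth_on_def using Ck_on_subset by blast

lemma smooth_on_local:
  assumes "\<And>x. x \<in> S \<Longrightarrow> \<exists>U. open U \<and> x \<in> U \<and> smooth_on U f"
  shows "smooth_on S f"
  unfolding smooth_on_def
proof
  show "Ck_on k S f" for k
    by (rule Ck_on_local) (use assms smooth_on_def in blast)
qed

lemma smooth_on_differentiable: "smooth_on S f \<Longrightarrow> x \<in> S \<Longrightarrow> f differentiable (at x)"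
  unfolding smooth_on_def by (metis Ck_on.simps(2))

lemma smooth_on_fderiv: "smooth_on S f \<Longrightarrow> smooth_on S (\<lambda>x. fderiv f x v)"
  unfolding smooth_on_def by (metis Ck_on.simps(2))

lemma smooth_on_continuous: "smooth_on S f \<Longrightarrow> continuous_on S f"
  unfolding smooth_on_def by (metis Ck_on.simps(1))

lemma smooth_on_has_derivative:
  "smooth_on S f \<Longrightarrow> x \<in> S \<Longrightarrow> (f has_derivative fderiv f x) (at x)"
  by (simp add: fderiv_works smooth_on_differentiable)

lemma smooth_on_const: "smooth_on S (\<lambda>x. c)"
proof -
  have "Ck_on k S (\<lambda>x. c)" for k
    by (induction k arbitrary: c) auto
  then show ?thesis by (simp add: smooth_on_def)
qed

lemma smooth_on_translation: "smooth_on S (\<lambda>x. x + c)"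
proof -
  have "((\<lambda>x. x + c) has_derivative (\<lambda>v. v)) (at x)" for x :: 'a
    by (auto intro!: derivative_eq_intros)
  then have D: "(\<lambda>x. x + c) differentiable (at x)" "fderiv (\<lambda>x. x + c) x = (\<lambda>v. v)" for x :: 'a
    using differentiable_def fderiv_eq by blast+
  have "Ck_on k S (\<lambda>x. x + c)" for k
  proof (cases k)
    case (Suc m)
    have "Ck_on m S (\<lambda>x::'a. v)" for v :: 'a
      using smooth_on_const smooth_on_def by blast
    then show ?thesis using Suc D by simp
  qed (auto intro!: continuous_intros)
  then show ?thesis by (simp add: smooth_on_def)
qed

abbreviation C1_on :: "'a::real_normed_vector set \<Rightarrow> ('a \<Rightarrow> 'b::real_normed_vector) \<Rightarrow> bool"
  where "C1_on \<equiv> Ck_on (Suc 0)"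

lemma C1_onI:
  assumes "\<And>x. x \<in> S \<Longrightarrow> (f has_derivative f' x) (at x)"
    and "\<And>v. continuous_on S (\<lambda>x. f' x v)" and "open S"
  shows "C1_on S f"
  unfolding Ck_on.simps
proof (intro conjI ballI allI)
  show "f differentiable at x" if "x \<in> S" for x
    using assms(1)[OF that] differentiable_def by blast
  show "continuous_on S (\<lambda>x. fderiv f x v)" for v
    by (rule continuous_on_eq[OF assms(2)[of v]]) (simp add: fderiv_eq[OF assms(1)])
qed

lemma C1_on_has_derivative: "C1_on S f \<Longrightarrow> x \<in> S \<Longrightarrow> (f has_derivative fderiv f x) (at x)"
  by (simp add: fderiv_works)

lemma C1_on_continuous_fderiv: "C1_on S f \<Longrightarrow> continuous_on S (\<lambda>x. fderiv f x v)"
  by simp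

lemma C1_on_continuous: "C1_on S f \<Longrightarrow> continuous_on S f"
  by (auto simp: continuous_at_imp_continuous_on differentiable_imp_continuous_within)

lemma smooth_on_C1: "smooth_on S f \<Longrightarrow> C1_on S f"
  unfolding smooth_on_def by blast

lemma C1_on_const: "C1_on S (\<lambda>x. c)"
  using smooth_on_const smooth_on_C1 by blast

lemma C1_on_add:
  assumes "open S" "C1_on S f" "C1_on S g"
  shows "C1_on S (\<lambda>x. f x + g x)"
proof (rule C1_onI)
  show "((\<lambda>x. f x + g x) has_derivative (\<lambda>v. fderiv f x v + fderiv g x v)) (at x)" if "x \<in> S" for x
    by (intro has_derivative_add C1_on_has_derivative[OF _ that] assms)
  show "continuous_on S (\<lambda>x. fderiv f x v + fderiv g x v)" for v
    by (intro continuous_on_add C1_on_continuous_fderiv assms)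
qed fact

lemma C1_on_sum:
  assumes "open S" "\<And>i. i \<in> I \<Longrightarrow> C1_on S (f i)"
  shows "C1_on S (\<lambda>x. \<Sum>i\<in>I. f i x)"
  using assms(2)
proof (induction I rule: infinite_finite_induct)
  case (insert i I)
  then have "C1_on S (\<lambda>x. f i x + (\<Sum>i\<in>I. f i x))"
    by (intro C1_on_add assms(1)) auto
  then show ?case using insert by simp
qed (simp_all add: C1_on_const del: Ck_on.simps)

lemma C1_on_inner:
  fixes f g :: "'a::real_normed_vector \<Rightarrow> 'b::real_inner"
  assumes "open S" "C1_on S f" "C1_on S g"
  shows "C1_on S (\<lambda>x. f x \<bullet> g x)"
proof (rule C1_onI)
  show "((\<lambda>x. f x \<bullet> g x) has_derivative (\<lambda>v. f x \<bullet> fderiv g x v + fderiv f x v \<bullet> g x)) (at x)"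
    if "x \<in> S" for x
    by (intro has_derivative_inner C1_on_has_derivative[OF _ that] assms)
  show "continuous_on S (\<lambda>x. f x \<bullet> fderiv g x v + fderiv f x v \<bullet> g x)" for v
    by (intro continuous_intros C1_on_continuous_fderiv C1_on_continuous assms)
qed fact

lemma C1_on_mult:
  fixes f g :: "'a::real_normed_vector \<Rightarrow> real"
  assumes "open S" "C1_on S f" "C1_on S g"
  shows "C1_on S (\<lambda>x. f x * g x)"
  using C1_on_inner[OF assms] by simp

lemma C1_on_scaleR:
  fixes f :: "'a::real_normed_vector \<Rightarrow> real" and g :: "'a \<Rightarrow> 'b::real_normed_vector"
  assumes "open S" "C1_on S f" "C1_on S g"
  shows "C1_on S (\<lambda>x. f x *\<^sub>R g x)"
proof (rule C1_onI)
  show "((\<lambda>x. f x *\<^sub>R g x) has_derivative (\<lambda>v. f x *\<^sub>R fderiv g x v + fderiv f x v *\<^sub>R g x)) (at x)"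
    if "x \<in> S" for x
    by (intro has_derivative_scaleR C1_on_has_derivative[OF _ that] assms)
  show "continuous_on S (\<lambda>x. f x *\<^sub>R fderiv g x v + fderiv f x v *\<^sub>R g x)" for v
    by (intro continuous_intros C1_on_continuous_fderiv C1_on_continuous assms)
qed fact

lemma C1_on_trig:
  fixes e :: "'z::real_inner"
  shows "C1_on UNIV (\<lambda>z. sin (2 * pi * (z \<bullet> e)))" "C1_on UNIV (\<lambda>z. cos (2 * pi * (z \<bullet> e)))"
proof -
  show "C1_on UNIV (\<lambda>z. sin (2 * pi * (z \<bullet> e)))"
    by (rule C1_onI[where f' = "\<lambda>z v. cos (2 * pi * (z \<bullet> e)) * (2 * pi * (v \<bullet> e))"])
      (auto intro!: derivative_eq_intros continuous_intros)
  show "C1_on UNIV (\<lambda>z. cos (2 * pi * (z \<bullet> e)))"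
    by (rule C1_onI[where f' = "\<lambda>z v. - sin (2 * pi * (z \<bullet> e)) * (2 * pi * (v \<bullet> e))"])
      (auto intro!: derivative_eq_intros continuous_intros)
qed

text \<open>Two applications of the mean value theorem to the mixed second difference of \<open>f\<close>. Exchanging
  \<open>v\<close> and \<open>w\<close> does not change the difference, which is why mixed derivatives commute.\<close>

lemma mixed_difference_mean_value:
  fixes f :: "'a::real_normed_vector \<Rightarrow> real"
  assumes f: "smooth_on D f" and h: "0 < h"
    and D: "\<And>s t. 0 \<le> s \<Longrightarrow> s \<le> h \<Longrightarrow> 0 \<le> t \<Longrightarrow> t \<le> h \<Longrightarrow> z + s *\<^sub>R v + t *\<^sub>R w \<in> D"
  obtains s t where "0 \<le> s" "s \<le> h" "0 \<le> t" "t \<le> h"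
    and "f (z + h *\<^sub>R v + h *\<^sub>R w) - f (z + h *\<^sub>R v) - f (z + h *\<^sub>R w) + f z
      = h * (h * fderiv (\<lambda>z. fderiv f z v) (z + s *\<^sub>R v + t *\<^sub>R w) w)"
proof -
  have *: "((\<lambda>r. g (p + r *\<^sub>R u)) has_derivative (\<lambda>r. r * fderiv g (p + r0 *\<^sub>R u) u)) (at r0)"
    if "smooth_on D g" "p + r0 *\<^sub>R u \<in> D" for g :: "'a \<Rightarrow> real" and p u r0
  proof -
    have g: "(g has_derivative fderiv g (p + r0 *\<^sub>R u)) (at (p + r0 *\<^sub>R u))"
      using that smooth_on_has_derivative by blast
    have "((\<lambda>r. g (p + r *\<^sub>R u)) has_derivative (\<lambda>r. fderiv g (p + r0 *\<^sub>R u) (r *\<^sub>R u))) (at r0)"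
    proof -
      have "((\<lambda>r. p + r *\<^sub>R u) has_derivative (\<lambda>r. r *\<^sub>R u)) (at r0)"
        by (auto intro!: derivative_eq_intros)
      then show ?thesis
        by (rule has_derivative_compose) (rule g)
    qed
    then show ?thesis
      using linear_scale[OF has_derivative_linear[OF g]] by simp
  qed
  have 1: "((\<lambda>r. f (z + h *\<^sub>R w + r *\<^sub>R v) - f (z + r *\<^sub>R v)) has_derivative
      (\<lambda>r. r * fderiv f (z + h *\<^sub>R w + s *\<^sub>R v) v - r * fderiv f (z + s *\<^sub>R v) v)) (at s)"
    if "0 \<le> s" "s \<le> h" for s
    using D[of s h] D[of s 0] h that
    by (intro has_derivative_diff * f) (auto simp: ac_simps)
  obtain s where s: "s \<in> {0<..<h}" and
    s': "(f (z + h *\<^sub>R w + h *\<^sub>R v) - f (z + h *\<^sub>R v)) - (f (z + h *\<^sub>R w + 0 *\<^sub>R v) - f (z + 0 *\<^sub>R v))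
      = (h - 0) * fderiv f (z + h *\<^sub>R w + s *\<^sub>R v) v - (h - 0) * fderiv f (z + s *\<^sub>R v) v"
    using mvt_simple[OF h, of "\<lambda>r. f (z + h *\<^sub>R w + r *\<^sub>R v) - f (z + r *\<^sub>R v)"
        "\<lambda>s r. r * fderiv f (z + h *\<^sub>R w + s *\<^sub>R v) v - r * fderiv f (z + s *\<^sub>R v) v"]
      has_derivative_at_withinI[OF 1] by auto
  have 2: "((\<lambda>r. fderiv f (z + s *\<^sub>R v + r *\<^sub>R w) v) has_derivative
      (\<lambda>r. r * fderiv (\<lambda>z. fderiv f z v) (z + s *\<^sub>R v + t *\<^sub>R w) w)) (at t)"
    if "0 \<le> t" "t \<le> h" for t
    using D[of s t] s that by (intro * smooth_on_fderiv f) auto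
  obtain t where t: "t \<in> {0<..<h}" and
    t': "fderiv f (z + s *\<^sub>R v + h *\<^sub>R w) v - fderiv f (z + s *\<^sub>R v + 0 *\<^sub>R w) v
       = (h - 0) * fderiv (\<lambda>z. fderiv f z v) (z + s *\<^sub>R v + t *\<^sub>R w) w"
    using mvt_simple[OF h, of "\<lambda>r. fderiv f (z + s *\<^sub>R v + r *\<^sub>R w) v"
        "\<lambda>t r. r * fderiv (\<lambda>z. fderiv f z v) (z + s *\<^sub>R v + t *\<^sub>R w) w"]
      has_derivative_at_withinI[OF 2] by auto
  show ?thesis
    by (rule that[of s t]) (use s s' t t' in \<open>auto simp: algebra_simps simp flip: t'\<close>)
qed

lemma fderiv_commute_real:
  fixes f :: "'a::real_normed_vector \<Rightarrow> real"
  assumes "open D" "z \<in> D" and f: "smooth_on D f"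
  shows "fderiv (\<lambda>z. fderiv f z v) z w = fderiv (\<lambda>z. fderiv f z w) z v"
proof (rule ccontr)
  define a where "a = (\<lambda>z. fderiv (\<lambda>z. fderiv f z v) z w)"
  define b where "b = (\<lambda>z. fderiv (\<lambda>z. fderiv f z w) z v)"
  assume "\<not> ?thesis"
  then have "a z \<noteq> b z" by (simp add: a_def b_def)
  define e where "e = \<bar>a z - b z\<bar> / 2"
  have e: "e > 0" using \<open>a z \<noteq> b z\<close> by (simp add: e_def)
  have "continuous_on D a" "continuous_on D b"
    unfolding a_def b_def by (intro smooth_on_continuous smooth_on_fderiv f)+
  then have "isCont a z" "isCont b z"
    using assms(1,2) continuous_on_eq_continuous_at by blast+
  then have "\<forall>\<^sub>F y in nhds z. dist (a y) (a z) < e \<and> dist (b y) (b z) < e \<and> y \<in> D"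
    using e assms(1,2) eventually_nhds_in_open
    by (auto simp: isCont_def tendsto_at_iff_tendsto_nhds dest!: tendstoD[where e = e]
        intro!: eventually_conj)
  then obtain r where r: "r > 0" "\<And>y. dist y z < r \<Longrightarrow> dist (a y) (a z) < e \<and> dist (b y) (b z) < e \<and> y \<in> D"
    unfolding eventually_nhds_metric by blast
  \<comment> \<open>so small that the whole parallelogram spanned by \<open>h v\<close> and \<open>h w\<close> lies in the ball of radius \<open>r\<close>\<close>
  define h where "h = r / (2 * (norm v + norm w + 1))"
  have pos: "norm v + norm w + 1 > 0"
    by (metis add_nonneg_pos add_nonneg_nonneg norm_ge_zero zero_less_one)
  have h: "h > 0" using r(1) pos by (simp add: h_def)
  have near: "dist (z + s *\<^sub>R v + t *\<^sub>R w) z < r" if "0 \<le> s" "s \<le> h" "0 \<le> t" "t \<le> h" for s t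
  proof -
    have "dist (z + s *\<^sub>R v + t *\<^sub>R w) z = norm (s *\<^sub>R v + t *\<^sub>R w)"
      by (simp add: dist_norm add.assoc)
    also have "\<dots> \<le> s * norm v + t * norm w"
      using norm_triangle_ineq[of "s *\<^sub>R v" "t *\<^sub>R w"] that by simp
    also have "\<dots> \<le> h * norm v + h * norm w"
      using that by (intro add_mono mult_right_mono) auto
    also have "\<dots> < h * (2 * (norm v + norm w + 1))"
    proof -
      have "norm v + norm w < 2 * (norm v + norm w + 1)"
        using pos by (simp add: distrib_left)
      then have "h * (norm v + norm w) < h * (2 * (norm v + norm w + 1))"
        using h by (rule mult_strict_left_mono)
      then show ?thesis by (simp only: distrib_left)
    qed
    also have "\<dots> = r" using pos by (simp add: h_def)
    finally show ?thesis .
  qed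
  have inD: "z + s *\<^sub>R v + t *\<^sub>R w \<in> D" if "0 \<le> s" "s \<le> h" "0 \<le> t" "t \<le> h" for s t
    using near[OF that] r(2) by blast
  obtain s t where st: "0 \<le> s" "s \<le> h" "0 \<le> t" "t \<le> h"
    "f (z + h *\<^sub>R v + h *\<^sub>R w) - f (z + h *\<^sub>R v) - f (z + h *\<^sub>R w) + f z = h * (h * a (z + s *\<^sub>R v + t *\<^sub>R w))"
    by (rule mixed_difference_mean_value[OF f h, of z v w]) (use inD in \<open>auto simp: a_def\<close>)
  have inD': "z + s *\<^sub>R w + t *\<^sub>R v \<in> D" if "0 \<le> s" "s \<le> h" "0 \<le> t" "t \<le> h" for s t
    using inD[of t s] that by (simp add: ac_simps)
  obtain s' t' where st': "0 \<le> s'" "s' \<le> h" "0 \<le> t'" "t' \<le> h"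
    "f (z + h *\<^sub>R w + h *\<^sub>R v) - f (z + h *\<^sub>R w) - f (z + h *\<^sub>R v) + f z = h * (h * b (z + s' *\<^sub>R w + t' *\<^sub>R v))"
    by (rule mixed_difference_mean_value[OF f h, of z w v]) (use inD' in \<open>auto simp: b_def\<close>)
  have "h * (h * a (z + s *\<^sub>R v + t *\<^sub>R w)) = h * (h * b (z + s' *\<^sub>R w + t' *\<^sub>R v))"
    unfolding st(5)[symmetric] st'(5)[symmetric] by (simp add: algebra_simps)
  then have "a (z + s *\<^sub>R v + t *\<^sub>R w) = b (z + t' *\<^sub>R v + s' *\<^sub>R w)"
    using h by (simp add: ac_simps)
  moreover have "dist (a (z + s *\<^sub>R v + t *\<^sub>R w)) (a z) < e"
    using near st r(2) by blast
  moreover have "dist (b (z + t' *\<^sub>R v + s' *\<^sub>R w)) (b z) < e"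
    using near st' r(2) by blast
  ultimately have "dist (a z) (b z) < e + e"
    using dist_triangle_less_add[of "a z" "a (z + s *\<^sub>R v + t *\<^sub>R w)" e "b z" e]
    by (metis dist_commute)
  then show False by (simp add: e_def dist_real_def)
qed

lemma fderiv_bounded_linear:
  assumes "bounded_linear h" "f differentiable (at x)"
  shows "fderiv (\<lambda>x. h (f x)) x v = h (fderiv f x v)"
  using fderiv_eq[OF bounded_linear.has_derivative[OF assms(1) fderiv_works[OF assms(2)]]] by metis

lemma fderiv_inner_const:
  fixes f :: "'a::real_normed_vector \<Rightarrow> 'b::real_inner"
  assumes "f differentiable (at x)"
  shows "fderiv (\<lambda>x. f x \<bullet> u) x v = fderiv f x v \<bullet> u"
  by (rule fderiv_bounded_linear[OF bounded_linear_inner_left assms])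

text \<open>Scalar functions and the components of pairs are obtained from vector-valued maps by bounded
  linear maps, which commute with all directional derivatives.\<close>

lemma smooth_on_bounded_linear:
  assumes h: "bounded_linear h" and "open S" "smooth_on S f"
  shows "smooth_on S (\<lambda>x. h (f x))"
proof -
  have "Ck_on k S (\<lambda>x. h (f x))" for k
    using assms(3)
  proof (induction k arbitrary: f)
    case 0
    then show ?case
      unfolding Ck_on.simps
      by (intro bounded_linear.continuous_on[OF h] smooth_on_continuous)
  next
    case (Suc k)
    have d: "f differentiable (at x)" if "x \<in> S" for x
      using Suc.prems that smooth_on_differentiable by blast
    show ?case unfolding Ck_on.simps
    proof (intro conjI ballI allI)
      show "(\<lambda>x. h (f x)) differentiable at x" if "x \<in> S" for x
        using bounded_linear.has_derivative[OF h fderiv_works[OF d[OF that]]] differentiable_def by blast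
      show "Ck_on k S (\<lambda>x. fderiv (\<lambda>x. h (f x)) x v)" for v
        by (rule Ck_on_cong[OF assms(2) _ Suc.IH[OF smooth_on_fderiv[OF Suc.prems, of v]]])
          (simp add: fderiv_bounded_linear[OF h] d)
    qed
  qed
  then show ?thesis by (simp add: smooth_on_def)
qed

lemma smooth_on_inner_const:
  fixes f :: "'a::real_normed_vector \<Rightarrow> 'b::real_inner"
  assumes "open S" "smooth_on S f"
  shows "smooth_on S (\<lambda>x. f x \<bullet> u)"
  by (rule smooth_on_bounded_linear[OF bounded_linear_inner_left assms])

text \<open>Reduction to the real-valued case by pairing with constant vectors.\<close>

lemma fderiv_commute:
  fixes f :: "'a::real_normed_vector \<Rightarrow> 'b::real_inner"
  assumes "open D" "z \<in> D" and f: "smooth_on D f"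
  shows "fderiv (\<lambda>z. fderiv f z v) z w = fderiv (\<lambda>z. fderiv f z w) z v"
proof -
  have *: "fderiv (\<lambda>z. fderiv f z v) z w \<bullet> u = fderiv (\<lambda>z. fderiv (\<lambda>z. f z \<bullet> u) z v) z w" for u v w
  proof -
    have "fderiv (\<lambda>z. fderiv f z v) z w \<bullet> u = fderiv (\<lambda>z. fderiv f z v \<bullet> u) z w"
      by (simp add: fderiv_inner_const smooth_on_differentiable[OF smooth_on_fderiv[OF f] assms(2)])
    also have "\<dots> = fderiv (\<lambda>z. fderiv (\<lambda>z. f z \<bullet> u) z v) z w"
      by (rule arg_cong[where f = "\<lambda>g. g w"], rule fderiv_cong[OF assms(1,2)])
        (simp add: fderiv_inner_const smooth_on_differentiable[OF f])
    finally show ?thesis .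
  qed
  have "fderiv (\<lambda>z. fderiv f z v) z w \<bullet> u = fderiv (\<lambda>z. fderiv f z w) z v \<bullet> u" for u
    unfolding * by (rule fderiv_commute_real[OF assms(1,2) smooth_on_inner_const[OF assms(1) f]])
  then show ?thesis using vector_eq_rdot by blast
qed

lemma fderiv_fst_snd:
  assumes "f differentiable (at z)"
  shows "fderiv f z v = (fderiv (\<lambda>z. fst (f z)) z v, fderiv (\<lambda>z. snd (f z)) z v)"
  by (simp add: fderiv_bounded_linear[OF bounded_linear_fst assms]
      fderiv_bounded_linear[OF bounded_linear_snd assms])

text \<open>A function trapped between 0 and a function with a critical zero inherits the critical zero. It
  disposes of the quadratic error term in \<open>has_derivative_kinetic\<close>.\<close>

lemma has_derivative_zero_squeeze:
  fixes r f :: "'a::real_normed_vector \<Rightarrow> real"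
  assumes f: "(f has_derivative (\<lambda>_. 0)) (at z)" "f z = 0"
    and ev: "\<forall>\<^sub>F y in nhds z. 0 \<le> r y \<and> r y \<le> f y"
  shows "(r has_derivative (\<lambda>_. 0)) (at z)"
proof -
  have "r z = 0" using eventually_nhds_x_imp_x[OF ev] f(2) by simp
  have "((\<lambda>y. f y / norm (y - z)) \<longlongrightarrow> 0) (at z)"
  proof -
    have "((\<lambda>y. norm (f y - f z - 0) / norm (y - z)) \<longlongrightarrow> 0) (at z)"
      using f(1) unfolding has_derivative_iff_norm by blast
    then have "((\<lambda>y. \<bar>f y / norm (y - z)\<bar>) \<longlongrightarrow> 0) (at z)"
      using f(2) by simp
    then show ?thesis by (rule tendsto_rabs_zero_cancel)
  qed
  moreover have "\<forall>\<^sub>F y in at z. norm (norm (r y - r z - 0) / norm (y - z)) \<le> f y / norm (y - z)"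
    using ev unfolding eventually_at_filter
    by eventually_elim (auto simp: \<open>r z = 0\<close> divide_right_mono)
  ultimately have "((\<lambda>y. norm (r y - r z - 0) / norm (y - z)) \<longlongrightarrow> 0) (at z)"
    by (rule Lim_null_comparison[rotated])
  then show ?thesis by (simp add: has_derivative_iff_norm)
qed

text \<open>The family of these functions is closed under directional derivatives, so one induction gives
  all orders at once.\<close>

lemma smooth_on_trig_combination:
  fixes e :: "'z::real_inner" and u w :: "'b::real_normed_vector"
  shows "smooth_on UNIV (\<lambda>z. sin (2 * pi * (z \<bullet> e)) *\<^sub>R u + cos (2 * pi * (z \<bullet> e)) *\<^sub>R w)"
proof -
  have D: "((\<lambda>z. sin (2 * pi * (z \<bullet> e)) *\<^sub>R u + cos (2 * pi * (z \<bullet> e)) *\<^sub>R w) has_derivative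
    (\<lambda>v. sin (2 * pi * (z \<bullet> e)) *\<^sub>R (- (2 * pi * (v \<bullet> e)) *\<^sub>R w)
      + cos (2 * pi * (z \<bullet> e)) *\<^sub>R ((2 * pi * (v \<bullet> e)) *\<^sub>R u))) (at z)" for z and u w :: 'b
    by (auto intro!: derivative_eq_intros simp: algebra_simps)
  have "Ck_on k UNIV (\<lambda>z. sin (2 * pi * (z \<bullet> e)) *\<^sub>R u + cos (2 * pi * (z \<bullet> e)) *\<^sub>R w)" for k
  proof (induction k arbitrary: u w)
    case 0
    show ?case by (auto intro!: continuous_intros)
  next
    case (Suc k)
    show ?case
      unfolding Ck_on.simps fderiv_eq[OF D] using D differentiable_def Suc by blast
  qed
  then show ?thesis by (simp add: smooth_on_def)
qed


section \<open>Means of periodic functions and the vanishing of the density\<close>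

text \<open>Cut the shifted box along the hyperplane that contains the upper face of the original one: the
  protruding part is the translate by the period of the part that has been left.\<close>

lemma integral_periodic_shift:
  fixes f :: "'z::euclidean_space \<Rightarrow> real"
  assumes k: "k \<in> Basis" and cont: "continuous_on UNIV f"
    and per: "\<And>z. f (z + k) = f z" and h: "0 \<le> h" "h \<le> 1"
  shows "integral (cbox a (a + One)) (\<lambda>z. f (z + h *\<^sub>R k)) = integral (cbox a (a + One)) f"
proof -
  define lo where "lo = cbox a (a + One) \<inter> {z. z \<bullet> k \<le> a \<bullet> k + h}"
  define hi where "hi = cbox a (a + One) \<inter> {z. z \<bullet> k \<ge> a \<bullet> k + h}"
  have int: "f integrable_on cbox u v" for u v
    by (rule integrable_continuous) (rule continuous_on_subset[OF cont], simp)
  have mem: "z \<in> cbox (a + c *\<^sub>R k) (a + c *\<^sub>R k + One) \<longleftrightarrow>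
      (a \<bullet> k + c \<le> z \<bullet> k \<and> z \<bullet> k \<le> a \<bullet> k + c + 1)
      \<and> (\<forall>i\<in>Basis - {k}. a \<bullet> i \<le> z \<bullet> i \<and> z \<bullet> i \<le> a \<bullet> i + 1)" for z c
  proof -
    have "(a + c *\<^sub>R k) \<bullet> i = a \<bullet> i" if "i \<in> Basis - {k}" for i
      using k that inner_not_same_Basis[of k i] by (auto simp: inner_add_left)
    moreover have "(a + c *\<^sub>R k) \<bullet> k = a \<bullet> k + c"
      using k by (simp add: inner_add_left)
    ultimately show ?thesis
      unfolding mem_box inner_add_left[of _ One] using k
      by (subst insert_Diff[OF k, symmetric], subst ball_simps(7)) (simp add: add.assoc)
  qed
  have mem0: "z \<in> cbox a (a + One) \<longleftrightarrow> (a \<bullet> k \<le> z \<bullet> k \<and> z \<bullet> k \<le> a \<bullet> k + 1)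
      \<and> (\<forall>i\<in>Basis - {k}. a \<bullet> i \<le> z \<bullet> i \<and> z \<bullet> i \<le> a \<bullet> i + 1)" for z
    using mem[of z 0] by simp
  let ?C = "cbox (a + h *\<^sub>R k) (a + h *\<^sub>R k + One)"
  have eq1: "?C \<inter> {z. z \<bullet> k \<le> a \<bullet> k + 1} = hi"
    unfolding hi_def using h by (auto simp: mem mem0)
  have eq2: "?C \<inter> {z. z \<bullet> k \<ge> a \<bullet> k + 1} = (+) k ` lo"
  proof -
    have "z \<in> (+) k ` lo \<longleftrightarrow> z - k \<in> lo" for z
      by (auto simp: image_iff intro: bexI[of _ "z - k"])
    moreover have "z - k \<in> lo \<longleftrightarrow> z \<in> ?C \<inter> {z. z \<bullet> k \<ge> a \<bullet> k + 1}" for z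
    proof -
      have "(z - k) \<bullet> i = z \<bullet> i" if "i \<in> Basis - {k}" for i
        using that k inner_not_same_Basis[of k i] by (auto simp: inner_diff_left)
      then have all: "(\<forall>i\<in>Basis - {k}. a \<bullet> i \<le> (z - k) \<bullet> i \<and> (z - k) \<bullet> i \<le> a \<bullet> i + 1)
          \<longleftrightarrow> (\<forall>i\<in>Basis - {k}. a \<bullet> i \<le> z \<bullet> i \<and> z \<bullet> i \<le> a \<bullet> i + 1)"
        by (intro ball_cong refl) simp
      have "(z - k) \<bullet> k = z \<bullet> k - 1" using k by (simp add: inner_diff_left)
      moreover have "((q \<le> p - 1 \<and> p - 1 \<le> q + 1) \<and> A) \<and> p - 1 \<le> q + h \<longleftrightarrow>
          ((q + h \<le> p \<and> p \<le> q + h + 1) \<and> A) \<and> q + 1 \<le> p" for p q A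
        using h by auto
      ultimately show ?thesis
        unfolding lo_def Int_iff mem_Collect_eq mem mem0 all by simp
    qed
    ultimately show ?thesis by blast
  qed
  have lobox: "\<exists>u v. lo = cbox u v"
    unfolding lo_def by (intro exI) (rule interval_split(1)[OF k])
  have "integral (cbox a (a + One)) (\<lambda>z. f (z + h *\<^sub>R k)) = integral ?C f"
    using integral_shift_cbox[of "a + h *\<^sub>R k" "h *\<^sub>R k" "a + h *\<^sub>R k + One" f]
    by (simp add: algebra_simps)
  also have "\<dots> = integral hi f + integral ((+) k ` lo) f"
    using integral_split[OF int k, of "a + h *\<^sub>R k" "a + h *\<^sub>R k + One" "a \<bullet> k + 1"]
    unfolding eq1 eq2 .
  also have "integral ((+) k ` lo) f = integral lo f"
  proof -
    obtain u v where uv: "lo = cbox u v" using lobox by blast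
    have "integral (cbox u v) (f \<circ> (+) k) = integral (cbox (u + k) (v + k)) f"
      by (rule integral_shift_cbox_plus)
    moreover have "f \<circ> (+) k = f" using per by (auto simp: add.commute)
    moreover have "(+) k ` cbox u v = cbox (u + k) (v + k)"
      by (simp add: cbox_translation add.commute)
    ultimately show ?thesis by (simp add: uv)
  qed
  also have "integral hi f + integral lo f = integral (cbox a (a + One)) f"
    using integral_split[OF int k, of a "a + One" "a \<bullet> k + h"] unfolding hi_def lo_def by simp
  finally show ?thesis .
qed

text \<open>The integral of the translates along \<open>k\<close> is constant by periodicity, and its derivative is the
  integral of the derivative.\<close>

lemma integral_fderiv_periodic:
  fixes f :: "'z::euclidean_space \<Rightarrow> real"
  assumes k: "k \<in> Basis" and f: "C1_on UNIV f" and per: "\<And>z. f (z + k) = f z"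
  shows "integral (cbox a (a + One)) (\<lambda>z. fderiv f z k) = 0"
proof -
  have cont: "continuous_on A f" for A
    using C1_on_continuous[OF f] continuous_on_subset by blast
  have cont': "continuous_on A (\<lambda>z. fderiv f z k)" for A
    using C1_on_continuous_fderiv[OF f, of k] continuous_on_subset by blast
  have "((\<lambda>h. integral (cbox a (a + One)) (\<lambda>z. f (z + h *\<^sub>R k))) has_field_derivative
        integral (cbox a (a + One)) (\<lambda>z. fderiv f (z + 0 *\<^sub>R k) k)) (at 0 within {0..1})"
  proof (rule leibniz_rule_field_derivative[where fx = "\<lambda>h z. fderiv f (z + h *\<^sub>R k) k"])
    show "((\<lambda>h. f (z + h *\<^sub>R k)) has_field_derivative fderiv f (z + h *\<^sub>R k) k) (at h within {0..1})"
      for h z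
    proof -
      have "((\<lambda>h. z + h *\<^sub>R k) has_derivative (\<lambda>h. h *\<^sub>R k)) (at h within {0..1})"
        by (auto intro!: derivative_eq_intros)
      then have "((\<lambda>h. f (z + h *\<^sub>R k)) has_derivative (\<lambda>r. fderiv f (z + h *\<^sub>R k) (r *\<^sub>R k))) (at h within {0..1})"
        by (rule has_derivative_compose) (rule C1_on_has_derivative[OF f UNIV_I])
      moreover have "fderiv f (z + h *\<^sub>R k) (r *\<^sub>R k) = fderiv f (z + h *\<^sub>R k) k * r" for r
        using linear_scale[OF has_derivative_linear[OF C1_on_has_derivative[OF f UNIV_I]]] by simp
      ultimately show ?thesis by (simp add: has_field_derivative_def)
    qed
    show "(\<lambda>z. f (z + h *\<^sub>R k)) integrable_on cbox a (a + One)" for h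
      by (intro integrable_continuous continuous_on_compose2[OF cont[of UNIV]] continuous_intros) auto
    show "continuous_on ({0..1} \<times> cbox a (a + One)) (\<lambda>(h, z). fderiv f (z + h *\<^sub>R k) k)"
      unfolding case_prod_beta
      by (intro continuous_on_compose2[OF cont'[of UNIV]] continuous_intros) auto
  qed auto
  moreover have "((\<lambda>h. integral (cbox a (a + One)) (\<lambda>z. f (z + h *\<^sub>R k))) has_field_derivative 0)
      (at 0 within {0..1})"
    by (rule has_field_derivative_transform_within[where d = 1
          and f = "\<lambda>h. integral (cbox a (a + One)) f"])
       (use integral_periodic_shift[OF k cont per] in auto)
  moreover have "at 0 within {0..1::real} \<noteq> bot"
    by (simp add: at_within_Icc_at_right)
  ultimately have "integral (cbox a (a + One)) (\<lambda>z. fderiv f (z + 0 *\<^sub>R k) k) = 0"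
    by (rule has_field_derivative_unique)
  then show ?thesis by simp
qed

definition set_coord :: "'z::euclidean_space \<Rightarrow> real \<Rightarrow> 'z \<Rightarrow> 'z"
  where "set_coord e x z = z + (x - z \<bullet> e) *\<^sub>R e"

text \<open>The mean over the slice where the coordinate along \<open>e\<close> equals \<open>x\<close>. The integral runs over a full box,
  including the direction \<open>e\<close> on which the integrand does not depend; this avoids a separate space for
  the remaining coordinates, and the box has side length 1. The corner \<open>a\<close> is free so that any
  given point can be placed in the box.\<close>

definition slice_mean :: "'z::euclidean_space \<Rightarrow> 'z \<Rightarrow> ('z \<Rightarrow> real) \<Rightarrow> real \<Rightarrow> real"
  where "slice_mean e a f x = integral (cbox a (a + One)) (\<lambda>z. f (set_coord e x z))"

lemma continuous_on_set_coord [continuous_intros]: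
  "continuous_on A f \<Longrightarrow> continuous_on A g \<Longrightarrow> continuous_on A (\<lambda>t. set_coord e (f t) (g t))"
  unfolding set_coord_def by (intro continuous_intros)

lemma slice_integrable:
  fixes f :: "'z::euclidean_space \<Rightarrow> real"
  assumes "continuous_on UNIV f"
  shows "(\<lambda>z. f (set_coord e x z)) integrable_on cbox a b"
  by (intro integrable_continuous continuous_on_compose2[OF assms] continuous_intros) auto

lemma slice_mean_fderiv_periodic:
  fixes f :: "'z::euclidean_space \<Rightarrow> real"
  assumes e: "e \<in> Basis" and k: "k \<in> Basis" "k \<noteq> e" and f: "C1_on UNIV f"
    and per: "\<And>z. f (z + k) = f z"
  shows "slice_mean e a (\<lambda>z. fderiv f z k) x = 0"
proof -
  let ?g = "\<lambda>z. f (set_coord e x z)"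
  have D: "(?g has_derivative (\<lambda>v. fderiv f (set_coord e x z) (v - (v \<bullet> e) *\<^sub>R e))) (at z)" for z
  proof -
    have "(set_coord e x has_derivative (\<lambda>v. v - (v \<bullet> e) *\<^sub>R e)) (at z)"
      unfolding set_coord_def[abs_def] by (auto intro!: derivative_eq_intros)
    then show ?thesis
      by (rule has_derivative_compose) (rule C1_on_has_derivative[OF f UNIV_I])
  qed
  have "C1_on UNIV ?g"
    by (rule C1_onI[OF D _ open_UNIV])
      (intro continuous_on_compose2[OF C1_on_continuous_fderiv[OF f]] continuous_intros, auto)
  moreover have "set_coord e x (z + k) = set_coord e x z + k" for z
    using e k by (simp add: set_coord_def inner_add_left inner_not_same_Basis)
  ultimately have "integral (cbox a (a + One)) (\<lambda>z. fderiv ?g z k) = 0"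
    using integral_fderiv_periodic[OF k(1)] per by simp
  moreover have "fderiv ?g z k = fderiv f (set_coord e x z) k" for z
    using fderiv_eq[OF D] e k by (simp add: inner_not_same_Basis)
  ultimately show ?thesis by (simp add: slice_mean_def)
qed

lemma slice_mean_has_derivative:
  fixes f :: "'z::euclidean_space \<Rightarrow> real"
  assumes f: "C1_on UNIV f"
  shows "(slice_mean e a f has_real_derivative slice_mean e a (\<lambda>z. fderiv f z e) x) (at x)"
proof -
  have "((\<lambda>x. integral (cbox a (a + One)) (\<lambda>z. f (set_coord e x z))) has_field_derivative
        integral (cbox a (a + One)) (\<lambda>z. fderiv f (set_coord e x z) e)) (at x within UNIV)"
  proof (rule leibniz_rule_field_derivative[where fx = "\<lambda>x z. fderiv f (set_coord e x z) e"])
    show "((\<lambda>x. f (set_coord e x z)) has_field_derivative fderiv f (set_coord e x z) e) (at x within UNIV)"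
      for x z
    proof -
      have "((\<lambda>x. set_coord e x z) has_derivative (\<lambda>r. r *\<^sub>R e)) (at x)"
        unfolding set_coord_def[abs_def] by (auto intro!: derivative_eq_intros)
      then have "((\<lambda>x. f (set_coord e x z)) has_derivative (\<lambda>r. fderiv f (set_coord e x z) (r *\<^sub>R e))) (at x)"
        by (rule has_derivative_compose) (rule C1_on_has_derivative[OF f UNIV_I])
      moreover have "fderiv f (set_coord e x z) (r *\<^sub>R e) = fderiv f (set_coord e x z) e * r" for r
        using linear_scale[OF has_derivative_linear[OF C1_on_has_derivative[OF f UNIV_I]]] by simp
      ultimately show ?thesis by (simp add: has_field_derivative_def)
    qed
    show "(\<lambda>z. f (set_coord e x z)) integrable_on cbox a (a + One)" for x
      by (rule slice_integrable[OF C1_on_continuous[OF f]])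
    show "continuous_on (UNIV \<times> cbox a (a + One)) (\<lambda>(x, z). fderiv f (set_coord e x z) e)"
      unfolding case_prod_beta
      by (intro continuous_on_compose2[OF C1_on_continuous_fderiv[OF f]] continuous_intros) auto
  qed auto
  then show ?thesis unfolding slice_mean_def[abs_def] by simp
qed

text \<open>Averaging the balance law over a slice leaves \<open>sin(2 \<pi> x) B'(x) = 0\<close> for the mean \<open>B\<close> of \<open>\<beta>\<close>, so
  \<open>B\<close> takes the same value at \<open>x = 0\<close> and at \<open>x = 1/2\<close>. The two signs force this value to be 0, and a
  continuous nonnegative function of mean 0 vanishes.\<close>

theorem conserved_density_vanishes:
  fixes \<beta> l :: "'z::euclidean_space \<Rightarrow> real" and f :: "'z \<Rightarrow> 'z \<Rightarrow> real"
  assumes e: "e1 \<in> Basis" "e2 \<in> Basis" "e1 \<noteq> e2" and K: "K \<subseteq> Basis - {e1}"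
    and \<beta>: "C1_on UNIV \<beta>" "\<And>z. \<beta> (z + e2) = \<beta> z"
    and l: "C1_on UNIV l" "\<And>z. l (z + e2) = l z"
    and f: "\<And>k. k \<in> K \<Longrightarrow> C1_on UNIV (f k)" "\<And>k z. k \<in> K \<Longrightarrow> f k (z + k) = f k z"
    and law: "\<And>z. 0 < z \<bullet> e1 \<Longrightarrow> z \<bullet> e1 < 1/2 \<Longrightarrow>
      sin (2 * pi * (z \<bullet> e1)) * fderiv \<beta> z e1 + cos (2 * pi * (z \<bullet> e1)) * fderiv \<beta> z e2
      = fderiv l z e2 + (\<Sum>k\<in>K. fderiv (f k) z k)"
    and nonneg: "\<And>z. z \<bullet> e1 = 0 \<Longrightarrow> 0 \<le> \<beta> z"
    and nonpos: "\<And>z. z \<bullet> e1 = 1/2 \<Longrightarrow> \<beta> z \<le> 0"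
    and z: "z \<bullet> e1 = 0"
  shows "\<beta> z = 0"
proof -
  let ?C = "cbox z (z + One)"
  have coord: "set_coord e1 x y \<bullet> e1 = x" for x y
    using e by (simp add: set_coord_def inner_add_left)
  have finK: "finite K" using K finite_Basis finite_subset by blast
  have "slice_mean e1 z (\<lambda>z. fderiv \<beta> z e1) x = 0" if x: "0 < x" "x < 1/2" for x
  proof -
    have int: "(\<lambda>y. fderiv g (set_coord e1 x y) v) integrable_on ?C" if "C1_on UNIV g"
      for g :: "'z \<Rightarrow> real" and v
      by (rule slice_integrable[OF C1_on_continuous_fderiv[OF that]])
    have "sin (2 * pi * x) * slice_mean e1 z (\<lambda>z. fderiv \<beta> z e1) x
      + cos (2 * pi * x) * slice_mean e1 z (\<lambda>z. fderiv \<beta> z e2) x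
      = integral ?C (\<lambda>y. sin (2 * pi * x) * fderiv \<beta> (set_coord e1 x y) e1
          + cos (2 * pi * x) * fderiv \<beta> (set_coord e1 x y) e2)"
      unfolding slice_mean_def
      by (subst integral_add) (use int[OF \<beta>(1)] in \<open>auto intro: integrable_on_mult_right\<close>)
    also have "\<dots> = integral ?C (\<lambda>y. fderiv l (set_coord e1 x y) e2
          + (\<Sum>k\<in>K. fderiv (f k) (set_coord e1 x y) k))"
      by (rule integral_cong) (use law[of "set_coord e1 x _"] x in \<open>simp add: coord\<close>)
    also have "\<dots> = slice_mean e1 z (\<lambda>z. fderiv l z e2) x
          + (\<Sum>k\<in>K. slice_mean e1 z (\<lambda>z. fderiv (f k) z k) x)"
      unfolding slice_mean_def
      by (subst integral_add)
        (use int[OF l(1)] int[OF f(1)] finK in \<open>auto intro!: integrable_sum integral_sum\<close>)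
    also have "(\<Sum>k\<in>K. slice_mean e1 z (\<lambda>z. fderiv (f k) z k) x) = 0"
      by (rule sum.neutral) (use K f e slice_mean_fderiv_periodic in blast)
    finally have "sin (2 * pi * x) * slice_mean e1 z (\<lambda>z. fderiv \<beta> z e1) x = 0"
      using slice_mean_fderiv_periodic[OF e(1,2) e(3)[symmetric] \<beta>]
        slice_mean_fderiv_periodic[OF e(1,2) e(3)[symmetric] l] by simp
    moreover have "sin (2 * pi * x) > 0"
      by (rule sin_gt_zero) (use x in auto)
    ultimately show ?thesis by simp
  qed
  then have der: "(slice_mean e1 z \<beta> has_real_derivative 0) (at x)" if "0 < x" "x < 1/2" for x
    using slice_mean_has_derivative[OF \<beta>(1), of e1 z x] that by metis
  have "continuous_on {0..1/2} (slice_mean e1 z \<beta>)"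
    by (intro continuous_at_imp_continuous_on ballI DERIV_isCont)
      (rule slice_mean_has_derivative[OF \<beta>(1)])
  then have "slice_mean e1 z \<beta> (1/2) = slice_mean e1 z \<beta> 0"
    by (rule DERIV_isconst_end[rotated]) (simp_all add: der)
  moreover have "0 \<le> slice_mean e1 z \<beta> 0"
    unfolding slice_mean_def by (rule integral_nonneg) 
      (use nonneg coord slice_integrable[OF C1_on_continuous[OF \<beta>(1)]] in auto)
  moreover have "slice_mean e1 z \<beta> (1/2) \<le> 0"
    unfolding slice_mean_def
    by (rule integral_le[where g = "\<lambda>_. 0", simplified])
      (use nonpos coord slice_integrable[OF C1_on_continuous[OF \<beta>(1)]] in auto)
  ultimately have "integral ?C (\<lambda>y. \<beta> (set_coord e1 0 y)) = 0"
    unfolding slice_mean_def by linarith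
  moreover have "continuous_on ?C (\<lambda>y. \<beta> (set_coord e1 0 y))"
    by (intro continuous_on_compose2[OF C1_on_continuous[OF \<beta>(1)]] continuous_intros) auto
  moreover have "box z (z + One) \<noteq> {}"
    by (auto simp: box_ne_empty inner_add_left)
  ultimately have "\<forall>y\<in>?C. \<beta> (set_coord e1 0 y) = 0"
    using nonneg coord by (subst (asm) integral_cbox_eq_0_iff) auto
  moreover have "z \<in> ?C" by (auto simp: mem_box inner_add_left)
  moreover have "set_coord e1 0 z = z" using z by (simp add: set_coord_def)
  ultimately show ?thesis by metis
qed


section \<open>Smooth families of inner products on a finite-dimensional space\<close>

text \<open>The coordinate space of a manifold is a finite-dimensional real inner product space that may be
  trivial. A finite Parseval frame does the work of an orthonormal basis there: it expands vectors, linear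
  maps and bilinear forms.\<close>

definition parseval_frame :: "'e::real_inner set \<Rightarrow> bool"
  where "parseval_frame E \<longleftrightarrow> finite E \<and> (\<forall>u. (\<Sum>e\<in>E. (u \<bullet> e) *\<^sub>R e) = u)"

text \<open>Gram-Schmidt, followed by normalisation of the nonzero vectors.\<close>

lemma parseval_frame_exists:
  fixes B :: "'e::real_inner set"
  assumes "finite B" "span B = UNIV"
  obtains E :: "'e set" where "parseval_frame E"
proof -
  obtain C :: "'e set" where C: "finite C" "span C = UNIV" "pairwise orthogonal C"
    using basis_orthogonal[OF assms(1)] assms(2) by metis
  define E where "E = (\<lambda>c. c /\<^sub>R norm c) ` (C - {0})"
  have fin: "finite E" using C by (simp add: E_def)
  have unit: "e \<bullet> e = 1" if "e \<in> E" for e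
    using that by (auto simp: E_def dot_square_norm power2_eq_square field_simps split: if_splits)
  have orth: "e \<bullet> e' = 0" if "e \<in> E" "e' \<in> E" "e \<noteq> e'" for e e'
  proof -
    obtain c c' where c: "c \<in> C" "c' \<in> C" "e = c /\<^sub>R norm c" "e' = c' /\<^sub>R norm c'"
      using \<open>e \<in> E\<close> \<open>e' \<in> E\<close> unfolding E_def by blast
    then have "c \<noteq> c'" using that(3) by auto
    then have "c \<bullet> c' = 0" using C(3) c by (auto simp: pairwise_def orthogonal_def)
    then show ?thesis using c by simp
  qed
  have "(\<Sum>e\<in>E. (u \<bullet> e) *\<^sub>R e) = u" for u
  proof -
    define w where "w = u - (\<Sum>e\<in>E. (u \<bullet> e) *\<^sub>R e)"
    have wE: "w \<bullet> e = 0" if "e \<in> E" for e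
    proof -
      have "(\<Sum>e'\<in>E. (u \<bullet> e') * (e' \<bullet> e)) = (\<Sum>e'\<in>E. if e' = e then u \<bullet> e else 0)"
        by (rule sum.cong) (use orth unit that in auto)
      also have "\<dots> = u \<bullet> e" using fin that by simp
      finally show ?thesis by (simp add: w_def inner_diff_left inner_sum_left)
    qed
    have wC: "w \<bullet> c = 0" if "c \<in> C" for c
    proof (cases "c = 0")
      case False
      then have "w \<bullet> (c /\<^sub>R norm c) = 0" using that by (intro wE) (auto simp: E_def)
      then show ?thesis using False by simp
    qed simp
    have "w \<bullet> v = 0" if "v \<in> span C" for v
      using that by (induction rule: span_induct) (auto simp: wC inner_add_right subspace_def)
    then have "w \<bullet> w = 0" using C by simp
    then show ?thesis by (simp add: w_def)
  qed
  then have "parseval_frame E" using fin by (simp add: parseval_frame_def)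
  then show ?thesis by (rule that)
qed

lemma linear_parseval_expand:
  fixes f :: "'e::real_inner \<Rightarrow> 'b::real_vector"
  assumes "parseval_frame E" "linear f"
  shows "f u = (\<Sum>e\<in>E. (u \<bullet> e) *\<^sub>R f e)"
proof -
  have "f u = f (\<Sum>e\<in>E. (u \<bullet> e) *\<^sub>R e)" using assms(1) by (simp add: parseval_frame_def)
  also have "\<dots> = (\<Sum>e\<in>E. (u \<bullet> e) *\<^sub>R f e)"
    using assms(2) by (simp add: linear_sum linear_scale o_def)
  finally show ?thesis .
qed

lemma parseval_frame_Basis: "parseval_frame (Basis :: 'e::euclidean_space set)"
  by (simp add: parseval_frame_def euclidean_representation)

definition inner_form :: "('e::real_inner \<Rightarrow> 'e \<Rightarrow> real) \<Rightarrow> bool"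
  where "inner_form a \<longleftrightarrow> (\<forall>u. linear (a u)) \<and> (\<forall>u v. a u v = a v u) \<and> (\<forall>u. u \<noteq> 0 \<longrightarrow> a u u > 0)"

lemma inner_form_sym: "inner_form a \<Longrightarrow> a u v = a v u"
  and inner_form_linear: "inner_form a \<Longrightarrow> linear (a u)"
  and inner_form_pos: "inner_form a \<Longrightarrow> u \<noteq> 0 \<Longrightarrow> a u u > 0"
  by (auto simp: inner_form_def)

lemma inner_form_linear_left:
  assumes "inner_form a" shows "linear (\<lambda>u. a u v)"
proof -
  have "(\<lambda>u. a u v) = a v" using assms by (auto simp: inner_form_def)
  then show ?thesis using assms by (simp add: inner_form_def)
qed

lemma inner_form_zero: "inner_form a \<Longrightarrow> a 0 u = 0" "inner_form a \<Longrightarrow> a u 0 = 0"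
  by (rule linear_0[OF inner_form_linear_left], assumption)
    (rule linear_0[OF inner_form_linear], assumption)

lemma inner_form_nonneg: "inner_form a \<Longrightarrow> a u u \<ge> 0"
  by (cases "u = 0") (auto simp: inner_form_zero inner_form_pos less_imp_le)

lemma inner_form_eq_0: "inner_form a \<Longrightarrow> a u u = 0 \<longleftrightarrow> u = 0"
  using inner_form_pos[of a u] inner_form_zero(1)[of a 0] by (cases "u = 0") auto

lemma inner_form_inner: "inner_form (\<bullet>)"
  by (auto simp: inner_form_def bounded_linear.linear[OF bounded_linear_inner_right] inner_commute)

lemma inner_form_expand:
  assumes E: "parseval_frame E" and a: "inner_form a"
  shows "a u v = (\<Sum>e\<in>E. \<Sum>e'\<in>E. (u \<bullet> e) * ((v \<bullet> e') * a e e'))"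
proof -
  have "a u v = (\<Sum>e\<in>E. (u \<bullet> e) * a e v)"
    using linear_parseval_expand[OF E inner_form_linear_left[OF a, of v], of u]
    by (simp only: real_scaleR_def)
  also have "\<dots> = (\<Sum>e\<in>E. (u \<bullet> e) * (\<Sum>e'\<in>E. (v \<bullet> e') * a e e'))"
  proof (rule sum.cong[OF refl])
    show "(u \<bullet> e) * a e v = (u \<bullet> e) * (\<Sum>e'\<in>E. (v \<bullet> e') * a e e')" for e
      using linear_parseval_expand[OF E inner_form_linear[OF a, of e], of v]
      by (simp only: real_scaleR_def)
  qed
  finally show ?thesis by (simp add: sum_distrib_left)
qed

text \<open>A maximal independent subset of the frame is a finite basis.\<close>

lemma linear_injective_imp_surj_frame:
  fixes f :: "'e::real_inner \<Rightarrow> 'e" and E :: "'e set"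
  assumes E: "parseval_frame E" and f: "linear f" "inj f"
  shows "surj f"
proof -
  have span: "span E = UNIV"
  proof -
    have "u \<in> span E" for u
    proof -
      have "(\<Sum>e\<in>E. (u \<bullet> e) *\<^sub>R e) \<in> span E"
        by (intro span_sum span_scale span_base)
      then show ?thesis using E by (simp add: parseval_frame_def)
    qed
    then show ?thesis by auto
  qed
  obtain B where B: "B \<subseteq> E" "independent B" "E \<subseteq> span B"
    using maximal_independent_subset by blast
  have "finite B" using B(1) E finite_subset by (auto simp: parseval_frame_def)
  moreover have "span B = UNIV"
    using B(3) span by (metis span_mono span_span top.extremum_uniqueI)
  ultimately interpret finite_dimensional_vector_space "scaleR :: real \<Rightarrow> 'e \<Rightarrow> 'e" B
    by unfold_locales (use B(2) in \<open>auto simp: dependent_raw_def span_raw_def\<close>)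
  show ?thesis using linear_inj_imp_surj f by (simp add: linear_def)
qed

text \<open>Riesz representation with respect to an arbitrary inner product. It is the reason why the index
  raising \<open>sharp\<close>, the Christoffel symbols and the Hamiltonian vector field, all of them definite
  descriptions, denote what they should.\<close>

lemma inner_form_represents:
  fixes a :: "'e::real_inner \<Rightarrow> 'e \<Rightarrow> real" and E :: "'e set"
  assumes E: "parseval_frame E" and a: "inner_form a" and f: "linear f"
  shows "\<exists>!v. \<forall>w. a v w = f w"
proof -
  define A where "A u = (\<Sum>e\<in>E. a u e *\<^sub>R e)" for u
  have dual: "(\<Sum>e\<in>E. f e *\<^sub>R e) \<bullet> w = f w" if "linear f" for f :: "'e \<Rightarrow> real" and w
    using linear_parseval_expand[OF E that, of w]
    by (simp add: inner_sum_left inner_commute[of w] mult.commute)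
  have A: "A u \<bullet> w = a u w" for u w
    unfolding A_def by (rule dual[OF inner_form_linear[OF a]])
  have eq: "u = u'" if "\<forall>w. a u w = a u' w" for u u'
  proof -
    have "a (u - u') (u - u') = 0"
      using linear_diff[OF inner_form_linear_left[OF a]] that by simp
    then show ?thesis using inner_form_eq_0[OF a] by simp
  qed
  have "linear A"
    by (rule linearI; rule vector_eq_rdot[THEN iffD1])
      (simp_all add: A inner_add_left linear_add[OF inner_form_linear_left[OF a]]
        linear_scale[OF inner_form_linear_left[OF a]])
  moreover have "inj A" using eq A by (metis injI)
  ultimately have "surj A" by (rule linear_injective_imp_surj_frame[OF E])
  then obtain v where "A v = (\<Sum>e\<in>E. f e *\<^sub>R e)" by (metis surjD)
  then have "\<forall>w. a v w = f w" using A dual[OF f] by metis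
  then show ?thesis using eq by metis
qed

lemma inner_form_Cauchy_Schwarz:
  assumes a: "inner_form a"
  shows "(a u v)\<^sup>2 \<le> a u u * a v v"
proof (cases "v = 0")
  case True
  then show ?thesis using inner_form_zero[OF a] by simp
next
  case False
  define t where "t = a u v / a v v"
  have v: "a v v > 0" by (rule inner_form_pos[OF a False])
  have "0 \<le> a (u - t *\<^sub>R v) (u - t *\<^sub>R v)" by (rule inner_form_nonneg[OF a])
  also have "\<dots> = a u u - 2 * t * a u v + t * t * a v v"
    by (simp add: linear_diff[OF inner_form_linear[OF a]] linear_diff[OF inner_form_linear_left[OF a]]
        linear_scale[OF inner_form_linear[OF a]] linear_scale[OF inner_form_linear_left[OF a]]
        inner_form_sym[OF a, of v u] algebra_simps)
  also have "\<dots> = a u u - (a u v)\<^sup>2 / a v v"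
    using v by (simp add: t_def power2_eq_square field_simps)
  finally show ?thesis using v by (simp add: field_simps)
qed

text \<open>Let \<open>S\<close> represent \<open>w\<close>, that is \<open>a S x = w \<bullet> x\<close>. Then \<open>|w|\<^sup>4 = (a S w)\<^sup>2 \<le> (w \<bullet> S) a w w\<close> by
  Cauchy-Schwarz for \<open>a\<close>, and \<open>w \<bullet> S\<close> is at most a multiple of \<open>|w|\<^sup>2\<close> because \<open>S\<close> depends linearly
  on \<open>w\<close>.\<close>

lemma inner_form_coercive:
  fixes a :: "'e::real_inner \<Rightarrow> 'e \<Rightarrow> real" and E :: "'e set"
  assumes E: "parseval_frame E" and a: "inner_form a"
  obtains m where "m > 0" "\<And>w. m * (w \<bullet> w) \<le> a w w"
proof -
  have "\<exists>v. \<forall>w. a v w = e \<bullet> w" for e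
    using inner_form_represents[OF E a bounded_linear.linear[OF bounded_linear_inner_right, of e]] by blast
  then obtain s where s: "\<And>e w. a (s e) w = e \<bullet> w" by metis
  define C where "C = 1 + (\<Sum>e\<in>E. norm e * norm (s e))"
  have C: "C \<ge> 1" unfolding C_def by (simp add: sum_nonneg)
  have bound: "(w \<bullet> w) \<le> C * a w w" for w
  proof (cases "w = 0")
    case True
    then show ?thesis using inner_form_zero[OF a] by simp
  next
    case False
    define S where "S = (\<Sum>e\<in>E. (w \<bullet> e) *\<^sub>R s e)"
    have S: "a S x = w \<bullet> x" for x
    proof -
      have "a S x = (\<Sum>e\<in>E. (w \<bullet> e) * (e \<bullet> x))"
        unfolding S_def
        by (simp add: linear_sum[OF inner_form_linear_left[OF a]] linear_scale[OF inner_form_linear_left[OF a]] s)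
      also have "\<dots> = (\<Sum>e\<in>E. (w \<bullet> e) *\<^sub>R e) \<bullet> x" by (simp add: inner_sum_left)
      also have "\<dots> = w \<bullet> x" using E by (simp add: parseval_frame_def)
      finally show ?thesis .
    qed
    have "norm S \<le> (\<Sum>e\<in>E. norm w * (norm e * norm (s e)))"
      unfolding S_def
    proof (rule order_trans[OF norm_sum sum_mono])
      fix e
      have "\<bar>w \<bullet> e\<bar> * norm (s e) \<le> (norm w * norm e) * norm (s e)"
        by (intro mult_right_mono Cauchy_Schwarz_ineq2) simp
      then show "norm ((w \<bullet> e) *\<^sub>R s e) \<le> norm w * (norm e * norm (s e))" by (simp add: mult.assoc)
    qed
    also have "\<dots> \<le> norm w * C"
      unfolding sum_distrib_left[symmetric] C_def by (intro mult_left_mono) auto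
    finally have nS: "norm S \<le> norm w * C" .
    have "w \<bullet> S \<le> norm w * norm S" by (rule norm_cauchy_schwarz)
    also have "\<dots> \<le> norm w * (norm w * C)" by (intro mult_left_mono nS) simp
    finally have wS: "w \<bullet> S \<le> C * (w \<bullet> w)"
      by (simp add: dot_square_norm power2_eq_square algebra_simps)
    have "(w \<bullet> w)\<^sup>2 \<le> a S S * a w w"
      using inner_form_Cauchy_Schwarz[OF a, of S w] by (simp only: S)
    also have "\<dots> = (w \<bullet> S) * a w w" by (simp only: S)
    also have "\<dots> \<le> (C * (w \<bullet> w)) * a w w"
      by (intro mult_right_mono wS inner_form_nonneg[OF a])
    finally have "(w \<bullet> w) * (w \<bullet> w) \<le> (w \<bullet> w) * (C * a w w)"
      by (simp add: power2_eq_square mult_ac)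
    then show ?thesis using False by (simp add: mult_le_cancel_left)
  qed
  show ?thesis
  proof (rule that[of "1 / C"])
    show "1 / C > 0" using C by simp
    show "1 / C * (w \<bullet> w) \<le> a w w" for w
      using bound[of w] C by (simp add: field_simps)
  qed
qed

text \<open>Continuity of the derivative \<open>dg (Q z) (dQ z v)\<close> is joint in two arguments of which the second
  one is moving; expanding it in the frame reduces this to finitely many fixed directions.\<close>

lemma C1_on_compose_real:
  fixes g :: "'e::real_inner \<Rightarrow> real" and Q :: "'z::real_normed_vector \<Rightarrow> 'e" and E :: "'e set"
  assumes E: "parseval_frame E" and D: "open D" and Q: "C1_on D Q" "Q ` D \<subseteq> S"
    and g: "C1_on S g"
  shows "C1_on D (\<lambda>z. g (Q z))"
proof (rule C1_onI[OF _ _ D])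
  show "((\<lambda>z. g (Q z)) has_derivative (\<lambda>v. fderiv g (Q z) (fderiv Q z v))) (at z)" if "z \<in> D" for z
    by (rule has_derivative_compose[OF C1_on_has_derivative[OF Q(1) that]])
      (rule C1_on_has_derivative[OF g], use that Q in blast)
  show "continuous_on D (\<lambda>z. fderiv g (Q z) (fderiv Q z v))" for v
  proof (rule continuous_on_eq)
    show "continuous_on D (\<lambda>z. \<Sum>e\<in>E. (fderiv Q z v \<bullet> e) *\<^sub>R fderiv g (Q z) e)"
      by (intro continuous_intros C1_on_continuous_fderiv Q
          continuous_on_compose2[OF C1_on_continuous_fderiv[OF g] C1_on_continuous])
    show "(\<Sum>e\<in>E. (fderiv Q z v \<bullet> e) *\<^sub>R fderiv g (Q z) e) = fderiv g (Q z) (fderiv Q z v)"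
      if "z \<in> D" for z
    proof -
      have "linear (fderiv g (Q z))"
        using C1_on_has_derivative[OF g] has_derivative_linear Q that by blast
      then show ?thesis using linear_parseval_expand[OF E] by metis
    qed
  qed
qed

text \<open>The derivative of the coefficient \<open>G\<^sub>q(u, v)\<close> in the direction \<open>w\<close>.\<close>

definition dG :: "('e::real_inner \<Rightarrow> 'e \<Rightarrow> 'e \<Rightarrow> real) \<Rightarrow> 'e \<Rightarrow> 'e \<Rightarrow> 'e \<Rightarrow> 'e \<Rightarrow> real"
  where "dG G q w u v = fderiv (\<lambda>q. G q u v) q w"

locale smooth_metric =
  fixes E :: "'e::real_inner set" and S :: "'e set" and G :: "'e \<Rightarrow> 'e \<Rightarrow> 'e \<Rightarrow> real"
  assumes frame: "parseval_frame E"
    and open_S: "open S"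
    and form: "q \<in> S \<Longrightarrow> inner_form (G q)"
    and smooth: "smooth_on S (\<lambda>q. G q u v)"
begin

lemma has_derivative_dG: "q \<in> S \<Longrightarrow> ((\<lambda>q. G q u v) has_derivative (\<lambda>w. dG G q w u v)) (at q)"
  unfolding dG_def using smooth_on_has_derivative[OF smooth] by simp

lemma dG_eq: "q \<in> S \<Longrightarrow> ((\<lambda>q. G q u v) has_derivative f) (at q) \<Longrightarrow> dG G q w u v = f w"
  unfolding dG_def using fderiv_eq by metis

lemma linear_dG: "q \<in> S \<Longrightarrow> linear (\<lambda>w. dG G q w u v)"
  using has_derivative_dG has_derivative_linear by blast

lemma dG_sym:
  assumes "q \<in> S" shows "dG G q w u v = dG G q w v u"
  unfolding dG_def
  by (rule arg_cong[where f = "\<lambda>f. f w"], rule fderiv_cong[OF open_S assms])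
    (simp add: inner_form_sym[OF form])

lemma dG_expand:
  assumes q: "q \<in> S"
  shows "dG G q w u v = (\<Sum>e\<in>E. \<Sum>e'\<in>E. (u \<bullet> e) * ((v \<bullet> e') * dG G q w e e'))"
proof (rule dG_eq[OF q])
  have "((\<lambda>q. \<Sum>e\<in>E. \<Sum>e'\<in>E. (u \<bullet> e) * ((v \<bullet> e') * G q e e')) has_derivative
      (\<lambda>w. \<Sum>e\<in>E. \<Sum>e'\<in>E. (u \<bullet> e) * ((v \<bullet> e') * dG G q w e e'))) (at q)"
    by (intro has_derivative_sum has_derivative_mult_right has_derivative_dG q)
  then show "((\<lambda>q. G q u v) has_derivative
      (\<lambda>w. \<Sum>e\<in>E. \<Sum>e'\<in>E. (u \<bullet> e) * ((v \<bullet> e') * dG G q w e e'))) (at q)"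
    by (rule has_derivative_transform_within_open[OF _ open_S q])
      (simp add: inner_form_expand[OF frame form])
qed

lemma linear_dG_left: "q \<in> S \<Longrightarrow> linear (\<lambda>u. dG G q w u v)"
  by (subst dG_expand, assumption, rule linearI)
    (simp_all add: inner_add_left distrib_right sum.distrib sum_distrib_left mult.assoc)

lemma linear_dG_right: "q \<in> S \<Longrightarrow> linear (\<lambda>v. dG G q w u v)"
  by (subst dG_sym, assumption, rule linear_dG_left)

text \<open>The product rule for \<open>G\<^sub>Q(A, B)\<close>, obtained by expansion in the frame because smoothness of \<open>G\<close> is
  only known for fixed arguments.\<close>

lemma has_derivative_metric:
  fixes Q A B :: "'z::real_normed_vector \<Rightarrow> 'e"
  assumes Q: "(Q has_derivative Q') (at z)" and A: "(A has_derivative A') (at z)"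
    and B: "(B has_derivative B') (at z)" and S: "Q z \<in> S"
  shows "((\<lambda>z. G (Q z) (A z) (B z)) has_derivative
    (\<lambda>h. dG G (Q z) (Q' h) (A z) (B z) + G (Q z) (A' h) (B z) + G (Q z) (A z) (B' h))) (at z)"
proof -
  let ?D = "\<lambda>h. dG G (Q z) (Q' h) (A z) (B z) + G (Q z) (A' h) (B z) + G (Q z) (A z) (B' h)"
  let ?F = "\<lambda>z. \<Sum>e\<in>E. \<Sum>e'\<in>E. (A z \<bullet> e) * ((B z \<bullet> e') * G (Q z) e e')"
  have "((\<lambda>z. G (Q z) e e') has_derivative (\<lambda>h. dG G (Q z) (Q' h) e e')) (at z)" for e e'
    by (rule has_derivative_compose[OF Q]) (rule has_derivative_dG[OF S])
  note * = this has_derivative_inner_left[OF A] has_derivative_inner_left[OF B]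
  have "(?F has_derivative (\<lambda>h. \<Sum>e\<in>E. \<Sum>e'\<in>E. (A z \<bullet> e) * ((B z \<bullet> e') * dG G (Q z) (Q' h) e e'
      + (B' h \<bullet> e') * G (Q z) e e') + (A' h \<bullet> e) * ((B z \<bullet> e') * G (Q z) e e'))) (at z)"
    by (intro has_derivative_sum has_derivative_mult *)
  also have "(\<lambda>h. \<Sum>e\<in>E. \<Sum>e'\<in>E. (A z \<bullet> e) * ((B z \<bullet> e') * dG G (Q z) (Q' h) e e'
      + (B' h \<bullet> e') * G (Q z) e e') + (A' h \<bullet> e) * ((B z \<bullet> e') * G (Q z) e e')) = ?D"
    by (subst dG_expand[OF S], subst (2 3) inner_form_expand[OF frame form[OF S]])
      (simp add: distrib_left sum.distrib add_ac)
  finally have F: "(?F has_derivative ?D) (at z)" .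
  have "isCont Q z" using Q has_derivative_continuous by blast
  then have "\<forall>\<^sub>F y in at z. Q y \<in> S"
    using open_S S unfolding isCont_def by (rule topological_tendstoD)
  then have "\<forall>\<^sub>F y in at z. ?F y = G (Q y) (A y) (B y)"
    by eventually_elim (simp add: inner_form_expand[OF frame form])
  then show ?thesis
    by (rule has_derivative_transform_eventually[OF F])
      (simp_all add: inner_form_expand[OF frame form[OF S], symmetric])
qed

lemma C1_on_metric:
  fixes Q A B :: "'z::real_normed_vector \<Rightarrow> 'e"
  assumes D: "open D" and Q: "C1_on D Q" "Q ` D \<subseteq> S" and A: "C1_on D A" and B: "C1_on D B"
  shows "C1_on D (\<lambda>z. G (Q z) (A z) (B z))"
proof (rule Ck_on_cong[OF D])
  show "C1_on D (\<lambda>z. \<Sum>e\<in>E. \<Sum>e'\<in>E. (A z \<bullet> e) * ((B z \<bullet> e') * G (Q z) e e'))"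
    by (intro C1_on_sum C1_on_mult C1_on_inner C1_on_const D A B
        C1_on_compose_real[OF frame D Q] smooth_on_C1 smooth)
  show "(\<Sum>e\<in>E. \<Sum>e'\<in>E. (A z \<bullet> e) * ((B z \<bullet> e') * G (Q z) e e')) = G (Q z) (A z) (B z)"
    if "z \<in> D" for z
  proof (rule inner_form_expand[OF frame form, symmetric])
    show "Q z \<in> S" using Q(2) that by blast
  qed
qed

end


section \<open>Waves over the flow, in local coordinates\<close>

text \<open>The vector field of the flow, with the coordinates \<open>x\<close> and \<open>y\<close> along \<open>e1\<close> and \<open>e2\<close>.\<close>

definition field_dir :: "'z::euclidean_space \<Rightarrow> 'z \<Rightarrow> 'z \<Rightarrow> 'z"
  where "field_dir e1 e2 z = sin (2 * pi * (z \<bullet> e1)) *\<^sub>R e1 + cos (2 * pi * (z \<bullet> e1)) *\<^sub>R e2"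

text \<open>A map from the flow to the phase space, lifted to the universal cover \<open>'z\<close> of the torus of the
  variables \<open>x\<close>, \<open>y\<close> (directions \<open>e1\<close>, \<open>e2\<close>) and the spatial variables (directions in \<open>K\<close>). For a chart
  \<open>c\<close> of the target, \<open>D c\<close> is the set of points that are mapped to it, \<open>Q c\<close> and \<open>P c\<close> are the
  components of position and momentum, and \<open>G c\<close> and \<open>W c\<close> are the metric and the potential.

  The assumption \<open>change\<close> lists the scalars that have to be independent of the chart. Assumption
  \<open>velocity\<close> says \<open>p = g(q) \<partial>\<^sub>t q\<close> and includes both closed orbits, where it fixes the sign of
  \<open>p(\<partial>\<^sub>y q)\<close>. Assumption \<open>force\<close> is the equation for the momentum with the Christoffel symbols written
  out; there the covariant derivatives of \<open>p\<close> and of \<open>\<partial>\<^sub>k q\<close> become derivatives of the metric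
  coefficients.\<close>

locale wave_cover =
  fixes e1 e2 :: "'z::euclidean_space" and K :: "'z set" and C :: "'c set"
    and E :: "'e::real_inner set" and D :: "'c \<Rightarrow> 'z set" and Q P :: "'c \<Rightarrow> 'z \<Rightarrow> 'e"
    and S :: "'c \<Rightarrow> 'e set" and G :: "'c \<Rightarrow> 'e \<Rightarrow> 'e \<Rightarrow> 'e \<Rightarrow> real" and W :: "'c \<Rightarrow> 'e \<Rightarrow> real"
  assumes e: "e1 \<in> Basis" "e2 \<in> Basis" "e1 \<noteq> e2" and K: "K \<subseteq> Basis - {e1}"
    and metric: "c \<in> C \<Longrightarrow> smooth_metric E (S c) (G c)"
    and potential: "c \<in> C \<Longrightarrow> smooth_on (S c) (W c)"
    and open_D: "c \<in> C \<Longrightarrow> open (D c)" and cover: "\<exists>c\<in>C. z \<in> D c"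
    and Q_in: "c \<in> C \<Longrightarrow> z \<in> D c \<Longrightarrow> Q c z \<in> S c"
    and smooth_Q: "c \<in> C \<Longrightarrow> smooth_on (D c) (Q c)"
    and smooth_P: "c \<in> C \<Longrightarrow> smooth_on (D c) (P c)"
    and periodic: "c \<in> C \<Longrightarrow> z \<in> D c \<Longrightarrow> k \<in> Basis \<Longrightarrow>
      z + k \<in> D c \<and> Q c (z + k) = Q c z \<and> P c (z + k) = P c z"
    and change: "c \<in> C \<Longrightarrow> c' \<in> C \<Longrightarrow> z \<in> D c \<Longrightarrow> z \<in> D c' \<Longrightarrow>
      P c z \<bullet> fderiv (Q c) z v = P c' z \<bullet> fderiv (Q c') z v \<and>
      G c (Q c z) (fderiv (Q c) z v) (fderiv (Q c) z u) = G c' (Q c' z) (fderiv (Q c') z v) (fderiv (Q c') z u) \<and>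
      W c (Q c z) = W c' (Q c' z)"
    and velocity: "c \<in> C \<Longrightarrow> z \<in> D c \<Longrightarrow> 0 \<le> z \<bullet> e1 \<Longrightarrow> z \<bullet> e1 \<le> 1/2 \<Longrightarrow>
      P c z \<bullet> w = G c (Q c z) (fderiv (Q c) z (field_dir e1 e2 z)) w"
    and force: "c \<in> C \<Longrightarrow> z \<in> D c \<Longrightarrow> 0 < z \<bullet> e1 \<Longrightarrow> z \<bullet> e1 < 1/2 \<Longrightarrow>
      fderiv (P c) z (field_dir e1 e2 z) \<bullet> w =
        1/2 * dG (G c) (Q c z) w (fderiv (Q c) z (field_dir e1 e2 z)) (fderiv (Q c) z (field_dir e1 e2 z))
        - fderiv (W c) (Q c z) w
        + (\<Sum>k\<in>K. G c (Q c z) (fderiv (\<lambda>z. fderiv (Q c) z k) z k) w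
            + dG (G c) (Q c z) (fderiv (Q c) z k) (fderiv (Q c) z k) w
            - 1/2 * dG (G c) (Q c z) w (fderiv (Q c) z k) (fderiv (Q c) z k))"
begin

definition chart_at :: "'z \<Rightarrow> 'c"
  where "chart_at z = (SOME c. c \<in> C \<and> z \<in> D c)"

lemma chart_at: "chart_at z \<in> C" "z \<in> D (chart_at z)"
  using someI_ex[of "\<lambda>c. c \<in> C \<and> z \<in> D c"] cover unfolding chart_at_def by blast+

text \<open>The function \<open>\<beta> = p(\<partial>\<^sub>y q)\<close>, the Noether density of translations in \<open>y\<close>.\<close>

definition density :: "'z \<Rightarrow> real"
  where "density z = P (chart_at z) z \<bullet> fderiv (Q (chart_at z)) z e2"

definition pairing :: "'z \<Rightarrow> 'z \<Rightarrow> 'z \<Rightarrow> real"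
  where "pairing z v w = G (chart_at z) (Q (chart_at z) z) (fderiv (Q (chart_at z)) z v) (fderiv (Q (chart_at z)) z w)"

definition lagrangian :: "'z \<Rightarrow> real"
  where "lagrangian z = 1/2 * pairing z (field_dir e1 e2 z) (field_dir e1 e2 z)
    - W (chart_at z) (Q (chart_at z) z) - 1/2 * (\<Sum>k\<in>K. pairing z k k)"

lemma density_eq: "c \<in> C \<Longrightarrow> z \<in> D c \<Longrightarrow> density z = P c z \<bullet> fderiv (Q c) z e2"
  unfolding density_def using change chart_at by blast

lemma pairing_eq:
  "c \<in> C \<Longrightarrow> z \<in> D c \<Longrightarrow> pairing z v w = G c (Q c z) (fderiv (Q c) z v) (fderiv (Q c) z w)"
  unfolding pairing_def using change chart_at by blast

lemma lagrangian_eq: "c \<in> C \<Longrightarrow> z \<in> D c \<Longrightarrow> lagrangian z =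
    1/2 * G c (Q c z) (fderiv (Q c) z (field_dir e1 e2 z)) (fderiv (Q c) z (field_dir e1 e2 z))
    - W c (Q c z) - 1/2 * (\<Sum>k\<in>K. G c (Q c z) (fderiv (Q c) z k) (fderiv (Q c) z k))"
  unfolding lagrangian_def using change[of c "chart_at z" z] chart_at[of z] by (simp add: pairing_eq)

lemma periodic_fderiv:
  assumes "c \<in> C" "z \<in> D c" "k \<in> Basis"
  shows "fderiv (Q c) (z + k) = fderiv (Q c) z"
proof -
  have zk: "z + k \<in> D c" using periodic assms by blast
  have "((\<lambda>z. Q c (z + k)) has_derivative fderiv (Q c) (z + k)) (at z)"
    by (rule has_derivative_compose[where f = "\<lambda>z. z + k" and f' = "\<lambda>v. v"])
      (use smooth_on_has_derivative[OF smooth_Q zk] assms in \<open>auto intro!: derivative_eq_intros\<close>)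
  moreover have "fderiv (\<lambda>z. Q c (z + k)) z = fderiv (Q c) z"
    by (rule fderiv_cong[OF open_D[OF assms(1)] assms(2)]) (use periodic assms in blast)
  ultimately show ?thesis using fderiv_eq by metis
qed

lemma density_periodic: "k \<in> Basis \<Longrightarrow> density (z + k) = density z"
  using density_eq[OF chart_at(1), of _ z] density_eq[OF chart_at(1), of "z + k" z] periodic[OF chart_at, of k z]
    periodic_fderiv[OF chart_at, of k z] chart_at by simp

lemma pairing_periodic: "k \<in> Basis \<Longrightarrow> pairing (z + k) v w = pairing z v w"
  using pairing_eq[OF chart_at(1), of _ z] pairing_eq[OF chart_at(1), of "z + k" z] periodic[OF chart_at, of k z]
    periodic_fderiv[OF chart_at, of k z] chart_at by simp

lemma lagrangian_periodic: "lagrangian (z + e2) = lagrangian z"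
proof -
  have "field_dir e1 e2 (z + e2) = field_dir e1 e2 z"
    using e by (simp add: field_dir_def inner_add_left inner_not_same_Basis)
  then show ?thesis
    using lagrangian_eq[OF chart_at(1), of _ z] lagrangian_eq[OF chart_at(1), of "z + e2" z]
      periodic[OF chart_at e(2), of z] periodic_fderiv[OF chart_at e(2), of z] chart_at by simp
qed

lemma C1_fderiv_Q: "c \<in> C \<Longrightarrow> C1_on (D c) (\<lambda>z. fderiv (Q c) z v)"
  by (intro smooth_on_C1 smooth_on_fderiv smooth_Q)

lemma fderiv_Q_field_dir:
  assumes "c \<in> C" "z \<in> D c"
  shows "fderiv (Q c) z (field_dir e1 e2 z)
    = sin (2 * pi * (z \<bullet> e1)) *\<^sub>R fderiv (Q c) z e1 + cos (2 * pi * (z \<bullet> e1)) *\<^sub>R fderiv (Q c) z e2"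
  using has_derivative_linear[OF smooth_on_has_derivative[OF smooth_Q assms(2)]] assms(1)
  by (simp add: field_dir_def linear_add linear_scale)

lemma C1_velocity:
  assumes c: "c \<in> C"
  shows "C1_on (D c) (\<lambda>z. fderiv (Q c) z (field_dir e1 e2 z))"
proof (rule Ck_on_cong[OF open_D[OF c]])
  show "C1_on (D c) (\<lambda>z. sin (2 * pi * (z \<bullet> e1)) *\<^sub>R fderiv (Q c) z e1
      + cos (2 * pi * (z \<bullet> e1)) *\<^sub>R fderiv (Q c) z e2)"
    by (intro C1_on_add C1_on_scaleR open_D c C1_fderiv_Q Ck_on_subset[OF C1_on_trig(1)]
        Ck_on_subset[OF C1_on_trig(2)] subset_UNIV)
qed (simp add: fderiv_Q_field_dir[OF c])

lemma C1_global:
  assumes "\<And>c. c \<in> C \<Longrightarrow> C1_on (D c) f"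
  shows "C1_on UNIV f"
  by (rule Ck_on_local) (use chart_at open_D assms in blast)

lemma C1_metric:
  assumes c: "c \<in> C" and "C1_on (D c) A" "C1_on (D c) B"
  shows "C1_on (D c) (\<lambda>z. G c (Q c z) (A z) (B z))"
  by (rule smooth_metric.C1_on_metric[OF metric[OF c] open_D[OF c] smooth_on_C1[OF smooth_Q[OF c]] _ assms(2,3)])
    (use Q_in c in blast)

lemma C1_density: "C1_on UNIV density"
proof (rule C1_global)
  fix c assume c: "c \<in> C"
  show "C1_on (D c) density"
    by (rule Ck_on_cong[OF open_D[OF c] density_eq[OF c, symmetric]], assumption)
      (intro C1_on_inner open_D c C1_fderiv_Q smooth_on_C1 smooth_P)
qed

lemma C1_pairing: "C1_on UNIV (\<lambda>z. pairing z v w)"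
proof (rule C1_global)
  fix c assume c: "c \<in> C"
  show "C1_on (D c) (\<lambda>z. pairing z v w)"
    by (rule Ck_on_cong[OF open_D[OF c] pairing_eq[OF c, symmetric]], assumption)
      (intro C1_metric c C1_fderiv_Q)
qed

lemma C1_lagrangian: "C1_on UNIV lagrangian"
proof (rule C1_global)
  fix c assume c: "c \<in> C"
  have frame: "parseval_frame E" using metric[OF c] smooth_metric.frame by blast
  have "C1_on (D c) (\<lambda>z. W c (Q c z))"
    by (rule C1_on_compose_real[OF frame open_D[OF c] smooth_on_C1[OF smooth_Q[OF c]] _
          smooth_on_C1[OF potential[OF c]]]) (use Q_in c in blast)
  then have "C1_on (D c) (\<lambda>z. 1/2 * G c (Q c z) (fderiv (Q c) z (field_dir e1 e2 z)) (fderiv (Q c) z (field_dir e1 e2 z))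
    + (-1) * W c (Q c z) + (-1/2) * (\<Sum>k\<in>K. G c (Q c z) (fderiv (Q c) z k) (fderiv (Q c) z k)))"
    by (intro C1_on_add C1_on_mult C1_on_const C1_on_sum C1_metric C1_velocity C1_fderiv_Q open_D c)
  then show "C1_on (D c) lagrangian"
    by (rule Ck_on_cong[OF open_D[OF c], rotated]) (simp add: lagrangian_eq[OF c])
qed

text \<open>Noether's identity for translations in \<open>y\<close>. The flow direction has coefficients depending on \<open>x\<close>
  only, so it commutes with \<open>\<partial>\<^sub>y\<close>, and \<open>P \<bullet> \<partial>\<^sub>y (\<partial>\<^sub>t q)\<close> is the \<open>\<partial>\<^sub>y\<close>-derivative of the kinetic energy up to
  a derivative of the metric. That derivative and those of the spatial terms cancel against the
  force.\<close>

lemma balance_law: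
  assumes x: "0 < z \<bullet> e1" "z \<bullet> e1 < 1/2"
  shows "sin (2 * pi * (z \<bullet> e1)) * fderiv density z e1 + cos (2 * pi * (z \<bullet> e1)) * fderiv density z e2
    = fderiv lagrangian z e2 + (\<Sum>k\<in>K. fderiv (\<lambda>z. pairing z k e2) z k)"
proof -
  obtain c where c: "c \<in> C" and z: "z \<in> D c" using cover by blast
  interpret smooth_metric E "S c" "G c" by (rule metric[OF c])
  note oD = open_D[OF c]
  define Y where "Y = field_dir e1 e2 z"
  define T where "T = (\<lambda>z. fderiv (Q c) z (field_dir e1 e2 z))"
  define q where "q v = fderiv (Q c) z v" for v
  define qq where "qq v w = fderiv (\<lambda>z. fderiv (Q c) z v) z w" for v w
  define R where "R = sin (2 * pi * (z \<bullet> e1)) *\<^sub>R qq e1 e2 + cos (2 * pi * (z \<bullet> e1)) *\<^sub>R qq e2 e2"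
  let ?q = "Q c z"
  have Sz: "?q \<in> S c" by (rule Q_in[OF c z])
  have qq_sym: "qq v w = qq w v" for v w
    unfolding qq_def by (rule fderiv_commute[OF oD z smooth_Q[OF c]])
  have dQ: "(Q c has_derivative q) (at z)"
    unfolding q_def using smooth_on_has_derivative[OF smooth_Q[OF c] z] by simp
  have dq: "((\<lambda>z. fderiv (Q c) z v) has_derivative qq v) (at z)" for v
    unfolding qq_def using smooth_on_has_derivative[OF smooth_on_fderiv[OF smooth_Q[OF c]] z] by simp
  have qY: "qq v Y = sin (2 * pi * (z \<bullet> e1)) *\<^sub>R qq v e1 + cos (2 * pi * (z \<bullet> e1)) *\<^sub>R qq v e2" for v
    using has_derivative_linear[OF dq] by (simp add: Y_def field_dir_def linear_add linear_scale)
  have Tz: "T z = q Y" by (simp add: T_def q_def Y_def)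
  have lhs: "sin (2 * pi * (z \<bullet> e1)) * fderiv density z e1 + cos (2 * pi * (z \<bullet> e1)) * fderiv density z e2
      = fderiv (P c) z Y \<bullet> q e2 + P c z \<bullet> R"
  proof -
    have "((\<lambda>z. P c z \<bullet> fderiv (Q c) z e2) has_derivative
        (\<lambda>h. P c z \<bullet> qq e2 h + fderiv (P c) z h \<bullet> fderiv (Q c) z e2)) (at z)"
      by (intro has_derivative_inner dq smooth_on_has_derivative[OF smooth_P[OF c] z])
    then have d: "(density has_derivative (\<lambda>h. P c z \<bullet> qq e2 h + fderiv (P c) z h \<bullet> q e2)) (at z)"
      unfolding q_def
      by (rule has_derivative_transform_within_open[OF _ oD z]) (simp add: density_eq[OF c])
    have lin: "linear (fderiv density z)"
      using has_derivative_linear[OF d] fderiv_eq[OF d] by simp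
    have "sin (2 * pi * (z \<bullet> e1)) * fderiv density z e1 + cos (2 * pi * (z \<bullet> e1)) * fderiv density z e2
        = fderiv density z Y"
      by (simp add: Y_def field_dir_def linear_add[OF lin] linear_scale[OF lin])
    also have "\<dots> = fderiv (P c) z Y \<bullet> q e2 + P c z \<bullet> qq e2 Y"
      unfolding fderiv_eq[OF d] by simp
    also have "qq e2 Y = R" unfolding qY R_def by (simp add: qq_sym[of e2 e1])
    finally show ?thesis .
  qed
  \<comment> \<open>the coefficients of the flow direction do not depend on \<open>y\<close>, so \<open>\<partial>\<^sub>y\<close> of the velocity is \<open>R\<close>\<close>
  have dT: "\<exists>T'. (T has_derivative T') (at z) \<and> T' e2 = R"
  proof -
    let ?s = "2 * pi * (z \<bullet> e1)"
    let ?T' = "\<lambda>h. (sin ?s *\<^sub>R qq e1 h + (cos ?s * (2 * pi * (h \<bullet> e1))) *\<^sub>R fderiv (Q c) z e1)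
       + (cos ?s *\<^sub>R qq e2 h + (- sin ?s * (2 * pi * (h \<bullet> e1))) *\<^sub>R fderiv (Q c) z e2)"
    have "((\<lambda>z. sin (2 * pi * (z \<bullet> e1)) *\<^sub>R fderiv (Q c) z e1 + cos (2 * pi * (z \<bullet> e1)) *\<^sub>R fderiv (Q c) z e2)
      has_derivative ?T') (at z)"
      by (intro has_derivative_add has_derivative_scaleR dq) (auto intro!: derivative_eq_intros)
    then have "(T has_derivative ?T') (at z)"
      by (rule has_derivative_transform_within_open[OF _ oD z]) (simp add: T_def fderiv_Q_field_dir[OF c])
    then show ?thesis
      by (intro exI conjI) (assumption, use e in \<open>simp add: R_def inner_not_same_Basis\<close>)
  qed
  then obtain T' where T': "(T has_derivative T') (at z)" "T' e2 = R" by blast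
  have rhs1: "fderiv lagrangian z e2 = 1/2 * dG (G c) ?q (q e2) (q Y) (q Y) + G c ?q (q Y) R
      - fderiv (W c) ?q (q e2)
      - (\<Sum>k\<in>K. 1/2 * dG (G c) ?q (q e2) (q k) (q k) + G c ?q (q k) (qq k e2))"
  proof -
    have W: "((\<lambda>z. W c (Q c z)) has_derivative (\<lambda>h. fderiv (W c) ?q (q h))) (at z)"
      by (rule has_derivative_compose[OF dQ]) (rule smooth_on_has_derivative[OF potential[OF c] Sz])
    let ?l' = "\<lambda>h. 1/2 * (dG (G c) ?q (q h) (T z) (T z) + G c ?q (T' h) (T z) + G c ?q (T z) (T' h))
        - fderiv (W c) ?q (q h)
        - 1/2 * (\<Sum>k\<in>K. dG (G c) ?q (q h) (fderiv (Q c) z k) (fderiv (Q c) z k)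
          + G c ?q (qq k h) (fderiv (Q c) z k) + G c ?q (fderiv (Q c) z k) (qq k h))"
    have "((\<lambda>z. 1/2 * G c (Q c z) (T z) (T z) - W c (Q c z)
        - 1/2 * (\<Sum>k\<in>K. G c (Q c z) (fderiv (Q c) z k) (fderiv (Q c) z k))) has_derivative ?l') (at z)"
      by (intro has_derivative_diff has_derivative_mult_right has_derivative_sum W
          has_derivative_metric dQ dq T' Sz)
    then have "(lagrangian has_derivative ?l') (at z)"
      by (rule has_derivative_transform_within_open[OF _ oD z]) (simp add: lagrangian_eq[OF c] T_def)
    from fderiv_eq[OF this] have "fderiv lagrangian z e2 =
       1/2 * (dG (G c) ?q (q e2) (q Y) (q Y) + G c ?q R (q Y) + G c ?q (q Y) R)
        - fderiv (W c) ?q (q e2)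
        - 1/2 * (\<Sum>k\<in>K. dG (G c) ?q (q e2) (q k) (q k) + G c ?q (qq k e2) (q k) + G c ?q (q k) (qq k e2))"
      by (simp add: T'(2) Tz flip: q_def)
    then show ?thesis
      by (simp add: inner_form_sym[OF form[OF Sz], of R "q Y"] inner_form_sym[OF form[OF Sz], of "qq _ e2" "q _"]
          sum_distrib_left distrib_left sum.distrib)
  qed
  have rhs2: "fderiv (\<lambda>z. pairing z k e2) z k
      = dG (G c) ?q (q k) (q k) (q e2) + G c ?q (qq k k) (q e2) + G c ?q (q k) (qq k e2)" for k
  proof -
    let ?f' = "\<lambda>h. dG (G c) ?q (q h) (fderiv (Q c) z k) (fderiv (Q c) z e2)
        + G c ?q (qq k h) (fderiv (Q c) z e2) + G c ?q (fderiv (Q c) z k) (qq e2 h)"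
    have "((\<lambda>z. G c (Q c z) (fderiv (Q c) z k) (fderiv (Q c) z e2)) has_derivative ?f') (at z)"
      by (intro has_derivative_metric dQ dq Sz)
    then have "((\<lambda>z. pairing z k e2) has_derivative ?f') (at z)"
      by (rule has_derivative_transform_within_open[OF _ oD z]) (simp add: pairing_eq[OF c])
    from fderiv_eq[OF this] show ?thesis
      by (simp add: qq_sym[of e2 k] flip: q_def)
  qed
  have "P c z \<bullet> R = G c ?q (q Y) R"
    using velocity[OF c z] x by (simp add: q_def Y_def)
  moreover have "fderiv (P c) z Y \<bullet> q e2 = 1/2 * dG (G c) ?q (q e2) (q Y) (q Y) - fderiv (W c) ?q (q e2)
      + (\<Sum>k\<in>K. G c ?q (qq k k) (q e2) + dG (G c) ?q (q k) (q k) (q e2) - 1/2 * dG (G c) ?q (q e2) (q k) (q k))"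
    using force[OF c z x, of "q e2"] by (simp add: q_def qq_def Y_def)
  ultimately show ?thesis
    unfolding lhs rhs1 rhs2 by (simp add: sum.distrib sum_subtractf)
qed

text \<open>On the two closed orbits \<open>\<partial>\<^sub>t q = \<plusminus>\<partial>\<^sub>y q\<close>, hence the density is \<open>\<plusminus>|\<partial>\<^sub>y q|\<^sup>2\<close>, and
  \<open>conserved_density_vanishes\<close> applies. The derivative of the momentum vanishes because
  the momentum is zero along the whole orbit.\<close>

theorem stationary_on_orbit:
  assumes c: "c \<in> C" and z: "z \<in> D c" and x: "z \<bullet> e1 = 0"
  shows "fderiv (Q c) z e2 = 0" "P c z = 0" "fderiv (P c) z e2 = 0"
proof -
  have speed: "density y = cos (2 * pi * (y \<bullet> e1)) * G c (Q c y) (fderiv (Q c) y e2) (fderiv (Q c) y e2)"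
    if "c \<in> C" "y \<in> D c" "0 \<le> y \<bullet> e1" "y \<bullet> e1 \<le> 1/2" "sin (2 * pi * (y \<bullet> e1)) = 0" for c y
  proof -
    interpret smooth_metric E "S c" "G c" by (rule metric[OF that(1)])
    have "density y = G c (Q c y) (fderiv (Q c) y (field_dir e1 e2 y)) (fderiv (Q c) y e2)"
      using that velocity by (simp add: density_eq)
    also have "fderiv (Q c) y (field_dir e1 e2 y) = cos (2 * pi * (y \<bullet> e1)) *\<^sub>R fderiv (Q c) y e2"
      using that by (simp add: fderiv_Q_field_dir)
    finally show ?thesis
      using linear_scale[OF inner_form_linear_left[OF form[OF Q_in]]] that by simp
  qed
  have G_nonneg: "0 \<le> G c (Q c y) u u" if "c \<in> C" "y \<in> D c" for c y u
    by (rule inner_form_nonneg[OF smooth_metric.form[OF metric[OF that(1)] Q_in[OF that]]])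
  have zero: "density y = 0" if "y \<bullet> e1 = 0" for y
  proof (rule conserved_density_vanishes[OF e K C1_density density_periodic[OF e(2)]
        C1_lagrangian lagrangian_periodic C1_pairing pairing_periodic balance_law _ _ that])
    show "0 \<le> density y" if "y \<bullet> e1 = 0" for y
      using speed[OF chart_at, of y] that G_nonneg[OF chart_at] by simp
    show "density y \<le> 0" if "y \<bullet> e1 = 1/2" for y
      using speed[OF chart_at, of y] that G_nonneg[OF chart_at] by simp
  qed (use K in auto)
  have *: "fderiv (Q c) y e2 = 0 \<and> P c y = 0" if "y \<in> D c" "y \<bullet> e1 = 0" for y
  proof -
    interpret smooth_metric E "S c" "G c" by (rule metric[OF c])
    have "G c (Q c y) (fderiv (Q c) y e2) (fderiv (Q c) y e2) = 0"
      using speed[OF c that(1)] zero that by simp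
    then have q: "fderiv (Q c) y e2 = 0"
      using inner_form_eq_0[OF form[OF Q_in[OF c that(1)]]] by simp
    then have "P c y \<bullet> P c y = 0"
      using velocity[OF c that(1), of "P c y"] that fderiv_Q_field_dir[OF c that(1)]
      by (simp add: inner_form_zero[OF form[OF Q_in[OF c that(1)]]])
    then show ?thesis using q by simp
  qed
  then show "fderiv (Q c) z e2 = 0" "P c z = 0" using z x by auto
  show "fderiv (P c) z e2 = 0"
  proof -
    have line: "((\<lambda>r. z + r *\<^sub>R e2) has_derivative (\<lambda>r. r *\<^sub>R e2)) (at 0)"
      by (auto intro!: derivative_eq_intros)
    have "((\<lambda>r. P c (z + r *\<^sub>R e2)) has_derivative (\<lambda>r. fderiv (P c) z (r *\<^sub>R e2))) (at 0)"
      by (rule has_derivative_compose[OF line])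
        (use smooth_on_has_derivative[OF smooth_P[OF c] z] in simp)
    moreover have "open ((\<lambda>r. z + r *\<^sub>R e2) -` D c)"
      by (intro open_vimage open_D c continuous_intros)
    then have "((\<lambda>r. P c (z + r *\<^sub>R e2)) has_derivative (\<lambda>r. 0)) (at 0)"
      by (rule has_derivative_transform_within_open[OF has_derivative_const])
        (use z x * e in \<open>auto simp: inner_add_left inner_not_same_Basis\<close>)
    ultimately have "(\<lambda>r. fderiv (P c) z (r *\<^sub>R e2)) = (\<lambda>r. 0)"
      by (rule has_derivative_unique)
    from fun_cong[OF this, of 1] show ?thesis by simp
  qed
qed

end


section \<open>The torus and its covering by Euclidean space\<close>

lemma torus_proj_eq_iff: "torus_proj x = torus_proj y \<longleftrightarrow> (\<forall>i. x $ i - y $ i \<in> \<int>)"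
  by (simp add: torus_proj_def vec_eq_iff circle.abs_eq_iff)

lemma torus_proj_surj: "\<exists>x. torus_proj x = z"
proof -
  have "\<exists>r. abs_circle r = z $ i" for i
    using circle.abs_induct[of "\<lambda>u. \<exists>r. abs_circle r = u" "z $ i"] by blast
  then obtain r where "\<And>i. abs_circle (r i) = z $ i" by metis
  then have "torus_proj (\<chi> i. r i) = z" by (simp add: torus_proj_def vec_eq_iff)
  then show ?thesis by blast
qed

lemma mem_unit_box: "x \<in> box a (a + 1) \<longleftrightarrow> (\<forall>i. a $ i < x $ i \<and> x $ i < a $ i + 1)"
  for x a :: "real ^ 'd"
  by (simp add: mem_box_cart)

lemma torus_proj_inj_box: "inj_on torus_proj (box a (a + 1))" for a :: "real ^ 'd"
proof (rule inj_onI)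
  fix x y :: "real ^ 'd"
  assume "x \<in> box a (a + 1)" "y \<in> box a (a + 1)" "torus_proj x = torus_proj y"
  then have *: "x $ i - y $ i \<in> \<int>" "\<bar>x $ i - y $ i\<bar> < 1" for i
    by (auto simp: torus_proj_eq_iff mem_unit_box abs_less_iff) (smt (verit, best))+
  have "x $ i - y $ i = 0" for i
    using Ints_nonzero_abs_less1[OF *] .
  then show "x = y" by (simp add: vec_eq_iff)
qed

lemma mem_centered_box: "x \<in> box (x - vec (1/2)) (x - vec (1/2) + 1)" for x :: "real ^ 'd"
  by (simp add: mem_unit_box)

lemma torus_chart_coord: "x \<in> box a (a + 1) \<Longrightarrow> snd (torus_chart a) (torus_proj x) = x"
  unfolding torus_chart_def snd_conv by (rule inv_into_f_f[OF torus_proj_inj_box])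

lemma torus_chart_image: "snd (torus_chart a) ` fst (torus_chart a) = box a (a + 1)"
proof -
  have "snd (torus_chart a) ` torus_proj ` box a (a + 1) = box a (a + 1)"
    unfolding image_image by (simp add: torus_chart_coord cong: image_cong)
  then show ?thesis by (simp add: torus_chart_def)
qed

lemma torus_chart_inj: "inj_on (snd (torus_chart a)) (fst (torus_chart a))"
  unfolding torus_chart_def by (simp add: inj_on_inv_into)

lemma torus_chart_inv: "x \<in> box a (a + 1) \<Longrightarrow> chart_inv (torus_chart a) x = torus_proj x"
  unfolding chart_inv_def
  by (rule inv_into_f_eq[OF torus_chart_inj]) (simp add: torus_chart_def, simp add: torus_chart_coord)

lemma torus_chart_domain: "torus_proj x \<in> fst (torus_chart a) \<longleftrightarrow> (\<exists>y\<in>box a (a + 1). torus_proj x = torus_proj y)"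
  by (auto simp: torus_chart_def)

lemma torus_chart_domainI: "x \<in> box a (a + 1) \<Longrightarrow> torus_proj x \<in> fst (torus_chart a)"
  by (auto simp: torus_chart_def)

lemma torus_chart_domainE:
  assumes "z \<in> fst (torus_chart a)"
  obtains x where "x \<in> box a (a + 1)" "z = torus_proj x"
  using assms by (auto simp: torus_chart_def)

text \<open>In every chart the coordinates differ from those of the cover by an integer vector, which is
  locally constant. Hence transition maps are locally translations, and the flow looks the same in
  all charts.\<close>

lemma torus_chart_local_shift:
  assumes "torus_proj x \<in> fst (torus_chart b)"
  obtains U n where "open U" "x \<in> U" "\<And>i. n $ i \<in> \<int>"
    "\<And>y. y \<in> U \<Longrightarrow> torus_proj y \<in> fst (torus_chart b) \<and> snd (torus_chart b) (torus_proj y) = y + n"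
proof -
  obtain x' where x': "x' \<in> box b (b + 1)" "torus_proj x = torus_proj x'"
    using assms torus_chart_domain by blast
  define n where "n = x' - x"
  \<comment> \<open>here the branch of the inverse of the covering map is the translation by \<open>n\<close>\<close>
  define U where "U = (\<lambda>y. y + n) -` box b (b + 1)"
  have n: "n $ i \<in> \<int>" for i
    using x'(2)[symmetric] by (simp add: n_def torus_proj_eq_iff)
  show ?thesis
  proof (rule that[of U n])
    show "open U" unfolding U_def by (intro open_vimage open_box continuous_intros)
    show "x \<in> U" using x' by (simp add: U_def n_def)
    fix y assume "y \<in> U"
    then have y: "y + n \<in> box b (b + 1)" by (simp add: U_def)
    have "torus_proj y = torus_proj (y + n)" using n by (simp add: torus_proj_eq_iff)
    then show "torus_proj y \<in> fst (torus_chart b) \<and> snd (torus_chart b) (torus_proj y) = y + n"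
      using y torus_chart_coord torus_chart_domainI by metis
  qed (rule n)
qed

lemma torus_points: "points torus_atlas = UNIV"
proof -
  have "z \<in> points torus_atlas" for z :: "circle ^ 'd"
  proof -
    obtain x where "z = torus_proj x" using torus_proj_surj by metis
    then show ?thesis
      using torus_chart_domainI[OF mem_centered_box[of x]] by (auto simp: points_def torus_atlas_def)
  qed
  then show ?thesis by auto
qed

lemma torus_transition:
  assumes "x \<in> box a (a + 1)" "torus_proj x \<in> fst (torus_chart b)"
  obtains U n where "open U" "x \<in> U" "\<And>y. y \<in> U \<Longrightarrow> transition (torus_chart a) (torus_chart b) y = y + n"
proof -
  obtain U n where U: "open U" "x \<in> U"
    "\<And>y. y \<in> U \<Longrightarrow> torus_proj y \<in> fst (torus_chart b) \<and> snd (torus_chart b) (torus_proj y) = y + n"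
    using torus_chart_local_shift[OF assms(2)] by metis
  show ?thesis
    by (rule that[of "U \<inter> box a (a + 1)" n])
      (use U assms open_box in \<open>auto simp: transition_def local_rep_def torus_chart_inv\<close>)
qed

lemma fderiv_torus_transition:
  assumes "x \<in> box a (a + 1)" "torus_proj x \<in> fst (torus_chart b)"
  shows "fderiv (transition (torus_chart a) (torus_chart b)) x = (\<lambda>v. v)"
proof -
  obtain U n where U: "open U" "x \<in> U" "\<And>y. y \<in> U \<Longrightarrow> transition (torus_chart a) (torus_chart b) y = y + n"
    using torus_transition[OF assms] by metis
  have "fderiv (transition (torus_chart a) (torus_chart b)) x = fderiv (\<lambda>y. y + n) x"
    by (rule fderiv_cong[OF U(1,2)]) (rule U(3))
  also have "\<dots> = (\<lambda>v. v)"
    by (rule fderiv_eq) (auto intro!: derivative_eq_intros)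
  finally show ?thesis .
qed

lemma openin_atlas_topology:
  assumes "\<And>c. c \<in> A \<Longrightarrow> inj_on (snd c) (fst c)"
  shows "openin (atlas_topology A) W \<longleftrightarrow> W \<subseteq> points A \<and> (\<forall>c\<in>A. open (snd c ` (W \<inter> fst c)))"
proof -
  have "istopology (\<lambda>W. W \<subseteq> points A \<and> (\<forall>c\<in>A. open (snd c ` (W \<inter> fst c))))"
    unfolding istopology_def
  proof (intro conjI allI impI ballI)
    fix S T c assume *: "S \<subseteq> points A \<and> (\<forall>c\<in>A. open (snd c ` (S \<inter> fst c)))"
      "T \<subseteq> points A \<and> (\<forall>c\<in>A. open (snd c ` (T \<inter> fst c)))"
    show "S \<inter> T \<subseteq> points A" using * by blast
    assume c: "c \<in> A"
    have "snd c ` (S \<inter> T \<inter> fst c) = snd c ` (S \<inter> fst c) \<inter> snd c ` (T \<inter> fst c)"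
      using inj_on_image_Int[OF assms[OF c], of "S \<inter> fst c" "T \<inter> fst c"]
      by (simp add: Int_ac)
    then show "open (snd c ` (S \<inter> T \<inter> fst c))" using * c by auto
  next
    fix \<K> assume *: "\<forall>S\<in>\<K>. S \<subseteq> points A \<and> (\<forall>c\<in>A. open (snd c ` (S \<inter> fst c)))"
    show "\<Union> \<K> \<subseteq> points A" using * by blast
    fix c assume c: "c \<in> A"
    have "snd c ` (\<Union> \<K> \<inter> fst c) = (\<Union>S\<in>\<K>. snd c ` (S \<inter> fst c))" by blast
    then show "open (snd c ` (\<Union> \<K> \<inter> fst c))" using * c by auto
  qed
  then show ?thesis unfolding atlas_topology_def by (simp add: topology_inverse')
qed

text \<open>The atlas induces the quotient topology of the covering map.\<close>

lemma openin_torus: "openin (atlas_topology torus_atlas) W \<longleftrightarrow> open (torus_proj -` W)"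
  for W :: "(circle ^ 'd) set"
proof -
  have img: "snd (torus_chart a) ` (W \<inter> fst (torus_chart a)) = box a (a + 1) \<inter> torus_proj -` W"
    for a :: "real ^ 'd"
    by (auto simp: torus_chart_coord elim!: torus_chart_domainE intro!: image_eqI torus_chart_domainI)
  have "openin (atlas_topology torus_atlas) W \<longleftrightarrow> (\<forall>a :: real ^ 'd. open (box a (a + 1) \<inter> torus_proj -` W))"
    by (subst openin_atlas_topology)
      (auto simp: torus_atlas_def torus_chart_inj img torus_points[unfolded torus_atlas_def])
  also have "\<dots> \<longleftrightarrow> open (torus_proj -` W)"
  proof
    assume "\<forall>a :: real ^ 'd. open (box a (a + 1) \<inter> torus_proj -` W)"
    then have "open (\<Union>a :: real ^ 'd. box a (a + 1) \<inter> torus_proj -` W)" by blast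
    moreover have "(\<Union>a. box a (a + 1) \<inter> torus_proj -` W) = torus_proj -` W"
      using mem_centered_box by blast
    ultimately show "open (torus_proj -` W)" by simp
  qed (auto intro: open_Int open_box)
  finally show ?thesis .
qed

lemma topspace_torus: "topspace (atlas_topology torus_atlas) = (UNIV :: (circle ^ 'd) set)"
  using openin_torus[of UNIV] openin_subset[of "atlas_topology torus_atlas" UNIV] by auto

lemma continuous_map_torus_proj: "continuous_map euclidean (atlas_topology torus_atlas) torus_proj"
  by (auto simp: continuous_map_def topspace_torus openin_torus vimage_def)

lemma open_map_torus_proj:
  "open_map euclidean (atlas_topology torus_atlas) (torus_proj :: real ^ 'd \<Rightarrow> _)"
  unfolding open_map_def openin_torus
proof (intro allI impI)
  fix U :: "(real ^ 'd) set" assume "openin euclidean U"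
  then have U: "open U" by simp
  have "torus_proj -` torus_proj ` U = (\<Union>n\<in>{n. \<forall>i. n $ i \<in> \<int>}. (\<lambda>x. x + n) -` U)"
  proof (intro set_eqI iffI)
    fix x assume "x \<in> torus_proj -` torus_proj ` U"
    then obtain u where u: "u \<in> U" "torus_proj u = torus_proj x" by auto
    then have "u - x \<in> {n. \<forall>i. n $ i \<in> \<int>}" "x + (u - x) \<in> U" by (auto simp: torus_proj_eq_iff)
    then show "x \<in> (\<Union>n\<in>{n. \<forall>i. n $ i \<in> \<int>}. (\<lambda>x. x + n) -` U)" by blast
  next
    fix x assume "x \<in> (\<Union>n\<in>{n. \<forall>i. n $ i \<in> \<int>}. (\<lambda>x. x + n) -` U)"
    then obtain n where n: "\<forall>i. n $ i \<in> \<int>" "x + n \<in> U" by auto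
    then have "torus_proj x = torus_proj (x + n)" by (auto simp: torus_proj_eq_iff)
    then show "x \<in> torus_proj -` torus_proj ` U" using n by auto
  qed
  then show "open (torus_proj -` torus_proj ` U)"
    using U by (auto intro!: open_UN open_vimage continuous_intros)
qed

text \<open>Sine and cosine separate the points of the circle; this makes the torus a Hausdorff space.\<close>

lemma sin_cos_2pi_eq_iff:
  "sin (2 * pi * x) = sin (2 * pi * y) \<and> cos (2 * pi * x) = cos (2 * pi * y) \<longleftrightarrow> x - y \<in> \<int>"
proof -
  have "2 * pi * x = 2 * pi * y + 2 * pi * of_int n \<longleftrightarrow> x - y = of_int n" for n
  proof -
    have "2 * pi * x = 2 * pi * y + 2 * pi * of_int n \<longleftrightarrow> 2 * pi * x = 2 * pi * (y + of_int n)"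
      by (simp add: distrib_left)
    also have "\<dots> \<longleftrightarrow> x = y + of_int n" by simp
    finally show ?thesis by auto
  qed
  then show ?thesis unfolding sin_cos_eq_iff by (auto simp: Ints_def)
qed

lift_definition circle_sin :: "circle \<Rightarrow> real" is "\<lambda>x. sin (2 * pi * x)"
  using sin_cos_2pi_eq_iff by blast

lift_definition circle_cos :: "circle \<Rightarrow> real" is "\<lambda>x. cos (2 * pi * x)"
  using sin_cos_2pi_eq_iff by blast

lemma Hausdorff_torus: "Hausdorff_space (atlas_topology (torus_atlas :: (circle ^ 'd, real ^ 'd) chart set))"
proof (rule Hausdorff_space_injective_preimage)
  define f :: "circle ^ 'd \<Rightarrow> (real ^ 'd) \<times> (real ^ 'd)"
    where "f z = ((\<chi> i. circle_sin (z $ i)), (\<chi> i. circle_cos (z $ i)))" for z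
  have f: "f (torus_proj x) = ((\<chi> i. sin (2 * pi * x $ i)), (\<chi> i. cos (2 * pi * x $ i)))" for x
    by (simp add: f_def torus_proj_def circle_sin.abs_eq circle_cos.abs_eq)
  show "Hausdorff_space (euclidean :: ((real ^ 'd) \<times> (real ^ 'd)) topology)" by simp
  show "inj_on f (topspace (atlas_topology torus_atlas))"
  proof (rule inj_onI)
    fix z w assume fzw: "f z = f w"
    obtain x y where xy: "z = torus_proj x" "w = torus_proj y" using torus_proj_surj by metis
    have "sin (2 * pi * x $ i) = sin (2 * pi * y $ i) \<and> cos (2 * pi * x $ i) = cos (2 * pi * y $ i)" for i
      using fzw by (simp add: xy f vec_eq_iff)
    then show "z = w" using sin_cos_2pi_eq_iff by (auto simp: xy torus_proj_eq_iff)
  qed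
  have "continuous_on UNIV (f \<circ> torus_proj)"
    unfolding o_def f by (intro continuous_intros)
  then have "open (torus_proj -` (f -` U))" if "open U" for U
    using open_vimage[OF that, of "f \<circ> torus_proj"] by (simp add: vimage_comp)
  then show "continuous_map (atlas_topology torus_atlas) euclidean f"
    by (auto simp: continuous_map_def topspace_torus openin_torus vimage_def)
qed

lemma second_countable_torus: "second_countable (atlas_topology (torus_atlas :: (circle ^ 'd, real ^ 'd) chart set))"
proof (rule second_countable_open_map_image[OF continuous_map_torus_proj open_map_torus_proj])
  show "torus_proj ` topspace euclidean = topspace (atlas_topology (torus_atlas :: (circle ^ 'd, real ^ 'd) chart set))"
    unfolding topspace_torus topspace_euclidean
    by (rule surj_def[THEN iffD2]) (metis torus_proj_surj)
  obtain B :: "(real ^ 'd) set set" where B: "countable B" "topological_basis B"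
    using ex_countable_basis by blast
  show "second_countable (euclidean :: (real ^ 'd) topology)"
    unfolding second_countable_def
  proof (intro exI[of _ B] conjI ballI allI impI)
    show "openin euclidean V" if "V \<in> B" for V
      using topological_basis_open[OF B(2) that] by simp
    fix U :: "(real ^ 'd) set" and x assume "openin euclidean U \<and> x \<in> U"
    then obtain V where "V \<in> B" "x \<in> V" "V \<subseteq> U"
      using topological_basisE[OF B(2), of U x] by auto
    then show "\<exists>V\<in>B. x \<in> V \<and> V \<subseteq> U" by blast
  qed (rule B)
qed

lemma compact_torus: "compact_space (atlas_topology (torus_atlas :: (circle ^ 'd, real ^ 'd) chart set))"
proof -
  have "compactin (atlas_topology torus_atlas) (torus_proj ` cbox (0 :: real ^ 'd) 1)"
    by (rule image_compactin[OF _ continuous_map_torus_proj]) (simp add: compact_cbox)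
  moreover have "z \<in> torus_proj ` cbox 0 1" for z :: "circle ^ 'd"
  proof -
    obtain x where x: "z = torus_proj x" using torus_proj_surj by metis
    define y :: "real ^ 'd" where "y = (\<chi> i. frac (x $ i))"
    have "torus_proj x = torus_proj y"
      by (simp add: torus_proj_eq_iff y_def frac_def)
    moreover have "y \<in> cbox 0 1"
      by (auto simp: y_def mem_box_cart frac_lt_1 less_imp_le)
    ultimately show ?thesis using x by blast
  qed
  ultimately show ?thesis
    unfolding compact_space_def topspace_torus by (metis UNIV_eq_I)
qed

lemma smooth_manifold_torus: "smooth_manifold (torus_atlas :: (circle ^ 'd, real ^ 'd) chart set)"
  unfolding smooth_manifold_def
proof (intro conjI ballI)
  show "\<exists>B :: (real ^ 'd) set. finite B \<and> span B = UNIV"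
    using finite_Basis span_Basis by blast
  fix c :: "(circle ^ 'd, real ^ 'd) chart" assume "c \<in> torus_atlas"
  then obtain a where a: "c = torus_chart a" by (auto simp: torus_atlas_def)
  show "inj_on (snd c) (fst c)" "open (snd c ` fst c)"
    by (simp_all add: a torus_chart_inj torus_chart_image open_box)
  fix c' :: "(circle ^ 'd, real ^ 'd) chart" assume "c' \<in> torus_atlas"
  then obtain b where b: "c' = torus_chart b" by (auto simp: torus_atlas_def)
  have img: "snd c ` (fst c \<inter> fst c') = box a (a + 1) \<inter> torus_proj -` fst c'"
    by (auto simp: a torus_chart_coord elim!: torus_chart_domainE intro!: image_eqI torus_chart_domainI)
  have "open (torus_proj -` fst c')"
    using open_map_torus_proj open_box by (auto simp: b torus_chart_def open_map_def openin_torus)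
  then show "open (snd c ` (fst c \<inter> fst c'))"
    unfolding img by (intro open_Int open_box)
  show "smooth_on (snd c ` (fst c \<inter> fst c')) (transition c c')"
  proof (rule smooth_on_local)
    fix x assume "x \<in> snd c ` (fst c \<inter> fst c')"
    then have "x \<in> box a (a + 1)" "torus_proj x \<in> fst (torus_chart b)" using img b by auto
    then obtain U n where U: "open U" "x \<in> U" "\<And>y. y \<in> U \<Longrightarrow> transition (torus_chart a) (torus_chart b) y = y + n"
      using torus_transition by metis
    have "smooth_on U (transition c c')"
      by (rule smooth_on_cong[OF U(1) _ smooth_on_translation]) (simp add: U(3) a b)
    then show "\<exists>U. open U \<and> x \<in> U \<and> smooth_on U (transition c c')" using U by blast
  qed
qed (rule Hausdorff_torus second_countable_torus)+

definition cover_field :: "real ^ 2 \<Rightarrow> real ^ 2"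
  where "cover_field x = vector [sin (2 * pi * x $ 1), cos (2 * pi * x $ 1)]"

lemma cover_field_shift: "(\<And>i. n $ i \<in> \<int>) \<Longrightarrow> cover_field (x + n) = cover_field x"
  using sin_cos_2pi_eq_iff[of "x $ 1 + n $ 1" "x $ 1"] by (simp add: cover_field_def)

lemma Y_torus_eq:
  assumes "torus_proj x \<in> fst (torus_chart a)"
  shows "Y_torus (torus_proj x) (torus_chart a) = cover_field x"
proof -
  obtain n where "snd (torus_chart a) (torus_proj x) = x + n" "\<And>i. n $ i \<in> \<int>"
    using torus_chart_local_shift[OF assms] by metis
  then show ?thesis
    using cover_field_shift[of n x] assms
    by (simp add: Y_torus_def torus_atlas_def Let_def cover_field_def)
qed

lemma cover_field_nonzero: "cover_field x \<noteq> 0"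
proof
  assume "cover_field x = 0"
  then have "cover_field x $ 1 = 0" "cover_field x $ 2 = 0" by simp_all
  then have "sin (2 * pi * x $ 1) = 0" "cos (2 * pi * x $ 1) = 0"
    by (simp_all add: cover_field_def)
  then show False using sin_cos_squared_add[of "2 * pi * x $ 1"] by simp
qed

lemma cover_field_eq: "cover_field x = sin (2 * pi * (x \<bullet> axis 1 1)) *\<^sub>R axis 1 1 + cos (2 * pi * (x \<bullet> axis 1 1)) *\<^sub>R axis 2 1"
proof -
  have "x \<bullet> axis 1 1 = x $ 1" by (simp add: inner_axis)
  then show ?thesis by (simp add: cover_field_def vec_eq_iff forall_2 axis_def)
qed

lemma smooth_cover_field: "smooth_on UNIV cover_field"
  unfolding cover_field_eq[abs_def] by (rule smooth_on_trig_combination)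

lemma vector_field_Y_torus: "vector_field torus_atlas Y_torus"
  unfolding vector_field_def
proof (intro conjI ballI)
  fix z :: "circle ^ 2"
  have "Y_torus z c' = fderiv (transition c c') (snd c z) (Y_torus z c)"
    if c: "c \<in> torus_atlas" "c' \<in> torus_atlas" "z \<in> fst c" "z \<in> fst c'" for c c'
  proof -
    obtain a b where ab: "c = torus_chart a" "c' = torus_chart b" using c by (auto simp: torus_atlas_def)
    obtain x where x: "x \<in> box a (a + 1)" "z = torus_proj x"
      using c(3) ab torus_chart_domainE by metis
    show ?thesis
      using c x by (simp add: ab torus_chart_coord fderiv_torus_transition Y_torus_eq)
  qed
  moreover have "Y_torus z c = 0" if "\<not> (c \<in> torus_atlas \<and> z \<in> fst c)" for c
    using that unfolding Y_torus_def by (rule if_not_P)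
  ultimately show "Y_torus z \<in> tangent_space torus_atlas z"
    unfolding tangent_space_def by blast
next
  fix c :: "(circle ^ 2, real ^ 2) chart" assume "c \<in> torus_atlas"
  then obtain a where a: "c = torus_chart a" by (auto simp: torus_atlas_def)
  show "smooth_on (snd c ` fst c) (\<lambda>x. Y_torus (chart_inv c x) c)"
    unfolding a torus_chart_image
    by (rule smooth_on_cong[OF open_box _ smooth_on_subset[OF smooth_cover_field subset_UNIV]])
      (simp add: torus_chart_inv Y_torus_eq torus_chart_domainI)
qed

lemma compact_flow_torus: "compact_flow torus_atlas Y_torus"
  by (simp add: compact_flow_def smooth_flow_def smooth_manifold_torus vector_field_Y_torus compact_torus)

lemma nonsingular_torus: "nonsingular torus_atlas Y_torus"
  unfolding nonsingular_def
proof
  fix z :: "circle ^ 2"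
  obtain x where x: "z = torus_proj x" using torus_proj_surj by metis
  have *: "Y_torus z (torus_chart (x - vec (1/2))) = cover_field x"
    unfolding x by (rule Y_torus_eq[OF torus_chart_domainI[OF mem_centered_box]])
  show "Y_torus z \<noteq> (\<lambda>c. 0)"
  proof
    assume "Y_torus z = (\<lambda>c. 0)"
    then show False using * cover_field_nonzero[of x] by simp
  qed
qed

text \<open>Smooth maps on the torus are handled through their composition with the covering map, which is
  smooth wherever it takes values in a chart of the target.\<close>

lemma smooth_map_torus_lift:
  assumes "smooth_map torus_atlas B \<phi>" "c' \<in> B"
  shows "open {x. \<phi> (torus_proj x) \<in> fst c'}"
    and "smooth_on {x. \<phi> (torus_proj x) \<in> fst c'} (\<lambda>x. snd c' (\<phi> (torus_proj x)))"
proof -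
  let ?D = "{x. \<phi> (torus_proj x) \<in> fst c'}"
  have img: "snd (torus_chart a) ` (fst (torus_chart a) \<inter> \<phi> -` fst c') = box a (a + 1) \<inter> ?D" for a
    by (auto simp: torus_chart_coord elim!: torus_chart_domainE intro!: image_eqI torus_chart_domainI)
  have *: "open (box a (a + 1) \<inter> ?D)" "smooth_on (box a (a + 1) \<inter> ?D) (local_rep (torus_chart a) c' \<phi>)" for a
    using assms unfolding img[symmetric] smooth_map_def torus_atlas_def by blast+
  have "open (\<Union>a. box a (a + 1) \<inter> ?D)" using *(1) by blast
  moreover have "(\<Union>a. box a (a + 1) \<inter> ?D) = ?D" using mem_centered_box by blast
  ultimately show "open ?D" by simp
  show "smooth_on ?D (\<lambda>x. snd c' (\<phi> (torus_proj x)))"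
  proof (rule smooth_on_local)
    fix x assume x: "x \<in> ?D"
    let ?a = "x - vec (1/2)"
    have "smooth_on (box ?a (?a + 1) \<inter> ?D) (\<lambda>x. snd c' (\<phi> (torus_proj x)))"
      by (rule smooth_on_cong[OF *(1) _ *(2)]) (simp add: local_rep_def torus_chart_inv)
    then show "\<exists>U. open U \<and> x \<in> U \<and> smooth_on U (\<lambda>x. snd c' (\<phi> (torus_proj x)))"
      using *(1) x mem_centered_box by blast
  qed
qed

lemma fderiv_local_rep_torus:
  assumes "x \<in> box a (a + 1)"
  shows "fderiv (local_rep (torus_chart a) c' \<phi>) (snd (torus_chart a) (torus_proj x))
    = fderiv (\<lambda>x. snd c' (\<phi> (torus_proj x))) x"
  unfolding torus_chart_coord[OF assms]
  by (rule fderiv_cong[OF open_box assms]) (simp add: local_rep_def torus_chart_inv)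

lemma prod_chart_inv:
  assumes "x \<in> box a (a + 1)" "\<xi> \<in> box b (b + 1)"
  shows "chart_inv (prod_chart (torus_chart a) (torus_chart b)) (x, \<xi>) = (torus_proj x, torus_proj \<xi>)"
  unfolding chart_inv_def
proof (rule inv_into_f_eq)
  show "inj_on (snd (prod_chart (torus_chart a) (torus_chart b))) (fst (prod_chart (torus_chart a) (torus_chart b)))"
    unfolding prod_chart_def
    by (simp add: map_prod_inj_on torus_chart_inj)
qed (use assms in \<open>auto simp: prod_chart_def torus_chart_coord torus_chart_domainI\<close>)

lemma torus_prod_points: "(y, x) \<in> points (prod_atlas torus_atlas torus_atlas)"
proof -
  obtain c where c: "c \<in> torus_atlas" "y \<in> fst c"
    using torus_points unfolding points_def by blast
  obtain c' where c': "c' \<in> torus_atlas" "x \<in> fst c'"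
    using torus_points unfolding points_def by blast
  have "prod_chart c c' \<in> prod_atlas torus_atlas torus_atlas"
    unfolding prod_atlas_def using c(1) c'(1) by blast
  moreover have "(y, x) \<in> fst (prod_chart c c')" using c(2) c'(2) by (simp add: prod_chart_def)
  ultimately show ?thesis unfolding points_def by blast
qed

lemma smooth_map_prod_torus_lift:
  fixes F :: "(circle ^ 'a) \<times> (circle ^ 'b) \<Rightarrow> 'm"
  assumes "smooth_map (prod_atlas torus_atlas torus_atlas) B F" "c' \<in> B"
  shows "open {z. F (torus_proj (fst z), torus_proj (snd z)) \<in> fst c'}"
    and "smooth_on {z. F (torus_proj (fst z), torus_proj (snd z)) \<in> fst c'}
      (\<lambda>z. snd c' (F (torus_proj (fst z), torus_proj (snd z))))"
proof -
  let ?D = "{z. F (torus_proj (fst z), torus_proj (snd z)) \<in> fst c'}"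
  let ?bx = "\<lambda>a b. box a (a + 1) \<times> box b (b + 1)"
  let ?c = "\<lambda>a b. prod_chart (torus_chart a) (torus_chart b)"
  have img: "snd (?c a b) ` (fst (?c a b) \<inter> F -` fst c') = ?bx a b \<inter> ?D" for a :: "real ^ 'a" and b :: "real ^ 'b"
    by (force simp: prod_chart_def torus_chart_coord elim!: torus_chart_domainE
        intro!: image_eqI torus_chart_domainI)
  have "?c a b \<in> prod_atlas torus_atlas torus_atlas" for a b
    unfolding prod_atlas_def torus_atlas_def by blast
  then have *: "open (?bx a b \<inter> ?D)" "smooth_on (?bx a b \<inter> ?D) (local_rep (?c a b) c' F)" for a b
    using assms unfolding img[symmetric] smooth_map_def by blast+
  have cov: "z \<in> ?bx (fst z - vec (1/2)) (snd z - vec (1/2))" for z :: "(real ^ 'a) \<times> (real ^ 'b)"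
    unfolding mem_Times_iff by (intro conjI mem_centered_box)
  have "open (\<Union>(a, b)\<in>UNIV. ?bx a b \<inter> ?D)" using *(1) by auto
  moreover have "(\<Union>(a, b)\<in>UNIV. ?bx a b \<inter> ?D) = ?D" using cov by blast
  ultimately show "open ?D" by simp
  show "smooth_on ?D (\<lambda>z. snd c' (F (torus_proj (fst z), torus_proj (snd z))))"
  proof (rule smooth_on_local)
    fix z assume z: "z \<in> ?D"
    let ?b = "?bx (fst z - vec (1/2)) (snd z - vec (1/2))"
    have "smooth_on (?b \<inter> ?D) (\<lambda>z. snd c' (F (torus_proj (fst z), torus_proj (snd z))))"
      by (rule smooth_on_cong[OF *(1) _ *(2)]) (auto simp: local_rep_def prod_chart_inv)
    then show "\<exists>U. open U \<and> z \<in> U \<and> smooth_on U (\<lambda>z. snd c' (F (torus_proj (fst z), torus_proj (snd z))))"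
      using *(1) z cov by blast
  qed
qed

lemma torus_trajectory:
  assumes a: "\<And>t. (a has_vector_derivative cover_field (a t)) (at t)"
  shows "trajectory torus_atlas Y_torus UNIV (\<lambda>t. torus_proj (a t))"
  unfolding trajectory_def
proof (intro conjI ballI impI)
  have "continuous_on UNIV a"
    using a by (auto intro!: continuous_at_imp_continuous_on has_vector_derivative_continuous)
  then have "continuous_map euclidean euclidean a" by simp
  from continuous_map_compose[OF this continuous_map_torus_proj]
  show "continuous_map (top_of_set UNIV) (atlas_topology torus_atlas) (\<lambda>t. torus_proj (a t))"
    by (simp add: o_def)
  fix t c assume c: "c \<in> torus_atlas" "torus_proj (a t) \<in> fst c"
  then obtain b where b: "c = torus_chart b" by (auto simp: torus_atlas_def)
  obtain U n where U: "open U" "a t \<in> U"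
    "\<And>y. y \<in> U \<Longrightarrow> torus_proj y \<in> fst (torus_chart b) \<and> snd (torus_chart b) (torus_proj y) = y + n"
    using torus_chart_local_shift c(2) b by metis
  have "((\<lambda>s. a s + n) has_vector_derivative cover_field (a t)) (at t)"
    using has_vector_derivative_add_const a by blast
  moreover have "open (a -` U)"
    by (rule open_vimage[OF U(1)]) fact
  ultimately have "((\<lambda>s. snd c (torus_proj (a s))) has_vector_derivative cover_field (a t)) (at t)"
    by (rule has_vector_derivative_transform_within_open)
      (use U b in auto)
  then show "((\<lambda>s. snd c (torus_proj (a s))) has_vector_derivative Y_torus (torus_proj (a t)) c) (at t within UNIV)"
    using c b by (simp add: Y_torus_eq)
qed simp

text \<open>The strip between the closed orbits is invariant. Off \<open>x = 1/2\<close> the substitution \<open>T = tan(\<pi> x)\<close>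
  turns \<open>x' = sin(2 \<pi> x)\<close> into \<open>T' = 2 \<pi> T\<close>, and \<open>y' = (1 - T\<^sup>2) / (1 + T\<^sup>2)\<close> is integrated by
  \<open>t - ln(1 + T\<^sup>2) / (2 \<pi>)\<close>.\<close>

lemma cover_trajectory_exists:
  fixes x :: "real ^ 2"
  assumes x: "0 \<le> x $ 1" "x $ 1 \<le> 1/2"
  obtains a where "a 0 = x" "\<And>t. (a has_vector_derivative cover_field (a t)) (at t)"
proof (cases "x $ 1 = 1/2")
  case True
  define a where "a t = x - t *\<^sub>R axis 2 1" for t :: real
  show ?thesis
  proof (rule that[of a])
    show "a 0 = x" by (simp add: a_def)
    have "cover_field (a t) = - axis 2 1" for t
    proof -
      have "2 * pi * x $ 1 = pi" using True by simp
      then have "sin (2 * pi * x $ 1) = 0" "cos (2 * pi * x $ 1) = -1"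
        by (simp_all only: sin_pi cos_pi)
      then show ?thesis by (simp add: cover_field_def a_def vec_eq_iff forall_2 axis_def)
    qed
    then show "(a has_vector_derivative cover_field (a t)) (at t)" for t
      unfolding a_def[abs_def] by (auto intro!: derivative_eq_intros)
  qed
next
  case False
  then have x1: "0 \<le> x $ 1" "x $ 1 < 1/2" using x by auto
  \<comment> \<open>initial value of \<open>tan (\<pi> x)\<close>, which grows like \<open>exp (2 \<pi> t)\<close>\<close>
  define k where "k = tan (pi * x $ 1)"
  define T where "T t = k * exp (2 * pi * t)" for t
  define h where "h t = x $ 2 + t - (ln (1 + (T t)\<^sup>2) - ln (1 + k\<^sup>2)) / (2 * pi)" for t
  define a :: "real \<Rightarrow> real ^ 2" where "a t = (arctan (T t) / pi) *\<^sub>R axis 1 1 + h t *\<^sub>R axis 2 1" for t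
  have pos: "1 + (T t)\<^sup>2 > 0" for t by (simp add: add_pos_nonneg)
  have dT: "(T has_real_derivative 2 * pi * T t) (at t)" for t
    unfolding T_def[abs_def] by (auto intro!: derivative_eq_intros)
  have field: "cover_field (a t) = (2 * T t / (1 + (T t)\<^sup>2)) *\<^sub>R axis 1 1
      + ((1 - (T t)\<^sup>2) / (1 + (T t)\<^sup>2)) *\<^sub>R axis 2 1" for t
  proof -
    have "2 * pi * a t $ 1 = 2 * arctan (T t)" by (simp add: a_def axis_def)
    moreover have "sin (2 * arctan (T t)) = 2 * T t / (1 + (T t)\<^sup>2)"
      using pos[of t] by (simp add: sin_double sin_arctan cos_arctan power2_eq_square[symmetric])
    moreover have "cos (2 * arctan (T t)) = (1 - (T t)\<^sup>2) / (1 + (T t)\<^sup>2)"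
      using pos[of t] by (simp add: cos_double sin_arctan cos_arctan power_divide diff_divide_distrib)
    ultimately have "sin (2 * pi * a t $ 1) = 2 * T t / (1 + (T t)\<^sup>2)"
        "cos (2 * pi * a t $ 1) = (1 - (T t)\<^sup>2) / (1 + (T t)\<^sup>2)"
      by (simp_all only:)
    then show ?thesis
      by (simp add: cover_field_def vec_eq_iff forall_2 axis_def)
  qed
  have d1: "((\<lambda>t. arctan (T t) / pi) has_real_derivative 2 * T t / (1 + (T t)\<^sup>2)) (at t)" for t
    by (rule derivative_eq_intros dT refl | simp)+ (simp add: field_simps)
  have d2: "(h has_real_derivative (1 - (T t)\<^sup>2) / (1 + (T t)\<^sup>2)) (at t)" for t
    unfolding h_def[abs_def]
    apply (rule derivative_eq_intros dT refl pos | simp)+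
    using pos[of t] by (simp add: field_simps power2_eq_square)
  show ?thesis
  proof (rule that[of a])
    have "pi * x $ 1 < pi / 2" using x1 by simp
    moreover have "0 \<le> pi * x $ 1" using x1 by simp
    then have "- (pi / 2) < pi * x $ 1" using pi_half_gt_zero by linarith
    ultimately have "arctan k = pi * x $ 1" unfolding k_def by (intro arctan_tan)
    then show "a 0 = x"
      by (simp add: a_def T_def h_def vec_eq_iff forall_2 axis_def)
    show "(a has_vector_derivative cover_field (a t)) (at t)" for t
      unfolding field unfolding a_def[abs_def]
      using d1[of t] d2[of t]
      by (intro has_vector_derivative_add has_vector_derivative_scaleR[OF _ has_vector_derivative_const, simplified])
  qed
qed

lemma torus_partial_eq:
  "torus_partial k f (torus_proj \<xi>) = vector_derivative (\<lambda>s. f (torus_proj (\<xi> + s *\<^sub>R axis k 1))) (at 0)"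
proof -
  have "torus_proj \<xi> + axis k (abs_circle s) = torus_proj (\<xi> + s *\<^sub>R axis k 1)" for s
    by (auto simp: torus_proj_def vec_eq_iff axis_def plus_circle.abs_eq zero_circle.abs_eq[symmetric])
  then show ?thesis by (simp add: torus_partial_def)
qed


section \<open>Strongly adapted 1-forms\<close>

lemma fderiv_cover_field_axis2: "fderiv cover_field x (axis 2 1) = 0"
proof -
  have "(cover_field has_derivative (\<lambda>v. (cos (2 * pi * (x \<bullet> axis 1 1)) * (2 * pi * (v \<bullet> axis 1 1))) *\<^sub>R axis 1 1
     + (- sin (2 * pi * (x \<bullet> axis 1 1)) * (2 * pi * (v \<bullet> axis 1 1))) *\<^sub>R axis 2 1)) (at x)"
    unfolding cover_field_eq[abs_def] by (auto intro!: derivative_eq_intros simp: mult.commute)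
  then show ?thesis by (simp add: fderiv_eq inner_axis_axis)
qed

text \<open>The function \<open>\<beta> = \<theta>(\<partial>\<^sub>y)\<close> satisfies \<open>Y \<beta> = \<partial>\<^sub>y L\<close> because \<open>Y\<close> does not depend on \<open>y\<close>. It is
  strictly positive on one closed orbit and strictly negative on the other one, whereas
  \<open>conserved_density_vanishes\<close> makes it vanish.\<close>

theorem no_strongly_adapted_form: "\<not> strongly_adapted torus_atlas Y_torus \<theta>"
proof
  assume adapted: "strongly_adapted torus_atlas Y_torus \<theta>"
  then obtain L where L: "smooth_function torus_atlas L"
    and lie: "\<And>c y w. c \<in> torus_atlas \<Longrightarrow> y \<in> fst c \<Longrightarrow> lie_deriv Y_torus \<theta> c y w = exterior_deriv L c y w"
    unfolding strongly_adapted_def by blast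
  have form: "one_form torus_atlas \<theta>"
    and pos: "\<And>c y. c \<in> torus_atlas \<Longrightarrow> y \<in> fst c \<Longrightarrow> \<theta> y c \<bullet> Y_torus y c > 0"
    using adapted unfolding strongly_adapted_def by blast+
  have atlas: "torus_chart a \<in> torus_atlas" for a :: "real ^ 2" by (simp add: torus_atlas_def)
  \<comment> \<open>a chart centred at the given point, to single out one representative of \<open>\<theta>\<close> everywhere\<close>
  define mid where "mid x = torus_chart (x - vec (1/2))" for x :: "real ^ 2"
  define th where "th x = \<theta> (torus_proj x) (mid x)" for x
  define \<beta> where "\<beta> x = th x \<bullet> axis 2 1" for x
  define l where "l x = L (torus_proj x)" for x :: "real ^ 2"
  have mid: "mid x \<in> torus_atlas" "torus_proj x \<in> fst (mid x)" for x
    by (simp_all add: mid_def atlas torus_chart_domainI mem_centered_box)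
  have th_eq: "th x = \<theta> (torus_proj x) (torus_chart a)" if x: "torus_proj x \<in> fst (torus_chart a)" for a x
  proof -
    have "\<theta> (torus_proj x) \<in> cotangent_space torus_atlas (torus_proj x)"
      using form by (simp add: one_form_def torus_points)
    then have "th x \<bullet> w = \<theta> (torus_proj x) (torus_chart a)
        \<bullet> fderiv (transition (mid x) (torus_chart a)) (snd (mid x) (torus_proj x)) w" for w
      using mid[of x] x atlas[of a] unfolding cotangent_space_def th_def by blast
    moreover have "snd (mid x) (torus_proj x) = x"
      by (simp add: mid_def torus_chart_coord mem_centered_box)
    moreover have "fderiv (transition (mid x) (torus_chart a)) x = (\<lambda>v. v)"
      unfolding mid_def by (rule fderiv_torus_transition[OF mem_centered_box x])
    ultimately show ?thesis using vector_eq_rdot by auto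
  qed
  have th_smooth: "smooth_on (box a (a + 1)) th" for a
  proof (rule smooth_on_cong[OF open_box])
    show "smooth_on (box a (a + 1)) (\<lambda>x. \<theta> (chart_inv (torus_chart a) x) (torus_chart a))"
      using form atlas[of a] torus_chart_image[of a] unfolding one_form_def by metis
    show "\<theta> (chart_inv (torus_chart a) x) (torus_chart a) = th x" if "x \<in> box a (a + 1)" for x
      using that by (simp add: torus_chart_inv th_eq[OF torus_chart_domainI[OF that]])
  qed
  have l_smooth: "smooth_on (box a (a + 1)) l" for a
  proof (rule smooth_on_cong[OF open_box])
    show "smooth_on (box a (a + 1)) (L \<circ> chart_inv (torus_chart a))"
      using L atlas[of a] torus_chart_image[of a] unfolding smooth_function_def by metis
    show "(L \<circ> chart_inv (torus_chart a)) x = l x" if "x \<in> box a (a + 1)" for x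
      using that by (simp add: torus_chart_inv l_def)
  qed
  have global: "smooth_on UNIV f" if "\<And>a. smooth_on (box a (a + 1)) f" for f :: "real ^ 2 \<Rightarrow> 'x::real_normed_vector"
    by (rule smooth_on_local) (use that open_box mem_centered_box in blast)
  have smooth: "smooth_on UNIV th" "smooth_on UNIV l"
    by (intro global th_smooth l_smooth)+
  have \<beta>_smooth: "smooth_on UNIV \<beta>"
    unfolding \<beta>_def[abs_def] by (rule smooth_on_inner_const[OF open_UNIV smooth(1)])
  have proj_shift: "torus_proj (x + axis 2 1) = torus_proj x" for x :: "real ^ 2"
    by (simp add: torus_proj_eq_iff axis_def)
  have law: "fderiv \<beta> x (cover_field x) = fderiv l x (axis 2 1)" for x
  proof -
    let ?a = "x - vec (1/2)"
    have x: "x \<in> box ?a (?a + 1)" by (rule mem_centered_box)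
    have coord: "snd (torus_chart ?a) (torus_proj x) = x" by (rule torus_chart_coord[OF x])
    have 1: "fderiv (\<lambda>x. \<theta> (chart_inv (torus_chart ?a) x) (torus_chart ?a)) x = fderiv th x"
      by (rule fderiv_cong[OF open_box x])
        (simp add: torus_chart_inv th_eq[OF torus_chart_domainI])
    have 2: "fderiv (\<lambda>x. Y_torus (chart_inv (torus_chart ?a) x) (torus_chart ?a)) x = fderiv cover_field x"
      by (rule fderiv_cong[OF open_box x]) (simp add: torus_chart_inv Y_torus_eq torus_chart_domainI)
    have 3: "fderiv (L \<circ> chart_inv (torus_chart ?a)) x = fderiv l x"
      by (rule fderiv_cong[OF open_box x]) (simp add: torus_chart_inv l_def)
    have "fderiv th x (cover_field x) \<bullet> axis 2 1 = fderiv l x (axis 2 1)"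
      using lie[OF atlas torus_chart_domainI[OF x], of "axis 2 1"]
      unfolding lie_deriv_def exterior_deriv_def coord 1 2 3 fderiv_cover_field_axis2
      by (simp add: Y_torus_eq[OF torus_chart_domainI[OF x]])
    then show ?thesis
      unfolding \<beta>_def[abs_def]
      by (simp add: fderiv_inner_const smooth_on_differentiable[OF smooth(1)])
  qed
  have sign: "th x \<bullet> cover_field x > 0" for x
    using pos[OF mid(1), OF mid(2), of x]
    by (simp add: th_def mid_def Y_torus_eq torus_chart_domainI mem_centered_box)
  have balance: "sin (2 * pi * (z \<bullet> axis 1 1)) * fderiv \<beta> z (axis 1 1) + cos (2 * pi * (z \<bullet> axis 1 1)) * fderiv \<beta> z (axis 2 1)
      = fderiv l z (axis 2 1)" for z
  proof -
    have lin: "linear (fderiv \<beta> z)"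
      by (rule has_derivative_linear[OF smooth_on_has_derivative[OF \<beta>_smooth UNIV_I]])
    show ?thesis
      using law[of z] by (simp add: cover_field_eq linear_add[OF lin] linear_scale[OF lin])
  qed
  have nonneg: "0 \<le> \<beta> z" if "z \<bullet> axis 1 1 = 0" for z
    using sign[of z] that by (simp add: cover_field_eq \<beta>_def)
  have nonpos: "\<beta> z \<le> 0" if "z \<bullet> axis 1 1 = 1/2" for z
  proof -
    have "2 * pi * (z \<bullet> axis 1 1) = pi" using that by simp
    then have "sin (2 * pi * (z \<bullet> axis 1 1)) = 0" "cos (2 * pi * (z \<bullet> axis 1 1)) = -1"
      by (simp_all only: sin_pi cos_pi)
    then have "cover_field z = - axis 2 1"
      unfolding cover_field_eq by simp
    then show ?thesis using sign[of z] by (simp add: \<beta>_def)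
  qed
  have \<beta>_per: "\<beta> (z + axis 2 1) = \<beta> z" for z
    using th_eq[of "z + axis 2 1" "z - vec (1/2)"] mid(2)[of z]
    by (simp add: \<beta>_def proj_shift th_def[of z] mid_def)
  have l_per: "l (z + axis 2 1) = l z" for z by (simp add: l_def proj_shift)
  have "(axis 1 1 :: real ^ 2) \<noteq> axis 2 1" by (simp add: axis_eq_axis)
  then have "\<beta> 0 = 0"
    using conserved_density_vanishes[of "axis 1 1" "axis 2 1" "{}" \<beta> l "\<lambda>_ _. 0" 0]
      smooth_on_C1[OF \<beta>_smooth] smooth_on_C1[OF smooth(2)] \<beta>_per l_per balance nonneg nonpos
    by (simp del: Ck_on.simps)
  then show False using sign[of 0] by (simp add: cover_field_eq \<beta>_def)
qed


section \<open>Waves with values in a Riemannian manifold\<close>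

lemma smooth_manifold_frame:
  fixes A :: "('m, 'e::real_inner) chart set"
  assumes "smooth_manifold A"
  obtains E :: "'e set" where "parseval_frame E"
  using assms parseval_frame_exists unfolding smooth_manifold_def by metis

lemma chart_inv_coord: "inj_on (snd c) (fst c) \<Longrightarrow> y \<in> fst c \<Longrightarrow> chart_inv c (snd c y) = y"
  by (simp add: chart_inv_def)

locale riemannian =
  fixes A :: "('m, 'e::real_inner) chart set" and g :: "('m, 'e) metric" and E :: "'e set"
  assumes riem: "riemannian_manifold A g" and frame: "parseval_frame E"
begin

definition metric_rep :: "('m, 'e) chart \<Rightarrow> 'e \<Rightarrow> 'e \<Rightarrow> 'e \<Rightarrow> real"
  where "metric_rep c q u v = g (chart_inv c q) c u v"

lemma manifold: "smooth_manifold A"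
  using riem by (simp add: riemannian_manifold_def)

lemma chart_inj: "c \<in> A \<Longrightarrow> inj_on (snd c) (fst c)"
  and chart_open: "c \<in> A \<Longrightarrow> open (snd c ` fst c)"
proof -
  have "\<forall>c\<in>A. inj_on (snd c) (fst c) \<and> open (snd c ` fst c)"
    using manifold unfolding smooth_manifold_def by (elim conjE)
  then show "c \<in> A \<Longrightarrow> inj_on (snd c) (fst c)" "c \<in> A \<Longrightarrow> open (snd c ` fst c)"
    by simp_all
qed

lemma inv_coord: "c \<in> A \<Longrightarrow> y \<in> fst c \<Longrightarrow> chart_inv c (snd c y) = y"
  by (rule chart_inv_coord[OF chart_inj])

lemma metric_form:
  assumes "c \<in> A" "y \<in> fst c" shows "inner_form (g y c)"
proof -
  have "\<forall>c\<in>A. \<forall>y\<in>fst c. (\<forall>u. linear (g y c u)) \<and> (\<forall>u v. g y c u v = g y c v u)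
      \<and> (\<forall>u. u \<noteq> 0 \<longrightarrow> g y c u u > 0)"
    using riem unfolding riemannian_manifold_def by (elim conjE)
  from bspec[OF bspec[OF this assms(1)] assms(2)] show ?thesis unfolding inner_form_def .
qed

lemma metric_smooth:
  assumes "c \<in> A" shows "smooth_on (snd c ` fst c) (\<lambda>x. g (chart_inv c x) c u v)"
proof -
  have "\<forall>c\<in>A. \<forall>u v. smooth_on (snd c ` fst c) (\<lambda>x. g (chart_inv c x) c u v)"
    using riem unfolding riemannian_manifold_def by (elim conjE)
  then show ?thesis using assms by simp
qed

lemma metric_change:
  assumes "c \<in> A" "c' \<in> A" "y \<in> fst c" "y \<in> fst c'"
  shows "g y c u v = g y c' (fderiv (transition c c') (snd c y) u) (fderiv (transition c c') (snd c y) v)"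
proof -
  have "\<forall>c\<in>A. \<forall>c'\<in>A. \<forall>y\<in>fst c \<inter> fst c'. \<forall>u v.
      g y c u v = g y c' (fderiv (transition c c') (snd c y) u) (fderiv (transition c c') (snd c y) v)"
    using riem unfolding riemannian_manifold_def by (elim conjE)
  from this[rule_format, OF assms(1,2) IntI[OF assms(3,4)]] show ?thesis .
qed

lemma smooth_metric_rep:
  assumes c: "c \<in> A" shows "smooth_metric E (snd c ` fst c) (metric_rep c)"
proof
  show "inner_form (metric_rep c q)" if "q \<in> snd c ` fst c" for q
    using that metric_form[OF c] inv_coord[OF c] by (auto simp: metric_rep_def[abs_def])
  show "smooth_on (snd c ` fst c) (\<lambda>q. metric_rep c q u v)" for u v
    unfolding metric_rep_def by (rule metric_smooth[OF c])
qed (rule frame chart_open c)+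

lemma sharp_eq:
  assumes "c \<in> A" "y \<in> fst c" shows "g y c (sharp g c y p) w = p \<bullet> w"
proof -
  have "\<exists>!v. \<forall>w. g y c v w = p \<bullet> w"
    by (rule inner_form_represents[OF frame metric_form[OF assms]])
      (rule bounded_linear.linear[OF bounded_linear_inner_right])
  from theI'[OF this] show ?thesis unfolding sharp_def by (rule spec)
qed

lemma sharp_unique:
  assumes "c \<in> A" "y \<in> fst c" "\<And>w. g y c v w = p \<bullet> w" shows "sharp g c y p = v"
proof -
  have "\<exists>!v. \<forall>w. g y c v w = p \<bullet> w"
    by (rule inner_form_represents[OF frame metric_form[OF assms(1,2)]])
      (rule bounded_linear.linear[OF bounded_linear_inner_right])
  then show ?thesis unfolding sharp_def by (rule the1_equality) (simp add: assms(3))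
qed

lemma christoffel_eq:
  assumes c: "c \<in> A" and y: "y \<in> fst c"
  shows "2 * g y c (christoffel g c y u v) w =
    dG (metric_rep c) (snd c y) u v w + dG (metric_rep c) (snd c y) v u w - dG (metric_rep c) (snd c y) w u v"
proof -
  interpret smooth_metric E "snd c ` fst c" "metric_rep c" by (rule smooth_metric_rep[OF c])
  let ?d = "dG (metric_rep c) (snd c y)"
  have q: "snd c y \<in> snd c ` fst c" using y by blast
  have lin: "linear (\<lambda>w. (?d u v w + ?d v u w - ?d w u v) / 2)"
    by (rule linearI)
      (simp_all add: linear_add[OF linear_dG_right[OF q]] linear_add[OF linear_dG[OF q]]
        linear_scale[OF linear_dG_right[OF q]] linear_scale[OF linear_dG[OF q]] algebra_simps add_divide_distrib diff_divide_distrib)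
  have "\<exists>!z. \<forall>w. g y c z w = (?d u v w + ?d v u w - ?d w u v) / 2"
    by (rule inner_form_represents[OF frame metric_form[OF c y] lin])
  moreover have "(g y c z w = (?d u v w + ?d v u w - ?d w u v) / 2)
      \<longleftrightarrow> (2 * g y c z w = ?d u v w + ?d v u w - ?d w u v)" for z w
    by auto
  ultimately have "\<exists>!z. \<forall>w. 2 * g y c z w = ?d u v w + ?d v u w - ?d w u v"
    by simp
  from theI'[OF this] show ?thesis
    unfolding christoffel_def Let_def dG_def metric_rep_def[abs_def] by (rule spec)
qed

text \<open>When the covector is dual to the velocity, the two derivatives of the metric along the velocity
  cancel by symmetry.\<close>

lemma momentum_christoffel:
  assumes c: "c \<in> A" and y: "y \<in> fst c"
  shows "p \<bullet> christoffel g c y (sharp g c y p) w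
    = 1/2 * dG (metric_rep c) (snd c y) w (sharp g c y p) (sharp g c y p)"
proof -
  interpret smooth_metric E "snd c ` fst c" "metric_rep c" by (rule smooth_metric_rep[OF c])
  have q: "snd c y \<in> snd c ` fst c" using y by blast
  let ?v = "sharp g c y p"
  have "2 * (p \<bullet> christoffel g c y ?v w) = 2 * g y c (christoffel g c y ?v w) ?v"
    using sharp_eq[OF c y] inner_form_sym[OF metric_form[OF c y]] by metis
  also have "\<dots> = dG (metric_rep c) (snd c y) w ?v ?v"
    unfolding christoffel_eq[OF c y] using dG_sym[OF q, of ?v w ?v] by simp
  finally show ?thesis by simp
qed

lemma transition_smooth:
  assumes "c \<in> A" "c' \<in> A"
  shows "open (snd c ` (fst c \<inter> fst c'))" "smooth_on (snd c ` (fst c \<inter> fst c')) (transition c c')"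
proof -
  have "\<forall>c\<in>A. \<forall>c'\<in>A. open (snd c ` (fst c \<inter> fst c')) \<and>
      smooth_on (snd c ` (fst c \<inter> fst c')) (transition c c')"
    using manifold unfolding smooth_manifold_def by (elim conjE)
  then show "open (snd c ` (fst c \<inter> fst c'))" "smooth_on (snd c ` (fst c \<inter> fst c')) (transition c c')"
    using assms by simp_all
qed

lemma transition_derivative:
  assumes "c \<in> A" "c' \<in> A" "y \<in> fst c" "y \<in> fst c'"
  shows "(transition c c' has_derivative fderiv (transition c c') (snd c y)) (at (snd c y))"
  by (rule smooth_on_has_derivative[OF transition_smooth(2)[OF assms(1,2)]]) (use assms in blast)

end

text \<open>A map from the cover to the cotangent bundle that is smooth in all canonical charts. The base
  point and the components of the covector in a chart \<open>c\<close> are \<open>pos c\<close> and \<open>mom c\<close>.\<close>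

locale cotangent_lift = riemannian A g E
  for A :: "('m, 'e::real_inner) chart set" and g :: "('m, 'e) metric" and E :: "'e set" +
  fixes \<psi> :: "'z::euclidean_space \<Rightarrow> ('m, 'e) cot"
  assumes in_points: "\<psi> z \<in> points (cotangent_atlas A)"
    and open_lift: "C \<in> cotangent_atlas A \<Longrightarrow> open {z. \<psi> z \<in> fst C}"
    and smooth_lift: "C \<in> cotangent_atlas A \<Longrightarrow> smooth_on {z. \<psi> z \<in> fst C} (\<lambda>z. snd C (\<psi> z))"
begin

definition dom :: "('m, 'e) chart \<Rightarrow> 'z set" where "dom c = {z. fst (\<psi> z) \<in> fst c}"
definition pos :: "('m, 'e) chart \<Rightarrow> 'z \<Rightarrow> 'e" where "pos c z = snd c (fst (\<psi> z))"
definition mom :: "('m, 'e) chart \<Rightarrow> 'z \<Rightarrow> 'e" where "mom c z = snd (\<psi> z) c"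

lemma mem_cotangent_chart: "x \<in> fst (cotangent_chart A c) \<longleftrightarrow> fst x \<in> fst c \<and> snd x \<in> cotangent_space A (fst x)"
  by (cases x) (simp add: cotangent_chart_def)

lemma in_chart: "\<exists>c\<in>A. \<psi> z \<in> fst (cotangent_chart A c)"
  using in_points[of z] unfolding points_def cotangent_atlas_def by blast

lemma cotangent: "snd (\<psi> z) \<in> cotangent_space A (fst (\<psi> z))"
  using in_chart[of z] unfolding mem_cotangent_chart by blast

lemma mem_chart_iff: "\<psi> z \<in> fst (cotangent_chart A c) \<longleftrightarrow> z \<in> dom c"
  using cotangent by (simp add: mem_cotangent_chart dom_def)

lemma chart_value: "snd (cotangent_chart A c) (\<psi> z) = (pos c z, mom c z)"
  by (simp add: cotangent_chart_def pos_def mom_def case_prod_beta)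

lemma cover: "\<exists>c\<in>A. z \<in> dom c"
  using in_chart[of z] unfolding mem_chart_iff .

lemma open_dom: "c \<in> A \<Longrightarrow> open (dom c)"
  using open_lift[of "cotangent_chart A c"] by (simp add: mem_chart_iff cotangent_atlas_def)

lemma smooth_pair: "c \<in> A \<Longrightarrow> smooth_on (dom c) (\<lambda>z. (pos c z, mom c z))"
  using smooth_lift[of "cotangent_chart A c"] by (simp add: mem_chart_iff chart_value cotangent_atlas_def)

lemma smooth_pos: "c \<in> A \<Longrightarrow> smooth_on (dom c) (pos c)"
  using smooth_on_bounded_linear[OF bounded_linear_fst open_dom smooth_pair] by simp

lemma smooth_mom: "c \<in> A \<Longrightarrow> smooth_on (dom c) (mom c)"
  using smooth_on_bounded_linear[OF bounded_linear_snd open_dom smooth_pair] by simp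

lemma inv_pos: "c \<in> A \<Longrightarrow> z \<in> dom c \<Longrightarrow> chart_inv c (pos c z) = fst (\<psi> z)"
  using inv_coord by (simp add: pos_def dom_def)

lemma fderiv_pair:
  assumes "c \<in> A" "z \<in> dom c"
  shows "fderiv (\<lambda>z. snd (cotangent_chart A c) (\<psi> z)) z v = (fderiv (pos c) z v, fderiv (mom c) z v)"
  unfolding chart_value
  by (subst fderiv_eq[OF has_derivative_Pair[OF smooth_on_has_derivative[OF smooth_pos[OF assms(1)] assms(2)]
        smooth_on_has_derivative[OF smooth_mom[OF assms(1)] assms(2)]]]) (rule refl)

lemma pos_change:
  assumes c: "c \<in> A" "c' \<in> A" and z: "z \<in> dom c" "z \<in> dom c'"
  shows "fderiv (pos c') z v = fderiv (transition c c') (pos c z) (fderiv (pos c) z v)"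
proof -
  let ?T = "fderiv (transition c c') (pos c z)"
  have T: "(transition c c' has_derivative ?T) (at (pos c z))"
    using transition_derivative[OF c, of "fst (\<psi> z)"] z by (simp add: dom_def pos_def)
  have "((\<lambda>z. transition c c' (pos c z)) has_derivative (\<lambda>v. ?T (fderiv (pos c) z v))) (at z)"
    by (rule has_derivative_compose[OF smooth_on_has_derivative[OF smooth_pos[OF c(1)] z(1)]]) (rule T)
  then have "(pos c' has_derivative (\<lambda>v. ?T (fderiv (pos c) z v))) (at z)"
    by (rule has_derivative_transform_within_open[OF _ open_dom[OF c(1)] z(1)])
      (simp add: transition_def local_rep_def inv_pos[OF c(1)], simp add: pos_def)
  from fderiv_eq[OF this] show ?thesis by simp
qed

text \<open>The invariant equations of motion with time derivatives in the direction \<open>v\<close> and space derivatives in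
  the directions of \<open>K\<close>; for empty \<open>K\<close> they describe a potential well.\<close>

definition wave_equation :: "'z set \<Rightarrow> ('m \<Rightarrow> real) \<Rightarrow> 'z \<Rightarrow> ('m, 'e) chart \<Rightarrow> 'z \<Rightarrow> bool"
  where "wave_equation K V v c z \<longleftrightarrow>
    fderiv (pos c) z v = sharp g c (fst (\<psi> z)) (mom c z) \<and>
    (\<forall>w. cov_deriv_covector g c (fst (\<psi> z)) (fderiv (pos c) z v) (mom c z) (fderiv (mom c) z v) w
      = (\<Sum>k\<in>K. g (fst (\<psi> z)) c (cov_deriv_vector g c (fst (\<psi> z)) (fderiv (pos c) z k) (fderiv (pos c) z k)
            (fderiv (\<lambda>z. fderiv (pos c) z k) z k)) w) - exterior_deriv V c (fst (\<psi> z)) w)"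

text \<open>With the Christoffel symbols written out, the wave equation becomes the coordinate equations of
  \<open>wave_cover\<close>; independence of the charts is the transformation law of vectors, covectors and of the
  metric.\<close>

theorem wave_cover_riemannian:
  fixes e1 e2 :: 'z
  assumes e: "e1 \<in> Basis" "e2 \<in> Basis" "e1 \<noteq> e2" and K: "K \<subseteq> Basis - {e1}"
    and V: "smooth_function A V" and periodic: "\<And>z k. k \<in> Basis \<Longrightarrow> \<psi> (z + k) = \<psi> z"
    and wave: "\<And>c z. c \<in> A \<Longrightarrow> z \<in> dom c \<Longrightarrow> 0 \<le> z \<bullet> e1 \<Longrightarrow> z \<bullet> e1 \<le> 1/2 \<Longrightarrow>
      wave_equation K V (field_dir e1 e2 z) c z"
  shows "wave_cover e1 e2 K A E dom pos mom (\<lambda>c. snd c ` fst c) metric_rep (\<lambda>c. V \<circ> chart_inv c)"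
proof (rule wave_cover.intro, goal_cases)
  case (5 c)
  then show ?case by (rule smooth_metric_rep)
next
  case (6 c)
  then show ?case using V by (simp add: smooth_function_def)
next
  case (9 c z)
  then show ?case by (simp add: pos_def dom_def)
next
  case (12 c z k)
  then show ?case using periodic[of k z] by (simp add: dom_def pos_def mom_def)
next
  case (13 c c' z v u)
  let ?y = "fst (\<psi> z)"
  have y: "?y \<in> fst c" "?y \<in> fst c'" using 13 by (simp_all add: dom_def)
  have "mom c z \<bullet> w = mom c' z \<bullet> fderiv (transition c c') (pos c z) w" for w
    using cotangent[of z] 13 y unfolding cotangent_space_def mom_def pos_def by blast
  moreover have "g ?y c a b = g ?y c' (fderiv (transition c c') (pos c z) a) (fderiv (transition c c') (pos c z) b)" for a b
    unfolding pos_def by (rule metric_change[OF 13(1,2) y])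
  ultimately show ?case
    using pos_change[OF 13] by (simp add: metric_rep_def inv_pos 13)
next
  case (14 c z w)
  then show ?case
    using wave[of c z] sharp_eq[of c "fst (\<psi> z)"]
    by (simp add: wave_equation_def metric_rep_def inv_pos dom_def)
next
  case (15 c z w)
  let ?y = "fst (\<psi> z)" and ?d = "dG (metric_rep c) (pos c z)"
  have y: "?y \<in> fst c" using 15 by (simp add: dom_def)
  interpret smooth_metric E "snd c ` fst c" "metric_rep c" by (rule smooth_metric_rep) fact
  have vel: "fderiv (pos c) z (field_dir e1 e2 z) = sharp g c ?y (mom c z)"
    using wave[OF 15(1,2)] 15(3,4) by (simp add: wave_equation_def)
  have m: "g ?y c = metric_rep c (pos c z)"
    using 15 by (simp add: metric_rep_def[abs_def] inv_pos)
  have F: "inner_form (g ?y c)" by (rule metric_form[OF 15(1) y])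
  have kin: "g ?y c (cov_deriv_vector g c ?y u u u') w = metric_rep c (pos c z) u' w + ?d u u w - 1/2 * ?d w u u" for u u'
  proof -
    have "g ?y c (christoffel g c ?y u u) w = ?d u u w - 1/2 * ?d w u u"
      using christoffel_eq[OF 15(1) y, of u u w] by (simp add: pos_def)
    then show ?thesis
      by (simp add: cov_deriv_vector_def linear_add[OF inner_form_linear_left[OF F]] m[symmetric])
  qed
  have ext: "exterior_deriv V c ?y w = fderiv (V \<circ> chart_inv c) (pos c z) w"
    by (simp add: exterior_deriv_def pos_def)
  have "fderiv (mom c) z (field_dir e1 e2 z) \<bullet> w
      = mom c z \<bullet> christoffel g c ?y (sharp g c ?y (mom c z)) w
      + (\<Sum>k\<in>K. g ?y c (cov_deriv_vector g c ?y (fderiv (pos c) z k) (fderiv (pos c) z k)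
            (fderiv (\<lambda>z. fderiv (pos c) z k) z k)) w) - exterior_deriv V c ?y w"
  proof -
    have "wave_equation K V (field_dir e1 e2 z) c z" using wave[OF 15(1,2)] 15(3,4) by simp
    from conjunct2[OF this[unfolded wave_equation_def], THEN spec, of w]
    show ?thesis by (simp add: cov_deriv_covector_def vel)
  qed
  then show ?case
    unfolding momentum_christoffel[OF 15(1) y] kin ext vel by (simp add: pos_def)
qed (use e K open_dom cover smooth_pos smooth_mom in auto)

end


section \<open>Hamilton's equations of a potential well\<close>

text \<open>A coercivity constant at \<open>q0\<close> serves, when halved, for all nearby points, since the finitely many
  coefficients of the form are continuous.\<close>

lemma (in smooth_metric) coercive_near:
  assumes q0: "q0 \<in> S"
  obtains m where "m > 0" "\<forall>\<^sub>F q in nhds q0. q \<in> S \<and> (\<forall>w. m * (w \<bullet> w) \<le> G q w w)"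
proof -
  obtain m where m: "m > 0" "\<And>w. m * (w \<bullet> w) \<le> G q0 w w"
    by (rule inner_form_coercive[OF frame form[OF q0]], rule that) blast+
  define err where "err q = (\<Sum>e\<in>E. \<Sum>e'\<in>E. norm e * (norm e' * \<bar>G q e e' - G q0 e e'\<bar>))" for q
  have "isCont (\<lambda>q. G q u v) q0" for u v
    using smooth_on_continuous[OF smooth] open_S q0 continuous_on_eq_continuous_at by blast
  then have "isCont err q0" unfolding err_def by (intro continuous_intros)
  then have "(err \<longlongrightarrow> err q0) (nhds q0)"
    unfolding isCont_def tendsto_at_iff_tendsto_nhds .
  then have "(err \<longlongrightarrow> 0) (nhds q0)" by (simp add: err_def)
  then have ev1: "\<forall>\<^sub>F q in nhds q0. err q < m / 2"
    using m(1) by (intro order_tendstoD(2)) auto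
  have ev2: "\<forall>\<^sub>F q in nhds q0. q \<in> S" by (rule eventually_nhds_in_open[OF open_S q0])
  have "\<forall>\<^sub>F q in nhds q0. q \<in> S \<and> (\<forall>w. m / 2 * (w \<bullet> w) \<le> G q w w)"
    using ev1 ev2
  proof eventually_elim
    case (elim q)
    have "m / 2 * (w \<bullet> w) \<le> G q w w" for w
    proof -
      have "G q0 w w - G q w w = (\<Sum>e\<in>E. \<Sum>e'\<in>E. - ((w \<bullet> e) * ((w \<bullet> e') * (G q e e' - G q0 e e'))))"
        by (subst (1 2) inner_form_expand[OF frame form])
          (simp_all add: q0 elim sum_subtractf[symmetric] algebra_simps)
      also have "\<dots> \<le> (\<Sum>e\<in>E. \<Sum>e'\<in>E. (norm w * norm e) * ((norm w * norm e') * \<bar>G q e e' - G q0 e e'\<bar>))"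
      proof (intro sum_mono)
        fix e e'
        let ?s = "- ((w \<bullet> e) * ((w \<bullet> e') * (G q e e' - G q0 e e')))"
        have "?s \<le> \<bar>w \<bullet> e\<bar> * (\<bar>w \<bullet> e'\<bar> * \<bar>G q e e' - G q0 e e'\<bar>)"
          by (metis abs_mult abs_ge_minus_self)
        also have "\<dots> \<le> (norm w * norm e) * ((norm w * norm e') * \<bar>G q e e' - G q0 e e'\<bar>)"
          by (intro mult_mono Cauchy_Schwarz_ineq2 mult_nonneg_nonneg order_refl) simp_all
        finally show "?s \<le> (norm w * norm e) * ((norm w * norm e') * \<bar>G q e e' - G q0 e e'\<bar>)" .
      qed
      also have "\<dots> = (w \<bullet> w) * err q"
        by (simp add: err_def sum_distrib_left dot_square_norm power2_eq_square mult_ac)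
      also have "\<dots> \<le> (w \<bullet> w) * (m / 2)" using elim by (intro mult_left_mono) auto
      finally show ?thesis using m(2)[of w] by (simp add: algebra_simps)
    qed
    then show ?case using elim by blast
  qed
  then show ?thesis using m(1) that[of "m / 2"] by simp
qed

text \<open>Here \<open>v q p\<close> is the vector dual to \<open>p\<close>, so that \<open>p \<bullet> v q p\<close> is twice the kinetic energy. This is the
  envelope theorem: with \<open>v0\<close> fixed,
  \<open>p \<bullet> v = 2 (p \<bullet> v0) - G\<^sub>q(v0, v0) + G\<^sub>q(v - v0, v - v0)\<close>, and the last term is of second order. Thus
  the derivative is found without differentiating the inverse metric. The last term is estimated
  through the residual \<open>\<rho>\<close> that represents \<open>G\<^sub>q(v - v0, \<cdot>)\<close> and vanishes at the base point.\<close>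

lemma (in smooth_metric) has_derivative_kinetic:
  fixes v :: "'e \<Rightarrow> 'e \<Rightarrow> 'e"
  assumes q0: "q0 \<in> S" and v: "\<And>q p w. q \<in> S \<Longrightarrow> G q (v q p) w = p \<bullet> w"
  shows "((\<lambda>(q, p). p \<bullet> v q p) has_derivative
    (\<lambda>(dq, dp). 2 * (dp \<bullet> v q0 p0) - dG G q0 dq (v q0 p0) (v q0 p0))) (at (q0, p0))"
proof -
  define v0 where "v0 = v q0 p0"
  \<comment> \<open>the vector representing the covector \<open>p - G\<^sub>q(v0, \<cdot>)\<close>\<close>
  define \<rho> where "\<rho> z = snd z - (\<Sum>e\<in>E. G (fst z) v0 e *\<^sub>R e)" for z :: "'e \<times> 'e"
  define r where "r z = G (fst z) (v (fst z) (snd z) - v0) (v (fst z) (snd z) - v0)" for z :: "'e \<times> 'e"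
  have \<rho>: "\<rho> z \<bullet> w = snd z \<bullet> w - G (fst z) v0 w" if "fst z \<in> S" for z w
  proof -
    have "G (fst z) v0 w = (\<Sum>e\<in>E. (w \<bullet> e) * G (fst z) v0 e)"
      using linear_parseval_expand[OF frame inner_form_linear[OF form[OF that], of v0], of w]
      by (simp only: real_scaleR_def)
    then show ?thesis
      by (simp add: \<rho>_def inner_diff_left inner_sum_left inner_commute[of w] mult.commute)
  qed
  have dfst: "((\<lambda>z. G (fst z) v0 w) has_derivative (\<lambda>h. dG G q0 (fst h) v0 w)) (at (q0, p0))" for w
    by (rule has_derivative_compose[OF has_derivative_fst[OF has_derivative_ident]])
      (simp add: has_derivative_dG q0)
  obtain m where m: "m > 0" "\<forall>\<^sub>F q in nhds q0. q \<in> S \<and> (\<forall>w. m * (w \<bullet> w) \<le> G q w w)"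
    by (rule coercive_near[OF q0])
  have "(fst \<longlongrightarrow> q0) (nhds (q0, p0))"
    using tendsto_fst[OF filterlim_ident, of "(q0, p0)"] by simp
  then have near: "\<forall>\<^sub>F z in nhds (q0, p0). fst z \<in> S \<and> (\<forall>w. m * (w \<bullet> w) \<le> G (fst z) w w)"
    using m(2) by (rule eventually_compose_filterlim[rotated])
  have r\<rho>: "r z = \<rho> z \<bullet> (v (fst z) (snd z) - v0)" if "fst z \<in> S" for z
    unfolding r_def \<rho>[OF that]
    using linear_diff[OF inner_form_linear_left[OF form[OF that]]] v[OF that] by simp
  have \<rho>0: "\<rho> (q0, p0) = 0"
  proof -
    have "\<rho> (q0, p0) \<bullet> w = 0" for w
      using \<rho>[of "(q0, p0)" w] q0 v[OF q0, of p0 w] by (simp add: v0_def)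
    then show ?thesis using vector_eq_rdot[of "\<rho> (q0, p0)" 0] by simp
  qed
  have squeeze: "0 \<le> r z \<and> r z \<le> (\<rho> z \<bullet> \<rho> z) / m"
    if z: "fst z \<in> S" "\<forall>w. m * (w \<bullet> w) \<le> G (fst z) w w" for z
  proof
    let ?w = "v (fst z) (snd z) - v0"
    show r0: "0 \<le> r z" unfolding r_def by (rule inner_form_nonneg[OF form[OF z(1)]])
    have "m * (?w \<bullet> ?w) \<le> r z" using z(2) by (simp add: r_def)
    moreover have "r z \<le> norm (\<rho> z) * norm ?w" unfolding r\<rho>[OF z(1)] by (rule norm_cauchy_schwarz)
    ultimately have "(m * norm ?w) * norm ?w \<le> norm (\<rho> z) * norm ?w"
      by (simp add: dot_square_norm power2_eq_square mult.assoc)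
    then have "m * norm ?w \<le> norm (\<rho> z) \<or> norm ?w = 0"
      by (auto simp: mult_le_cancel_right)
    then have "m * norm ?w \<le> norm (\<rho> z)" by auto
    then have "norm ?w \<le> norm (\<rho> z) / m" using m(1) by (simp add: field_simps)
    then have "norm (\<rho> z) * norm ?w \<le> norm (\<rho> z) * (norm (\<rho> z) / m)" by (rule mult_left_mono) simp
    with \<open>r z \<le> norm (\<rho> z) * norm ?w\<close> show "r z \<le> (\<rho> z \<bullet> \<rho> z) / m"
      by (simp add: dot_square_norm power2_eq_square)
  qed
  have d\<rho>: "(\<rho> has_derivative (\<lambda>h. snd h - (\<Sum>e\<in>E. dG G q0 (fst h) v0 e *\<^sub>R e))) (at (q0, p0))"
    unfolding \<rho>_def
    by (intro has_derivative_diff has_derivative_snd has_derivative_ident has_derivative_sum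
        has_derivative_scaleR_left dfst)
  have "((\<lambda>z. (\<rho> z \<bullet> \<rho> z) / m) has_derivative (\<lambda>h. 0)) (at (q0, p0))"
    by (rule has_derivative_eq_rhs[OF bounded_linear.has_derivative[OF bounded_linear_divide has_derivative_inner[OF d\<rho> d\<rho>]]])
      (simp add: \<rho>0)
  then have dr: "(r has_derivative (\<lambda>_. 0)) (at (q0, p0))"
    by (rule has_derivative_zero_squeeze) (use near squeeze in \<open>auto simp: \<rho>0 elim: eventually_mono\<close>)
  have eq: "snd z \<bullet> v (fst z) (snd z) = 2 * (snd z \<bullet> v0) - G (fst z) v0 v0 + r z" if "fst z \<in> S" for z
  proof -
    note F = form[OF that]
    have "r z = G (fst z) (v (fst z) (snd z)) (v (fst z) (snd z)) - G (fst z) (v (fst z) (snd z)) v0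
        - (G (fst z) v0 (v (fst z) (snd z)) - G (fst z) v0 v0)"
      unfolding r_def
      by (simp add: linear_diff[OF inner_form_linear[OF F]] linear_diff[OF inner_form_linear_left[OF F]])
    then show ?thesis
      unfolding inner_form_sym[OF F, of v0 "v (fst z) (snd z)"] v[OF that] by simp
  qed
  let ?dk = "\<lambda>h. 2 * (snd h \<bullet> v0) - dG G q0 (fst h) v0 v0 + 0"
  have "((\<lambda>z. 2 * (snd z \<bullet> v0) - G (fst z) v0 v0 + r z) has_derivative ?dk) (at (q0, p0))"
    by (intro has_derivative_add has_derivative_diff has_derivative_mult_right has_derivative_inner_left
        has_derivative_snd has_derivative_ident dfst dr)
  then have "((\<lambda>z. snd z \<bullet> v (fst z) (snd z)) has_derivative ?dk) (at (q0, p0))"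
    by (rule has_derivative_transform_within_open[where s = "S \<times> UNIV"])
      (use q0 eq in \<open>auto intro!: open_Times open_S\<close>)
  then show ?thesis by (simp add: case_prod_beta' v0_def)
qed

context riemannian
begin

lemma transition_cocycle:
  assumes "c \<in> A" "c' \<in> A" "c'' \<in> A" "y \<in> fst c" "y \<in> fst c'" "y \<in> fst c''"
  shows "fderiv (transition c' c'') (snd c' y) (fderiv (transition c c') (snd c y) w)
    = fderiv (transition c c'') (snd c y) w"
proof -
  have at: "transition c c' (snd c y) = snd c' y"
    by (simp add: transition_def local_rep_def inv_coord assms)
  have d: "((\<lambda>q. transition c' c'' (transition c c' q)) has_derivative
      (\<lambda>w. fderiv (transition c' c'') (snd c' y) (fderiv (transition c c') (snd c y) w))) (at (snd c y))"
    by (rule has_derivative_compose[OF transition_derivative[of c c' y]])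
      (use assms transition_derivative[of c' c'' y] at in simp_all)
  have op: "open (snd c ` (fst c \<inter> fst c'))" by (rule transition_smooth(1)[OF assms(1,2)])
  have "(transition c c'' has_derivative
      (\<lambda>w. fderiv (transition c' c'') (snd c' y) (fderiv (transition c c') (snd c y) w))) (at (snd c y))"
    by (rule has_derivative_transform_within_open[OF d op])
      (use assms in \<open>auto simp: transition_def local_rep_def inv_coord\<close>)
  from fderiv_eq[OF this] show ?thesis by simp
qed

lemma transition_self:
  assumes "c \<in> A" "y \<in> fst c"
  shows "fderiv (transition c c) (snd c y) w = w"
proof -
  have "((\<lambda>q. q) has_derivative (\<lambda>w. w)) (at (snd c y))" by (rule has_derivative_ident)
  then have "(transition c c has_derivative (\<lambda>w. w)) (at (snd c y))"
    by (rule has_derivative_transform_within_open[OF _ chart_open[OF assms(1)]])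
      (use assms in \<open>auto simp: transition_def local_rep_def inv_coord\<close>)
  from fderiv_eq[OF this] show ?thesis by simp
qed

text \<open>Covectors are families of components in all charts; the components in one chart can be prescribed and
  are transported to the others by the cocycle of transition derivatives. Hence the
  image of a canonical chart contains all momenta, as differentiation in it requires.\<close>

lemma covector_exists:
  assumes c: "c \<in> A" and y: "y \<in> fst c"
  obtains p where "p \<in> cotangent_space A y" "p c = p0"
proof -
  define p where "p c' = (if c' \<in> A \<and> y \<in> fst c' then
      (\<Sum>e\<in>E. (p0 \<bullet> fderiv (transition c' c) (snd c' y) e) *\<^sub>R e) else 0)" for c'
  have p: "p c' \<bullet> w = p0 \<bullet> fderiv (transition c' c) (snd c' y) w" if "c' \<in> A" "y \<in> fst c'" for c' w
  proof -
    have "fderiv (transition c' c) (snd c' y) w = (\<Sum>e\<in>E. (w \<bullet> e) *\<^sub>R fderiv (transition c' c) (snd c' y) e)"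
      by (rule linear_parseval_expand[OF frame has_derivative_linear[OF transition_derivative]])
        (use that c y in auto)
    then show ?thesis
      using that by (simp add: p_def inner_sum_left inner_sum_right inner_commute[of w] mult.commute)
  qed
  show ?thesis
  proof (rule that[of p])
    show "p c = p0"
      by (rule vector_eq_rdot[THEN iffD1]) (simp add: p c y transition_self)
    show "p \<in> cotangent_space A y"
      unfolding cotangent_space_def
      using p transition_cocycle[OF _ _ c _ _ y] by (auto simp: p_def[of "_ :: ('m, 'e) chart"])
  qed
qed

lemma cotangent_eqI:
  assumes p: "p \<in> cotangent_space A y" "p' \<in> cotangent_space A y" and c: "c \<in> A" "y \<in> fst c" "p c = p' c"
  shows "p = p'"
proof
  fix c'
  show "p c' = p' c'"
  proof (cases "c' \<in> A \<and> y \<in> fst c'")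
    case True
    have *: "r c' \<bullet> w = r c \<bullet> fderiv (transition c' c) (snd c' y) w" if "r \<in> cotangent_space A y" for r w
      using that True c unfolding cotangent_space_def by blast
    have "p c' \<bullet> w = p' c' \<bullet> w" for w
      using *[OF p(1), of w] *[OF p(2), of w] c(3) by simp
    then show ?thesis using vector_eq_rdot by blast
  next
    case False
    have "r c' = 0" if "r \<in> cotangent_space A y" for r
      using that False unfolding cotangent_space_def by blast
    from this[OF p(1)] this[OF p(2)] show ?thesis by simp
  qed
qed

lemma cotangent_chart_inv:
  assumes c: "c \<in> A" and z: "z \<in> fst (cotangent_chart A c)"
  shows "chart_inv (cotangent_chart A c) (snd (cotangent_chart A c) z) = z"
proof (rule chart_inv_coord[OF _ z], rule inj_onI)
  fix z z' :: "('m, 'e) cot"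
  assume zz: "z \<in> fst (cotangent_chart A c)" "z' \<in> fst (cotangent_chart A c)"
    "snd (cotangent_chart A c) z = snd (cotangent_chart A c) z'"
  obtain q p q' p' where [simp]: "z = (q, p)" "z' = (q', p')" by (cases z, cases z')
  have m: "q \<in> fst c" "q' \<in> fst c" "p \<in> cotangent_space A q" "p' \<in> cotangent_space A q'"
    "snd c q = snd c q'" "p c = p' c"
    using zz by (auto simp: cotangent_chart_def)
  then have "q = q'" using chart_inj[OF c] by (auto dest: inj_onD)
  then show "z = z'" using cotangent_eqI[of p q p' c] m c by simp
qed

text \<open>The Hamiltonian is defined through an arbitrary choice of a chart at each point, so this is needed
  before it can be differentiated in a fixed one.\<close>

lemma kinetic_chart_independent:
  assumes c: "c \<in> A" "c' \<in> A" and y: "y \<in> fst c" "y \<in> fst c'" and p: "p \<in> cotangent_space A y"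
  shows "p c' \<bullet> sharp g c' y (p c') = p c \<bullet> sharp g c y (p c)"
proof -
  let ?T = "fderiv (transition c c') (snd c y)" and ?T' = "fderiv (transition c' c) (snd c' y)"
  have cov: "p c \<bullet> w = p c' \<bullet> ?T w" for w
    using p c y unfolding cotangent_space_def by blast
  have "sharp g c' y (p c') = ?T (sharp g c y (p c))"
  proof (rule sharp_unique[OF c(2) y(2)])
    fix w
    have w: "?T (?T' w) = w"
      using transition_cocycle[OF c(2) c(1) c(2) y(2) y(1) y(2)] transition_self[OF c(2) y(2)] by simp
    have "g y c' (?T (sharp g c y (p c))) (?T (?T' w)) = g y c (sharp g c y (p c)) (?T' w)"
      by (rule metric_change[OF c y, symmetric])
    also have "\<dots> = p c' \<bullet> ?T (?T' w)"
      unfolding sharp_eq[OF c(1) y(1)] by (rule cov)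
    finally show "g y c' (?T (sharp g c y (p c))) w = p c' \<bullet> w" unfolding w .
  qed
  then show ?thesis by (simp add: cov)
qed

lemma well_hamiltonian_chart:
  assumes c: "c \<in> A" and y: "y \<in> fst c" and p: "p \<in> cotangent_space A y"
  shows "well_hamiltonian A g V (y, p) = (p c \<bullet> sharp g c y (p c)) / 2 + V y"
proof -
  let ?c = "SOME c. c \<in> A \<and> y \<in> fst c"
  have "?c \<in> A \<and> y \<in> fst ?c" by (rule someI[of _ c]) (use c y in simp)
  then show ?thesis
    using kinetic_chart_independent[OF c _ y _ p, of ?c] by (simp add: well_hamiltonian_def Let_def)
qed

text \<open>The Hamiltonian vector field of a potential well satisfies the geodesic equation with force
  \<open>-dV\<close>, in the form in which the wave equation is stated.\<close>

theorem well_field_eq: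
  assumes V: "smooth_function A V" and c: "c \<in> A" and y: "y \<in> fst c" and p: "p \<in> cotangent_space A y"
    and X: "well_field A g V (y, p) (cotangent_chart A c) = (a, b)"
  shows "a = sharp g c y (p c)"
    and "cov_deriv_covector g c y (sharp g c y (p c)) (p c) b w = - exterior_deriv V c y w"
proof -
  interpret M: smooth_metric E "snd c ` fst c" "metric_rep c" by (rule smooth_metric_rep[OF c])
  let ?C = "cotangent_chart A c" and ?H = "well_hamiltonian A g V" and ?q = "snd c y"
  let ?v = "sharp g c y (p c)" and ?d = "dG (metric_rep c) (snd c y)"
  let ?W = "V \<circ> chart_inv c"
  let ?dH = "\<lambda>h. (1/2) * (2 * (snd h \<bullet> ?v) - ?d (fst h) ?v ?v) + fderiv ?W ?q (fst h)"
  have q: "?q \<in> snd c ` fst c" using y by blast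
  have z: "(y, p) \<in> fst ?C" using y p by (simp add: cotangent_chart_def)
  have val: "?H (chart_inv ?C (q, r)) = (r \<bullet> sharp g c (chart_inv c q) r) / 2 + ?W q"
    if "q \<in> snd c ` fst c" for q r
  proof -
    obtain y' where y': "y' \<in> fst c" "q = snd c y'" using \<open>q \<in> snd c ` fst c\<close> by blast
    obtain p' where p': "p' \<in> cotangent_space A y'" "p' c = r" by (rule covector_exists[OF c y'(1)])
    have "chart_inv ?C (snd ?C (y', p')) = (y', p')"
      by (rule cotangent_chart_inv[OF c]) (simp add: cotangent_chart_def y' p')
    then have "chart_inv ?C (q, r) = (y', p')" by (simp add: cotangent_chart_def y' p')
    then show ?thesis
      using well_hamiltonian_chart[OF c y'(1) p'(1)] by (simp add: y' p' inv_coord c)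
  qed
  have W: "(?W has_derivative fderiv ?W ?q) (at ?q)"
    by (rule smooth_on_has_derivative[OF _ q]) (use V c in \<open>simp add: smooth_function_def\<close>)
  have "((\<lambda>(q, p). p \<bullet> sharp g c (chart_inv c q) p) has_derivative
    (\<lambda>(dq, dp). 2 * (dp \<bullet> sharp g c (chart_inv c ?q) (p c))
      - ?d dq (sharp g c (chart_inv c ?q) (p c)) (sharp g c (chart_inv c ?q) (p c)))) (at (?q, p c))"
    by (rule M.has_derivative_kinetic[OF q])
      (auto simp: metric_rep_def inv_coord c sharp_eq)
  then have kin: "((\<lambda>z. snd z \<bullet> sharp g c (chart_inv c (fst z)) (snd z)) has_derivative
    (\<lambda>h. 2 * (snd h \<bullet> ?v) - ?d (fst h) ?v ?v)) (at (?q, p c))"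
    by (simp add: case_prod_beta' inv_coord c y)
  have W': "((\<lambda>z. ?W (fst z)) has_derivative (\<lambda>h. fderiv ?W ?q (fst h))) (at (?q, p c))"
    by (rule has_derivative_compose[OF has_derivative_fst[OF has_derivative_ident]]) (simp only: fst_conv W)
  have "((\<lambda>z. (1/2) * (snd z \<bullet> sharp g c (chart_inv c (fst z)) (snd z)) + ?W (fst z)) has_derivative
    ?dH) (at (?q, p c))"
    by (intro has_derivative_add has_derivative_mult_right kin W')
  then have "((?H \<circ> chart_inv ?C) has_derivative
    ?dH) (at (?q, p c))"
    by (rule has_derivative_transform_within_open[where s = "(snd c ` fst c) \<times> UNIV"])
      (use q val in \<open>auto intro!: open_Times chart_open c\<close>)
  from fderiv_eq[OF this]
  have ext: "exterior_deriv ?H ?C (y, p) Z = snd Z \<bullet> ?v - 1/2 * ?d (fst Z) ?v ?v + fderiv ?W ?q (fst Z)" for Z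
    by (simp add: exterior_deriv_def cotangent_chart_def)
  have lin: "linear (\<lambda>u. 1/2 * ?d u ?v ?v - fderiv ?W ?q u)"
    by (rule linearI)
      (simp_all add: linear_add[OF M.linear_dG[OF q]] linear_scale[OF M.linear_dG[OF q]]
        linear_add[OF has_derivative_linear[OF W]] linear_scale[OF has_derivative_linear[OF W]] algebra_simps)
  obtain b0 where b0: "\<And>u. b0 \<bullet> u = 1/2 * ?d u ?v ?v - fderiv ?W ?q u"
    using ex1_implies_ex[OF inner_form_represents[OF frame inner_form_inner lin]] by blast
  have sol: "(\<forall>Z. canonical_symplectic X Z = exterior_deriv ?H ?C (y, p) Z) \<longleftrightarrow> X = (?v, b0)" for X
  proof
    assume *: "\<forall>Z. canonical_symplectic X Z = exterior_deriv ?H ?C (y, p) Z"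
    have d0: "?d 0 ?v ?v = 0" "fderiv ?W ?q 0 = 0"
      by (rule linear_0[OF M.linear_dG[OF q]]) (rule linear_0[OF has_derivative_linear[OF W]])
    have "fst X \<bullet> u = ?v \<bullet> u" for u
      using *[rule_format, of "(0, u)"] by (simp add: canonical_symplectic_def ext d0[simplified] inner_commute)
    moreover have "snd X \<bullet> u = b0 \<bullet> u" for u
      using *[rule_format, of "(u, 0)"] by (simp add: canonical_symplectic_def ext b0)
    ultimately have "fst X = ?v" "snd X = b0"
      using vector_eq_rdot[of "fst X" ?v] vector_eq_rdot[of "snd X" b0] by simp_all
    then show "X = (?v, b0)" by (simp add: prod_eq_iff)
  qed (simp add: canonical_symplectic_def ext b0 inner_commute)
  have "well_field A g V (y, p) ?C = (?v, b0)"
    using c z unfolding well_field_def hamiltonian_field_def sol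
    by (simp add: cotangent_atlas_def)
  then have ab: "a = ?v" "b = b0" using X by auto
  show "a = ?v" by (rule ab)
  show "cov_deriv_covector g c y ?v (p c) b w = - exterior_deriv V c y w"
    unfolding cov_deriv_covector_def momentum_christoffel[OF c y] ab b0 exterior_deriv_def by simp
qed

end


section \<open>Embeddings\<close>

lemma torus_proj_periodic: "k \<in> Basis \<Longrightarrow> torus_proj (x + k) = torus_proj x"
  by (auto simp: Basis_vec_def torus_proj_eq_iff axis_def)

lemma field_dir_torus: "field_dir (axis 1 1) (axis 2 1) x = cover_field x"
  by (simp add: field_dir_def cover_field_eq)

lemma axis12_neq: "(axis 1 1 :: real ^ 2) \<noteq> axis 2 1"
  by (simp add: axis_eq_axis)

lemma flow_morphism_lift:
  assumes \<phi>: "flow_morphism torus_atlas Y_torus B Y' \<phi>" and C: "C \<in> B" "\<phi> (torus_proj x) \<in> fst C"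
  shows "fderiv (\<lambda>x. snd C (\<phi> (torus_proj x))) x (cover_field x) = Y' (\<phi> (torus_proj x)) C"
proof -
  let ?c = "torus_chart (x - vec (1/2))"
  have x: "torus_proj x \<in> fst ?c" by (rule torus_chart_domainI[OF mem_centered_box])
  have "fderiv (local_rep ?c C \<phi>) (snd ?c (torus_proj x)) (Y_torus (torus_proj x) ?c) = Y' (\<phi> (torus_proj x)) C"
    using \<phi> C x unfolding flow_morphism_def torus_atlas_def by blast
  then show ?thesis
    unfolding fderiv_local_rep_torus[OF mem_centered_box] Y_torus_eq[OF x] .
qed

text \<open>Evaluated at \<open>\<partial>\<^sub>y\<close> on the orbit \<open>x = 0\<close>, this contradicts \<open>stationary_on_orbit\<close>.\<close>

lemma immersion_lift:
  assumes \<phi>: "immersion torus_atlas B \<phi>" "smooth_map torus_atlas B \<phi>"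
    and C: "C \<in> B" "\<phi> (torus_proj x) \<in> fst C" and w: "w \<noteq> 0"
  shows "fderiv (\<lambda>x. snd C (\<phi> (torus_proj x))) x w \<noteq> 0"
proof
  let ?c = "torus_chart (x - vec (1/2))" and ?f = "fderiv (\<lambda>x. snd C (\<phi> (torus_proj x))) x"
  have x: "torus_proj x \<in> fst ?c" by (rule torus_chart_domainI[OF mem_centered_box])
  have "inj (fderiv (local_rep ?c C \<phi>) (snd ?c (torus_proj x)))"
    using \<phi>(1) C x unfolding immersion_def torus_atlas_def by blast
  then have "inj ?f" unfolding fderiv_local_rep_torus[OF mem_centered_box] .
  moreover have "?f 0 = 0"
    by (rule linear_0[OF has_derivative_linear[OF smooth_on_has_derivative[OF smooth_map_torus_lift(2)[OF \<phi>(2) C(1)]]]])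
      (simp add: C)
  moreover assume "?f w = 0"
  ultimately show False using w by (metis injD)
qed

theorem no_well_embedding:
  fixes A :: "('m, 'e::real_inner) chart set"
  assumes riem: "riemannian_manifold A g" and V: "smooth_function A V"
  shows "\<not> flow_embedding torus_atlas Y_torus (cotangent_atlas A) (well_field A g V) \<phi>"
proof
  assume "flow_embedding torus_atlas Y_torus (cotangent_atlas A) (well_field A g V) \<phi>"
  then have mor: "flow_morphism torus_atlas Y_torus (cotangent_atlas A) (well_field A g V) \<phi>"
    and imm: "immersion torus_atlas (cotangent_atlas A) \<phi>"
    by (simp_all add: flow_embedding_def)
  then have smooth: "smooth_map torus_atlas (cotangent_atlas A) \<phi>" by (simp add: flow_morphism_def)
  have man: "smooth_manifold A" using riem by (simp add: riemannian_manifold_def)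
  obtain E :: "'e set" where E: "parseval_frame E" by (rule smooth_manifold_frame[OF man])
  define \<psi> where "\<psi> x = \<phi> (torus_proj x)" for x :: "real ^ 2"
  interpret cotangent_lift A g E \<psi>
  proof
    show "\<psi> z \<in> points (cotangent_atlas A)" for z
      using smooth by (auto simp: \<psi>_def smooth_map_def torus_points)
  qed (use riem E smooth_map_torus_lift[OF smooth] in \<open>simp_all add: \<psi>_def\<close>)
  have field: "well_field A g V (fst (\<psi> z), snd (\<psi> z)) (cotangent_chart A c)
      = (fderiv (pos c) z (field_dir (axis 1 1) (axis 2 1) z), fderiv (mom c) z (field_dir (axis 1 1) (axis 2 1) z))"
    if "c \<in> A" "z \<in> dom c" for c z
    using flow_morphism_lift[OF mor, of "cotangent_chart A c" z] that
      fderiv_pair[OF that] mem_chart_iff[of z c]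
    by (simp add: cotangent_atlas_def \<psi>_def field_dir_torus)
  have "wave_cover (axis 1 1) (axis 2 1) {} A E dom pos mom (\<lambda>c. snd c ` fst c) metric_rep (\<lambda>c. V \<circ> chart_inv c)"
  proof (rule wave_cover_riemannian[OF _ _ axis12_neq _ V])
    show "\<psi> (z + k) = \<psi> z" if "k \<in> Basis" for z k
      using torus_proj_periodic[OF that] by (simp add: \<psi>_def)
    show "wave_equation {} V (field_dir (axis 1 1) (axis 2 1) z) c z" if "c \<in> A" "z \<in> dom c" for c z
      using well_field_eq[OF V that(1) _ cotangent field[OF that]] that
      by (simp add: wave_equation_def dom_def mom_def)
  qed simp_all
  then interpret W: wave_cover "axis 1 1" "axis 2 1" "{}" A E dom pos mom "\<lambda>c. snd c ` fst c" metric_rep "\<lambda>c. V \<circ> chart_inv c" .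
  obtain c where c: "c \<in> A" "0 \<in> dom c" using cover by blast
  have "fderiv (\<lambda>z. snd (cotangent_chart A c) (\<psi> z)) 0 (axis 2 1) = 0"
    using fderiv_pair[OF c] W.stationary_on_orbit[OF c] by (simp add: zero_prod_def)
  moreover have "fderiv (\<lambda>z. snd (cotangent_chart A c) (\<psi> z)) 0 (axis 2 1) \<noteq> 0"
    unfolding \<psi>_def
    by (rule immersion_lift[OF imm smooth])
      (use c mem_chart_iff[of 0 c] in \<open>auto simp: cotangent_atlas_def \<psi>_def axis_eq_0_iff\<close>)
  ultimately show False by simp
qed

lemma grad_inner:
  assumes "V differentiable (at q)" shows "grad V q \<bullet> w = fderiv V q w"
proof -
  have lin: "linear (fderiv V q)" by (rule has_derivative_linear[OF fderiv_works[OF assms]])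
  have "w = (\<Sum>i\<in>UNIV. w $ i *\<^sub>R axis i 1)"
    using basis_expansion[of w] by (simp add: scalar_mult_eq_scaleR)
  then have "fderiv V q w = fderiv V q (\<Sum>i\<in>UNIV. w $ i *\<^sub>R axis i 1)" by simp
  also have "\<dots> = (\<Sum>i\<in>UNIV. w $ i * fderiv V q (axis i 1))"
    by (simp add: linear_sum[OF lin] linear_scale[OF lin])
  finally show ?thesis by (simp add: grad_def inner_vec_def mult.commute)
qed

text \<open>A single chart and the constant metric, so that all metric derivatives vanish.\<close>

theorem wave_cover_euclidean:
  fixes \<psi> :: "'z::euclidean_space \<Rightarrow> (real ^ 'm) \<times> (real ^ 'm)" and e1 e2 :: 'z
  assumes e: "e1 \<in> Basis" "e2 \<in> Basis" "e1 \<noteq> e2" and K: "K \<subseteq> Basis - {e1}"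
    and V: "smooth_on UNIV V" and smooth: "smooth_on UNIV \<psi>"
    and periodic: "\<And>z k. k \<in> Basis \<Longrightarrow> \<psi> (z + k) = \<psi> z"
    and velocity: "\<And>z. 0 \<le> z \<bullet> e1 \<Longrightarrow> z \<bullet> e1 \<le> 1/2 \<Longrightarrow>
      fderiv (\<lambda>z. fst (\<psi> z)) z (field_dir e1 e2 z) = snd (\<psi> z)"
    and force: "\<And>z. 0 < z \<bullet> e1 \<Longrightarrow> z \<bullet> e1 < 1/2 \<Longrightarrow>
      fderiv (\<lambda>z. snd (\<psi> z)) z (field_dir e1 e2 z)
      = (\<Sum>k\<in>K. fderiv (\<lambda>z. fderiv (\<lambda>z. fst (\<psi> z)) z k) z k) - grad V (fst (\<psi> z))"
  shows "wave_cover e1 e2 K {()} Basis (\<lambda>_. UNIV) (\<lambda>_ z. fst (\<psi> z)) (\<lambda>_ z. snd (\<psi> z)) (\<lambda>_. UNIV)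
    (\<lambda>_ _. (\<bullet>)) (\<lambda>_. V)"
proof (rule wave_cover.intro, goal_cases)
  case 5
  show ?case
    by unfold_locales (auto simp: parseval_frame_Basis inner_form_inner smooth_on_const)
next
  case (15 c z w)
  have "dG (\<lambda>_. (\<bullet>)) q u v v' = 0" for q u v v' :: "real ^ 'm"
    by (simp add: dG_def)
  then show ?case
    using force[OF 15(3,4)] grad_inner[OF smooth_on_differentiable[OF V UNIV_I]]
    by (simp add: inner_diff_left inner_sum_left)
qed (use e K V periodic velocity smooth_on_bounded_linear[OF bounded_linear_fst open_UNIV smooth]
    smooth_on_bounded_linear[OF bounded_linear_snd open_UNIV smooth] in auto)

theorem no_euclidean_well_embedding:
  fixes V :: "real ^ 'm \<Rightarrow> real"
  assumes V: "smooth_on UNIV V"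
  shows "\<not> flow_embedding torus_atlas Y_torus euclidean_atlas (euclidean_well_field V) \<phi>"
proof
  assume "flow_embedding torus_atlas Y_torus euclidean_atlas (euclidean_well_field V) \<phi>"
  then have mor: "flow_morphism torus_atlas Y_torus euclidean_atlas (euclidean_well_field V) \<phi>"
    and imm: "immersion torus_atlas euclidean_atlas \<phi>"
    by (simp_all add: flow_embedding_def)
  then have map: "smooth_map torus_atlas euclidean_atlas \<phi>" by (simp add: flow_morphism_def)
  define C :: "((real ^ 'm) \<times> (real ^ 'm), (real ^ 'm) \<times> (real ^ 'm)) chart" where "C = (UNIV, \<lambda>x. x)"
  have C: "C \<in> euclidean_atlas" by (simp add: C_def euclidean_atlas_def)
  define \<psi> where "\<psi> x = \<phi> (torus_proj x)" for x :: "real ^ 2"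
  have smooth: "smooth_on UNIV \<psi>"
    using smooth_map_torus_lift(2)[OF map C] by (simp add: C_def \<psi>_def[abs_def])
  note split = fderiv_fst_snd[OF smooth_on_differentiable[OF smooth UNIV_I]]
  have "fderiv \<psi> z (cover_field z) = (snd (\<psi> z), - grad V (fst (\<psi> z)))" for z
    using flow_morphism_lift[OF mor C, of z] C
    by (simp add: C_def \<psi>_def[abs_def] euclidean_well_field_def case_prod_beta)
  then have field: "fderiv (\<lambda>z. fst (\<psi> z)) z (cover_field z) = snd (\<psi> z)"
    "fderiv (\<lambda>z. snd (\<psi> z)) z (cover_field z) = - grad V (fst (\<psi> z))" for z
    unfolding split by simp_all
  interpret W: wave_cover "axis 1 1" "axis 2 1" "{}" "{()}" Basis "\<lambda>_. UNIV" "\<lambda>_ z. fst (\<psi> z)" "\<lambda>_ z. snd (\<psi> z)"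
    "\<lambda>_. UNIV" "\<lambda>_ _. (\<bullet>)" "\<lambda>_. V"
    by (rule wave_cover_euclidean[OF _ _ axis12_neq _ V smooth])
      (simp_all add: field_dir_torus field torus_proj_periodic \<psi>_def[of "_ + _"] \<psi>_def[symmetric])
  have "fderiv \<psi> 0 (axis 2 1) = 0"
    unfolding split using W.stationary_on_orbit[of "()" 0] by (simp add: zero_prod_def)
  moreover have "fderiv (\<lambda>x. snd C (\<phi> (torus_proj x))) 0 (axis 2 1) \<noteq> 0"
    by (rule immersion_lift[OF imm map C]) (simp_all add: C_def axis_eq_0_iff)
  ultimately show False by (simp add: C_def \<psi>_def[abs_def])
qed

abbreviation ex :: "(real ^ 2) \<times> (real ^ 'd)" where "ex \<equiv> (axis 1 1, 0)"
abbreviation ey :: "(real ^ 2) \<times> (real ^ 'd)" where "ey \<equiv> (axis 2 1, 0)"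
abbreviation space_axis :: "'d \<Rightarrow> (real ^ 2) \<times> (real ^ 'd)" where "space_axis k \<equiv> (0, axis k 1)"

lemma field_dir_prod: "field_dir ex ey z = (cover_field (fst z), 0)"
  by (cases z) (simp add: field_dir_def cover_field_eq inner_axis)

lemma prod_basis: "ex \<in> Basis" "ey \<in> Basis" "(ex :: (real ^ 2) \<times> (real ^ 'd)) \<noteq> ey"
  "range (space_axis :: 'd \<Rightarrow> _) \<subseteq> Basis - {ex}"
  by (auto simp: Basis_prod_def axis_eq_axis axis_eq_0_iff zero_prod_def)

lemma sum_space_axis: "(\<Sum>k\<in>range space_axis. h k) = (\<Sum>k\<in>UNIV. h (space_axis k))"
  by (subst sum.reindex) (auto simp: inj_on_def axis_eq_axis)

lemma prod_proj_periodic: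
  assumes "k \<in> Basis"
  shows "torus_proj (fst (z + k)) = torus_proj (fst z) \<and> torus_proj (snd (z + k)) = torus_proj (snd z)"
  using assms torus_proj_periodic[of "fst k" "fst z"] torus_proj_periodic[of "snd k" "snd z"]
  by (auto simp: Basis_prod_def)

lemma has_vector_derivative_along:
  assumes F: "F differentiable (at (x, \<xi>))"
    and a: "(a has_vector_derivative v) (at 0)" "a 0 = x"
  shows "((\<lambda>s. F (a s, \<xi>)) has_vector_derivative fderiv F (x, \<xi>) (v, 0)) (at 0)"
proof -
  have F': "(F has_derivative fderiv F (x, \<xi>)) (at (x, \<xi>))" by (rule fderiv_works[OF F])
  have "((\<lambda>s. (a s, \<xi>)) has_derivative (\<lambda>h. (h *\<^sub>R v, 0))) (at 0)"
    using a(1) unfolding has_vector_derivative_def by (intro has_derivative_Pair has_derivative_const)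
  then have "((\<lambda>s. F (a s, \<xi>)) has_derivative (\<lambda>h. fderiv F (x, \<xi>) (h *\<^sub>R v, 0))) (at 0)"
    by (rule has_derivative_compose) (simp add: a(2) F')
  moreover have "fderiv F (x, \<xi>) (h *\<^sub>R v, 0) = h *\<^sub>R fderiv F (x, \<xi>) (v, 0)" for h
    using linear_scale[OF has_derivative_linear[OF F'], of h "(v, 0)"] by simp
  ultimately show ?thesis by (simp add: has_vector_derivative_def)
qed

lemma has_vector_derivative_space:
  assumes "F differentiable (at (x, \<xi> + s0 *\<^sub>R u))"
  shows "((\<lambda>s. F (x, \<xi> + s *\<^sub>R u)) has_vector_derivative fderiv F (x, \<xi> + s0 *\<^sub>R u) (0, u)) (at s0)"
proof -
  note F' = fderiv_works[OF assms]
  have "((\<lambda>s. (x, \<xi> + s *\<^sub>R u)) has_derivative (\<lambda>h. (0, h *\<^sub>R u))) (at s0)"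
    by (auto intro!: derivative_eq_intros)
  then have "((\<lambda>s. F (x, \<xi> + s *\<^sub>R u)) has_derivative (\<lambda>h. fderiv F (x, \<xi> + s0 *\<^sub>R u) (0, h *\<^sub>R u))) (at s0)"
    by (rule has_derivative_compose) (rule F')
  moreover have "fderiv F (x, \<xi> + s0 *\<^sub>R u) (0, h *\<^sub>R u) = h *\<^sub>R fderiv F (x, \<xi> + s0 *\<^sub>R u) (0, u)" for h
    using linear_scale[OF has_derivative_linear[OF F'], of h "(0, u)"] by simp
  ultimately show ?thesis by (simp add: has_vector_derivative_def)
qed

text \<open>Iterated derivatives on the torus are derivatives along the cover. Regularity is local, as \<open>q\<close> will be a
  coordinate expression in a chart of the target, with arbitrary values elsewhere.\<close>

lemma torus_partial_lift:
  fixes F :: "(real ^ 2) \<times> (real ^ 'd) \<Rightarrow> 'b::real_normed_vector"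
  assumes D: "open D" "(x, \<xi>) \<in> D" and F: "smooth_on D F"
    and q: "\<And>\<eta>. F (x, \<eta>) = q (torus_proj \<eta>)"
  shows "torus_partial k q (torus_proj \<xi>) = fderiv F (x, \<xi>) (space_axis k)"
    and "torus_partial k (torus_partial k q) (torus_proj \<xi>)
      = fderiv (\<lambda>z. fderiv F z (space_axis k)) (x, \<xi>) (space_axis k)"
proof -
  have 1: "torus_partial k q (torus_proj \<eta>) = fderiv F (x, \<eta>) (space_axis k)" if "(x, \<eta>) \<in> D" for \<eta>
    unfolding torus_partial_eq q[symmetric]
    using vector_derivative_at[OF has_vector_derivative_space[of F x \<eta> 0]]
      smooth_on_differentiable[OF F that] by simp
  then show "torus_partial k q (torus_proj \<xi>) = fderiv F (x, \<xi>) (space_axis k)" using D by simp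
  have "((\<lambda>s. fderiv F (x, \<xi> + s *\<^sub>R axis k 1) (space_axis k)) has_vector_derivative
      fderiv (\<lambda>z. fderiv F z (space_axis k)) (x, \<xi> + 0 *\<^sub>R axis k 1) (space_axis k)) (at 0)"
    by (rule has_vector_derivative_space[where F = "\<lambda>z. fderiv F z (space_axis k)"])
      (use smooth_on_differentiable[OF smooth_on_fderiv[OF F] D(2)] in simp)
  moreover have "open ((\<lambda>s. (x, \<xi> + s *\<^sub>R axis k 1)) -` D)"
    by (intro open_vimage D continuous_intros)
  ultimately have "((\<lambda>s. torus_partial k q (torus_proj (\<xi> + s *\<^sub>R axis k 1))) has_vector_derivative
      fderiv (\<lambda>z. fderiv F z (space_axis k)) (x, \<xi> + 0 *\<^sub>R axis k 1) (space_axis k)) (at 0)"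
    by (rule has_vector_derivative_transform_within_open) (use D 1 in auto)
  then show "torus_partial k (torus_partial k q) (torus_proj \<xi>)
      = fderiv (\<lambda>z. fderiv F z (space_axis k)) (x, \<xi>) (space_axis k)"
    unfolding torus_partial_eq[of k "torus_partial k q"] using vector_derivative_at by fastforce
qed

text \<open>The equations of motion are known along trajectories only; an explicit trajectory through each
  point of the strip turns them into differential equations for the embedding.\<close>

lemma field_embedding_trajectory:
  assumes \<phi>: "field_embedding torus_atlas Y_torus B sol \<phi>" and x: "0 \<le> x $ 1" "x $ 1 \<le> 1/2"
  obtains a where "a 0 = x" "(a has_vector_derivative cover_field x) (at 0)"
    "sol UNIV (\<lambda>t. \<phi> (torus_proj (a t)))"
proof -
  obtain a where a: "a 0 = x" "\<And>t. (a has_vector_derivative cover_field (a t)) (at t)"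
    by (rule cover_trajectory_exists[OF x]) blast
  have "trajectory torus_atlas Y_torus UNIV (\<lambda>t. torus_proj (a t))"
    by (rule torus_trajectory[OF a(2)])
  then have "sol UNIV (\<lambda>t. \<phi> (torus_proj (a t)))"
    using \<phi> unfolding field_embedding_def by blast
  then show ?thesis using that a(1) a(2)[of 0] by simp
qed

text \<open>Like \<open>immersion_lift\<close>, this is what \<open>stationary_on_orbit\<close> contradicts; the spatial point is the
  one at which the infinitesimal variation of the field is nonzero.\<close>

lemma field_embedding_immersion:
  fixes \<phi> :: "circle ^ 2 \<Rightarrow> circle ^ 'd \<Rightarrow> 'b"
  assumes \<phi>: "field_embedding torus_atlas Y_torus B sol \<phi>"
  obtains \<xi> C where "C \<in> B" "\<phi> (torus_proj 0) (torus_proj \<xi>) \<in> fst C"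
    "fderiv (\<lambda>z. snd C (\<phi> (torus_proj (fst z)) (torus_proj (snd z)))) (0, \<xi>) ey \<noteq> 0"
proof -
  let ?c = "torus_chart (0 - vec (1/2) :: real ^ 2)"
  have imm: "\<forall>c\<in>torus_atlas. \<forall>y\<in>fst c. \<forall>w. w \<noteq> 0 \<longrightarrow>
       (\<exists>x. \<exists>c'\<in>B. \<phi> y x \<in> fst c' \<and> fderiv (local_rep c c' (\<lambda>y. \<phi> y x)) (snd c y) w \<noteq> 0)"
    using \<phi> unfolding field_embedding_def by (elim conjE)
  have map: "smooth_map (prod_atlas torus_atlas torus_atlas) B (\<lambda>(y, x). \<phi> y x)"
    using \<phi> unfolding field_embedding_def by (elim conjE)
  have c: "?c \<in> torus_atlas" "torus_proj 0 \<in> fst ?c"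
    by (auto simp only: torus_atlas_def torus_chart_domainI[OF mem_centered_box])
  have "axis 2 1 \<noteq> (0 :: real ^ 2)" by (simp add: axis_eq_0_iff)
  with imm c obtain x C where C: "C \<in> B" "\<phi> (torus_proj 0) x \<in> fst C"
    "fderiv (local_rep ?c C (\<lambda>y. \<phi> y x)) (snd ?c (torus_proj 0)) (axis 2 1) \<noteq> 0"
    by blast
  obtain \<xi> :: "real ^ 'd" where \<xi>: "torus_proj \<xi> = x" using torus_proj_surj by blast
  let ?F = "\<lambda>z. snd C (\<phi> (torus_proj (fst z)) (torus_proj (snd z)))"
  have "?F differentiable (at (0, \<xi>))"
    using smooth_on_differentiable[OF smooth_map_prod_torus_lift(2)[OF map C(1)], of "(0, \<xi>)"] C(2) \<xi> by simp
  then have "(?F has_derivative fderiv ?F (0, \<xi>)) (at (0, \<xi>))" by (rule fderiv_works)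
  moreover have "((\<lambda>y. (y, \<xi>)) has_derivative (\<lambda>v. (v, 0))) (at 0)"
    by (intro has_derivative_Pair has_derivative_ident has_derivative_const)
  ultimately have "((\<lambda>y. ?F (y, \<xi>)) has_derivative (\<lambda>v. fderiv ?F (0, \<xi>) (v, 0))) (at 0)"
    by (rule has_derivative_compose[rotated])
  from fderiv_eq[OF this] have "fderiv (\<lambda>y. snd C (\<phi> (torus_proj y) x)) 0 (axis 2 1) = fderiv ?F (0, \<xi>) ey"
    by (simp add: \<xi>)
  then have "fderiv ?F (0, \<xi>) ey \<noteq> 0"
    using C(3) unfolding fderiv_local_rep_torus[OF mem_centered_box] by simp
  then show ?thesis using that C \<xi> by blast
qed

theorem no_euclidean_nlw_embedding:
  fixes V :: "real ^ 'm \<Rightarrow> real" and \<phi> :: "circle ^ 2 \<Rightarrow> circle ^ 'd \<Rightarrow> (real ^ 'm) \<times> (real ^ 'm)"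
  assumes V: "smooth_on UNIV V"
  shows "\<not> field_embedding torus_atlas Y_torus euclidean_atlas (euclidean_nlw_solution V) \<phi>"
proof
  assume emb: "field_embedding torus_atlas Y_torus euclidean_atlas (euclidean_nlw_solution V) \<phi>"
  then have map: "smooth_map (prod_atlas torus_atlas torus_atlas) euclidean_atlas (\<lambda>(y, x). \<phi> y x)"
    unfolding field_embedding_def by (elim conjE)
  define C :: "((real ^ 'm) \<times> (real ^ 'm), (real ^ 'm) \<times> (real ^ 'm)) chart" where "C = (UNIV, \<lambda>x. x)"
  have C: "C \<in> euclidean_atlas" by (simp add: C_def euclidean_atlas_def)
  define \<psi> where "\<psi> z = \<phi> (torus_proj (fst z)) (torus_proj (snd z))" for z :: "(real ^ 2) \<times> (real ^ 'd)"
  have smooth: "smooth_on UNIV \<psi>"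
    using smooth_map_prod_torus_lift(2)[OF map C] by (simp add: C_def \<psi>_def[abs_def])
  have sQ: "smooth_on UNIV (\<lambda>z. fst (\<psi> z))" and sP: "smooth_on UNIV (\<lambda>z. snd (\<psi> z))"
    by (rule smooth_on_bounded_linear[OF bounded_linear_fst open_UNIV smooth],
        rule smooth_on_bounded_linear[OF bounded_linear_snd open_UNIV smooth])
  have eqs: "fderiv (\<lambda>z. fst (\<psi> z)) z (field_dir ex ey z) = snd (\<psi> z) \<and>
      fderiv (\<lambda>z. snd (\<psi> z)) z (field_dir ex ey z)
      = (\<Sum>k\<in>range space_axis. fderiv (\<lambda>z. fderiv (\<lambda>z. fst (\<psi> z)) z k) z k) - grad V (fst (\<psi> z))"
    if z: "0 \<le> z \<bullet> ex" "z \<bullet> ex \<le> 1/2" for z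
  proof -
    obtain x \<xi> where z_eq: "z = (x, \<xi>)" by (cases z)
    have x: "0 \<le> x $ 1" "x $ 1 \<le> 1/2" using z by (simp_all add: z_eq inner_axis)
    obtain a where a: "a 0 = x" "(a has_vector_derivative cover_field x) (at 0)"
      "euclidean_nlw_solution V UNIV (\<lambda>t. \<phi> (torus_proj (a t)))"
      by (rule field_embedding_trajectory[OF emb x])
    have sol: "((\<lambda>s. fst (\<psi> (a s, \<xi>))) has_vector_derivative snd (\<psi> (x, \<xi>))) (at 0)"
      "((\<lambda>s. snd (\<psi> (a s, \<xi>))) has_vector_derivative
          (\<Sum>k\<in>UNIV. torus_partial k (torus_partial k (\<lambda>\<eta>. fst (\<phi> (torus_proj x) \<eta>))) (torus_proj \<xi>))
          - grad V (fst (\<psi> (x, \<xi>)))) (at 0)"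
    proof -
      have "\<forall>t\<in>UNIV. \<forall>x. ((\<lambda>s. fst (\<phi> (torus_proj (a s)) x)) has_vector_derivative
            snd (\<phi> (torus_proj (a t)) x)) (at t within UNIV) \<and>
          ((\<lambda>s. snd (\<phi> (torus_proj (a s)) x)) has_vector_derivative
            (\<Sum>k\<in>UNIV. torus_partial k (torus_partial k (\<lambda>x. fst (\<phi> (torus_proj (a t)) x))) x)
            - grad V (fst (\<phi> (torus_proj (a t)) x))) (at t within UNIV)"
        using a(3) unfolding euclidean_nlw_solution_def by (elim conjE)
      from spec[OF bspec[OF this UNIV_I[of 0]], of "torus_proj \<xi>"]
      show "((\<lambda>s. fst (\<psi> (a s, \<xi>))) has_vector_derivative snd (\<psi> (x, \<xi>))) (at 0)"
        "((\<lambda>s. snd (\<psi> (a s, \<xi>))) has_vector_derivative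
          (\<Sum>k\<in>UNIV. torus_partial k (torus_partial k (\<lambda>\<eta>. fst (\<phi> (torus_proj x) \<eta>))) (torus_proj \<xi>))
          - grad V (fst (\<psi> (x, \<xi>)))) (at 0)"
        by (simp_all add: \<psi>_def a(1))
    qed
    have "torus_partial k (torus_partial k (\<lambda>\<eta>. fst (\<phi> (torus_proj x) \<eta>))) (torus_proj \<xi>)
        = fderiv (\<lambda>z. fderiv (\<lambda>z. fst (\<psi> z)) z (space_axis k)) (x, \<xi>) (space_axis k)" for k
      by (rule torus_partial_lift(2)[OF open_UNIV UNIV_I sQ]) (simp add: \<psi>_def)
    then have sol2: "((\<lambda>s. snd (\<psi> (a s, \<xi>))) has_vector_derivative
          (\<Sum>k\<in>UNIV. fderiv (\<lambda>z. fderiv (\<lambda>z. fst (\<psi> z)) z (space_axis k)) (x, \<xi>) (space_axis k))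
          - grad V (fst (\<psi> (x, \<xi>)))) (at 0)"
      using sol(2) by simp
    show ?thesis
      unfolding z_eq field_dir_prod sum_space_axis fst_conv
      by (intro conjI)
        (rule vector_derivative_unique_at[OF has_vector_derivative_along[OF smooth_on_differentiable[OF sQ UNIV_I] a(2,1)] sol(1)],
         rule vector_derivative_unique_at[OF has_vector_derivative_along[OF smooth_on_differentiable[OF sP UNIV_I] a(2,1)] sol2])
  qed
  interpret W: wave_cover ex ey "range space_axis" "{()}" Basis "\<lambda>_. UNIV" "\<lambda>_ z. fst (\<psi> z)" "\<lambda>_ z. snd (\<psi> z)"
    "\<lambda>_. UNIV" "\<lambda>_ _. (\<bullet>)" "\<lambda>_. V"
  proof (rule wave_cover_euclidean[OF prod_basis V smooth])
    show "\<psi> (z + k) = \<psi> z" if "k \<in> Basis" for z k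
      unfolding \<psi>_def using prod_proj_periodic[OF that, of z] by simp
  qed (use eqs in auto)
  obtain \<xi> C' where imm: "C' \<in> euclidean_atlas"
    "fderiv (\<lambda>z. snd C' (\<phi> (torus_proj (fst z)) (torus_proj (snd z)))) (0, \<xi>) ey \<noteq> 0"
    by (rule field_embedding_immersion[OF emb])
  have "fderiv \<psi> (0, \<xi>) ey = 0"
    unfolding fderiv_fst_snd[OF smooth_on_differentiable[OF smooth UNIV_I]]
    using W.stationary_on_orbit[of "()" "(0, \<xi>)"] by (simp add: zero_prod_def)
  then show False using imm by (simp add: euclidean_atlas_def \<psi>_def[abs_def])
qed

theorem no_nlw_embedding:
  fixes A :: "('m, 'e::real_inner) chart set" and \<phi> :: "circle ^ 2 \<Rightarrow> circle ^ 'd \<Rightarrow> ('m, 'e) cot"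
  assumes riem: "riemannian_manifold A g" and V: "smooth_function A V"
  shows "\<not> field_embedding torus_atlas Y_torus (cotangent_atlas A) (nlw_solution A g V) \<phi>"
proof
  assume emb: "field_embedding torus_atlas Y_torus (cotangent_atlas A) (nlw_solution A g V) \<phi>"
  then have map: "smooth_map (prod_atlas torus_atlas torus_atlas) (cotangent_atlas A) (\<lambda>(y, x). \<phi> y x)"
    unfolding field_embedding_def by (elim conjE)
  have man: "smooth_manifold A" using riem by (simp add: riemannian_manifold_def)
  obtain E :: "'e set" where E: "parseval_frame E" by (rule smooth_manifold_frame[OF man])
  define \<psi> where "\<psi> z = \<phi> (torus_proj (fst z)) (torus_proj (snd z))" for z :: "(real ^ 2) \<times> (real ^ 'd)"
  interpret cotangent_lift A g E \<psi>
  proof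
    show "\<psi> z \<in> points (cotangent_atlas A)" for z
    proof -
      have img: "(\<lambda>(y, x). \<phi> y x) ` points (prod_atlas torus_atlas torus_atlas) \<subseteq> points (cotangent_atlas A)"
        using map unfolding smooth_map_def by (elim conjE)
      from img torus_prod_points[of "torus_proj (fst z)" "torus_proj (snd z)"]
      show ?thesis unfolding \<psi>_def by (auto dest: subsetD[OF _ imageI])
    qed
  qed (use riem E smooth_map_prod_torus_lift[OF map] in \<open>simp_all add: \<psi>_def\<close>)
  have wave: "wave_equation (range space_axis) V (field_dir ex ey z) c z"
    if c: "c \<in> A" "z \<in> dom c" and z: "0 \<le> z \<bullet> ex" "z \<bullet> ex \<le> 1/2" for c z
  proof -
    obtain x \<xi> where z_eq: "z = (x, \<xi>)" by (cases z)
    have x: "0 \<le> x $ 1" "x $ 1 \<le> 1/2" using z by (simp_all add: z_eq inner_axis)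
    obtain a where a: "a 0 = x" "(a has_vector_derivative cover_field x) (at 0)"
      "nlw_solution A g V UNIV (\<lambda>t. \<phi> (torus_proj (a t)))"
      by (rule field_embedding_trajectory[OF emb x])
    let ?y = "fst (\<psi> z)"
    have y: "fst (\<phi> (torus_proj (a 0)) (torus_proj \<xi>)) \<in> fst c"
      using c by (simp add: a(1) dom_def \<psi>_def z_eq)
    have part: "torus_partial k (\<lambda>\<eta>. snd c (fst (\<phi> (torus_proj x) \<eta>))) (torus_proj \<xi>) = fderiv (pos c) (x, \<xi>) (space_axis k)"
      "torus_partial k (torus_partial k (\<lambda>\<eta>. snd c (fst (\<phi> (torus_proj x) \<eta>)))) (torus_proj \<xi>)
        = fderiv (\<lambda>z. fderiv (pos c) z (space_axis k)) (x, \<xi>) (space_axis k)" for k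
      by (rule torus_partial_lift[OF open_dom[OF c(1)] c(2)[unfolded z_eq] smooth_pos[OF c(1)]],
          simp add: pos_def \<psi>_def)+
    have sol: "((\<lambda>s. pos c (a s, \<xi>)) has_vector_derivative sharp g c ?y (mom c z)) (at 0) \<and>
      (\<exists>Pt. ((\<lambda>s. mom c (a s, \<xi>)) has_vector_derivative Pt) (at 0) \<and>
        (\<forall>w. cov_deriv_covector g c ?y (sharp g c ?y (mom c z)) (mom c z) Pt w
          = (\<Sum>k\<in>UNIV. g ?y c (cov_deriv_vector g c ?y (fderiv (pos c) (x, \<xi>) (space_axis k)) (fderiv (pos c) (x, \<xi>) (space_axis k))
            (fderiv (\<lambda>z. fderiv (pos c) z (space_axis k)) (x, \<xi>) (space_axis k))) w) - exterior_deriv V c ?y w))"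
      using a(3) y c(1) unfolding nlw_solution_def Let_def
      by (elim conjE) (drule bspec[OF _ UNIV_I, of _ 0], drule spec[of _ "torus_proj \<xi>"],
          drule bspec[OF _ c(1)], simp add: a(1) part z_eq pos_def mom_def \<psi>_def)
    have vel: "fderiv (pos c) (x, \<xi>) (cover_field x, 0) = sharp g c ?y (mom c z)"
      using vector_derivative_unique_at[OF has_vector_derivative_along[OF smooth_on_differentiable[OF smooth_pos[OF c(1)] c(2)[unfolded z_eq]] a(2,1)]] sol
      by blast
    have mom: "Pt = fderiv (mom c) (x, \<xi>) (cover_field x, 0)"
      if "((\<lambda>s. mom c (a s, \<xi>)) has_vector_derivative Pt) (at 0)" for Pt
      by (rule vector_derivative_unique_at[OF that has_vector_derivative_along[OF smooth_on_differentiable[OF smooth_mom[OF c(1)] c(2)[unfolded z_eq]] a(2,1)]])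
    show ?thesis
      using sol mom vel unfolding wave_equation_def field_dir_prod sum_space_axis z_eq fst_conv by auto
  qed
  have "wave_cover ex ey (range space_axis) A E dom pos mom (\<lambda>c. snd c ` fst c) metric_rep (\<lambda>c. V \<circ> chart_inv c)"
  proof (rule wave_cover_riemannian[OF prod_basis V])
    show "\<psi> (z + k) = \<psi> z" if "k \<in> Basis" for z k
      unfolding \<psi>_def using prod_proj_periodic[OF that, of z] by simp
  qed (rule wave)
  then interpret W: wave_cover ex ey "range space_axis" A E dom pos mom "\<lambda>c. snd c ` fst c" metric_rep "\<lambda>c. V \<circ> chart_inv c" .
  obtain \<xi> C where imm: "C \<in> cotangent_atlas A" "\<psi> (0, \<xi>) \<in> fst C" "fderiv (\<lambda>z. snd C (\<psi> z)) (0, \<xi>) ey \<noteq> 0"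
    by (rule field_embedding_immersion[OF emb]) (simp add: \<psi>_def)
  then obtain c where c: "c \<in> A" "C = cotangent_chart A c" by (auto simp: cotangent_atlas_def)
  have z: "(0, \<xi>) \<in> dom c" using imm(2) mem_chart_iff c by simp
  have "fderiv (\<lambda>z. snd C (\<psi> z)) (0, \<xi>) ey = 0"
    unfolding c(2) fderiv_pair[OF c(1) z]
    using W.stationary_on_orbit[OF c(1) z] by (simp add: zero_prod_def)
  then show False using imm(3) by simp
qed

theorem proposition1p9:
  shows "compact_flow torus_atlas Y_torus \<and>
    nonsingular torus_atlas Y_torus \<and>
    (\<nexists>\<theta>. strongly_adapted torus_atlas Y_torus \<theta>) \<and>
    (\<forall>V :: real ^ 'm \<Rightarrow> real. smooth_on UNIV V \<longrightarrow>
      (\<nexists>\<phi>. flow_embedding torus_atlas Y_torus euclidean_atlas (euclidean_well_field V) \<phi>)) \<and>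
    (\<forall>(A :: ('q, 'e::real_inner) chart set) g V.
      riemannian_manifold A g \<longrightarrow> smooth_function A V \<longrightarrow>
      (\<nexists>\<phi>. flow_embedding torus_atlas Y_torus (cotangent_atlas A) (well_field A g V) \<phi>)) \<and>
    (\<forall>V :: real ^ 'm \<Rightarrow> real. smooth_on UNIV V \<longrightarrow>
      (\<nexists>\<phi> :: circle ^ 2 \<Rightarrow> circle ^ 'd \<Rightarrow> (real ^ 'm) \<times> (real ^ 'm).
        field_embedding torus_atlas Y_torus euclidean_atlas (euclidean_nlw_solution V) \<phi>)) \<and>
    (\<forall>(A :: ('q, 'e) chart set) g V.
      riemannian_manifold A g \<longrightarrow> smooth_function A V \<longrightarrow>
      (\<nexists>\<phi> :: circle ^ 2 \<Rightarrow> circle ^ 'd \<Rightarrow> ('q, 'e) cot.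
        field_embedding torus_atlas Y_torus (cotangent_atlas A) (nlw_solution A g V) \<phi>))"
  by (intro conjI allI impI)
    (simp_all add: compact_flow_torus nonsingular_torus no_strongly_adapted_form
      no_euclidean_well_embedding no_well_embedding no_euclidean_nlw_embedding no_nlw_embedding)

end
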